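(* Assume that $\mathcal A$ is bounded. Then the process $\mathcal V(t)=Y(t)^{\otimes2}$ satisfies $$d\mathcal V(t)=\left(\mathcal A\mathcal V(t)\mathcal A^*+\mathcal V(t)-(\mathcal A-\mathrm{Id})\mathcal V(t)(\mathcal A^*-\mathrm{Id})+\eta Q_W\eta^*\right)dt+|\eta(\cdot)|\left(\Gamma_{\eta(\cdot)/|\eta(\cdot)|}(t)+\Gamma^*_{\eta(\cdot)/|\eta(\cdot)|}(t)\right)dW(t),$$ where $\mathrm{Id}$ is the identity operator on $H$ and, for $z\in H$ with $|z|=1$, $\Gamma_z(t):=z\otimes Y(t)$.
   Context: $(\Omega,\mathcal F,\{\mathcal F_t\}_{t\ge0},\mathbb P)$ is a filtered probability space. $H$ is a real separable Hilbert space with inner product $\langle\cdot,\cdot\rangle$ and norm $|\cdot|$; $L(H)$ is the space of bounded linear operators on $H$; $\mathcal H=L_{HS}(H)$ is the Hilbert space of Hilbert-Schmidt operators on $H$, in which the equation for $\mathcal V$ is understood. For $f,g\in H$ the tensor product is the operator $f\otimes g:=\langle f,\cdot\rangle g$, and $f^{\otimes2}:=f\otimes f$. $\{W(t)\}_{t\ge0}$ is an $H$-valued $\mathcal F_t$-Wiener process with covariance operator $Q_W$ (symmetric, positive definite, trace class), $\eta\in L(H)$, $Y_0\in H$. $\{Y(t)\}_{t\ge0}$ is the solution of $dY(t)=\mathcal AY(t)\,dt+\eta\,dW(t)$, $Y(0)=Y_0$; when $\mathcal A\in L(H)$ this is a strong solution. The tensor Heston stochastic variance process is $\mathcal V(t):=Y(t)^{\otimes2}$.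 For $z\in H$ with $|z|=1$, $\Gamma_z(t)=z\otimes Y(t)$ has adjoint $\Gamma_z^*(t)=Y(t)\otimes z$ and satisfies $\mathcal V(t)=\Gamma_z(t)\Gamma_z^*(t)$. The diffusion coefficient is the linear operator from $H$ to $\mathcal H$ given by $f\mapsto|\eta(f)|\left(\Gamma_{\eta(f)/|\eta(f)|}(t)+\Gamma^*_{\eta(f)/|\eta(f)|}(t)\right)$ if $\eta(f)\ne0$ and $f\mapsto0$ if $\eta(f)=0$. *)

theory Defs
  imports "HOL-Probability.Probability"
begin

definition orthonormal :: "'a::real_inner set \<Rightarrow> bool" where
  "orthonormal B \<longleftrightarrow> pairwise orthogonal B \<and> (\<forall>e\<in>B. norm e = 1)"

definition orthonormal_basis :: "'a::real_inner set \<Rightarrow> bool" where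
  "orthonormal_basis B \<longleftrightarrow> orthonormal B \<and> closure (span B) = UNIV"

definition onb :: "'a::real_inner set" where
  "onb = (SOME B. countable B \<and> orthonormal_basis B)"

lemma orthonormalD:
  assumes "orthonormal B" "e \<in> B" "f \<in> B"
  shows "e \<bullet> f = (if e = f then 1 else 0)"
  using assms by (auto simp: orthonormal_def pairwise_def orthogonal_def norm_eq_1)

lemma orthonormal_inner_sum:
  assumes "orthonormal B" "finite F" "F \<subseteq> B" "e \<in> F"
  shows "(\<Sum>f\<in>F. c f *\<^sub>R f) \<bullet> e = c e"
proof -
  have "(\<Sum>f\<in>F. c f *\<^sub>R f) \<bullet> e = (\<Sum>f\<in>F. if f = e then c f else 0)"
    unfolding inner_sum_left
    by (rule sum.cong) (use assms in \<open>auto simp: orthonormalD[OF assms(1)] subset_iff\<close>)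
  then show ?thesis using assms by simp
qed

lemma orthonormal_norm_sum:
  assumes "orthonormal B" "finite F" "F \<subseteq> B"
  shows "(norm (\<Sum>f\<in>F. c f *\<^sub>R f))\<^sup>2 = (\<Sum>f\<in>F. (c f)\<^sup>2)"
proof -
  have "(norm (\<Sum>f\<in>F. c f *\<^sub>R f))\<^sup>2 = (\<Sum>e\<in>F. c e * ((\<Sum>f\<in>F. c f *\<^sub>R f) \<bullet> e))"
    by (simp add: power2_norm_eq_inner inner_sum_right)
  also have "\<dots> = (\<Sum>f\<in>F. (c f)\<^sup>2)"
    by (rule sum.cong) (simp_all add: orthonormal_inner_sum[OF assms] power2_eq_square)
  finally show ?thesis .
qed

lemma orthonormal_diff:
  assumes "orthonormal B" "finite F" "F \<subseteq> B"
  shows "(norm (x - (\<Sum>f\<in>F. (x \<bullet> f) *\<^sub>R f)))\<^sup>2 = (norm x)\<^sup>2 - (\<Sum>f\<in>F. (x \<bullet> f)\<^sup>2)"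
proof -
  let ?p = "\<Sum>f\<in>F. (x \<bullet> f) *\<^sub>R f"
  have "x \<bullet> ?p = (\<Sum>f\<in>F. (x \<bullet> f)\<^sup>2)"
    by (simp add: inner_sum_right power2_eq_square)
  moreover have "?p \<bullet> ?p = (\<Sum>f\<in>F. (x \<bullet> f)\<^sup>2)"
    using orthonormal_norm_sum[OF assms, of "\<lambda>f. x \<bullet> f"] by (simp add: power2_norm_eq_inner)
  ultimately show ?thesis
    by (simp add: power2_norm_eq_inner inner_diff_left inner_diff_right inner_commute)
qed

lemma Bessel_finite:
  assumes "orthonormal B" "finite F" "F \<subseteq> B"
  shows "(\<Sum>f\<in>F. (x \<bullet> f)\<^sup>2) \<le> (norm x)\<^sup>2"
  using orthonormal_diff[OF assms, of x] zero_le_power2[of "norm (x - (\<Sum>f\<in>F. (x \<bullet> f) *\<^sub>R f))"]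
  by linarith

lemma Bessel_summable:
  assumes "orthonormal B"
  shows "(\<lambda>f. (x \<bullet> f)\<^sup>2) summable_on B"
  by (rule nonneg_bdd_above_summable_on)
     (auto intro!: bdd_aboveI2[where M="(norm x)\<^sup>2"] Bessel_finite[OF assms])

lemma onb_approx:
  assumes B: "orthonormal_basis B" and "\<epsilon> > 0"
  obtains F where "finite F" "F \<subseteq> B" "norm (x - (\<Sum>f\<in>F. (x \<bullet> f) *\<^sub>R f)) < \<epsilon>"
proof -
  have on: "orthonormal B" using B by (simp add: orthonormal_basis_def)
  have "x \<in> closure (span B)" using B by (simp add: orthonormal_basis_def)
  then obtain y where y: "y \<in> span B" "dist y x < \<epsilon>"
    using \<open>\<epsilon> > 0\<close> by (auto simp: closure_approachable)
  from y(1) obtain F c where F: "finite F" "F \<subseteq> B" "y = (\<Sum>f\<in>F. c f *\<^sub>R f)"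
    unfolding span_explicit by auto
  let ?p = "\<Sum>f\<in>F. (x \<bullet> f) *\<^sub>R f"
  have orth: "(x - ?p) \<bullet> f = 0" if "f \<in> F" for f
    using orthonormal_inner_sum[OF on F(1,2) that, of "\<lambda>f. x \<bullet> f"]
    by (simp add: inner_diff_left)
  have "(x - ?p) \<bullet> (?p - y) = 0"
    by (simp add: F(3) inner_diff_right inner_sum_right orth)
  then have "(norm ((x - ?p) + (?p - y)))\<^sup>2 = (norm (x - ?p))\<^sup>2 + (norm (?p - y))\<^sup>2"
    by (intro norm_add_Pythagorean) (simp add: orthogonal_def)
  then have "(norm (x - ?p))\<^sup>2 \<le> (norm (x - y))\<^sup>2" by simp
  then have "norm (x - ?p) \<le> norm (x - y)" by (simp add: power2_le_iff_abs_le)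
  then show ?thesis using that F y(2) by (auto simp: dist_norm norm_minus_commute)
qed

lemma Parseval:
  assumes B: "orthonormal_basis B"
  shows "(\<Sum>\<^sub>\<infinity>f\<in>B. (x \<bullet> f)\<^sup>2) = (norm x)\<^sup>2"
proof (rule antisym)
  have on: "orthonormal B" using B by (simp add: orthonormal_basis_def)
  show "(\<Sum>\<^sub>\<infinity>f\<in>B. (x \<bullet> f)\<^sup>2) \<le> (norm x)\<^sup>2"
    by (rule infsum_le_finite_sums[OF Bessel_summable[OF on]]) (rule Bessel_finite[OF on])
  show "(norm x)\<^sup>2 \<le> (\<Sum>\<^sub>\<infinity>f\<in>B. (x \<bullet> f)\<^sup>2)"
  proof (rule field_le_epsilon)
    fix \<epsilon> :: real assume "\<epsilon> > 0"
    then obtain F where F: "finite F" "F \<subseteq> B" "norm (x - (\<Sum>f\<in>F. (x \<bullet> f) *\<^sub>R f)) < sqrt \<epsilon>"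
      using onb_approx[OF B, of "sqrt \<epsilon>" x] by auto
    have "(norm (x - (\<Sum>f\<in>F. (x \<bullet> f) *\<^sub>R f)))\<^sup>2 \<le> (sqrt \<epsilon>)\<^sup>2"
      using F(3) by (intro power_mono) auto
    then have "(norm x)\<^sup>2 \<le> (\<Sum>f\<in>F. (x \<bullet> f)\<^sup>2) + \<epsilon>"
      using orthonormal_diff[OF on F(1,2), of x] \<open>\<epsilon> > 0\<close> by simp
    also have "(\<Sum>f\<in>F. (x \<bullet> f)\<^sup>2) \<le> (\<Sum>\<^sub>\<infinity>f\<in>B. (x \<bullet> f)\<^sup>2)"
      by (rule finite_sum_le_infsum[OF Bessel_summable[OF on] F(1,2)]) simp
    finally show "(norm x)\<^sup>2 \<le> (\<Sum>\<^sub>\<infinity>f\<in>B. (x \<bullet> f)\<^sup>2) + \<epsilon>" by simp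
  qed
qed

text \<open>Gram--Schmidt orthonormalisation of a sequence; linearly dependent terms are skipped.\<close>

fun gs :: "(nat \<Rightarrow> 'a::real_inner) \<Rightarrow> nat \<Rightarrow> 'a set" where
  "gs d 0 = {}"
| "gs d (Suc n) = (let r = d n - (\<Sum>e\<in>gs d n. (d n \<bullet> e) *\<^sub>R e)
                   in if r = 0 then gs d n else insert (r /\<^sub>R norm r) (gs d n))"

lemma gs_orthonormal: "finite (gs d n) \<and> orthonormal (gs d n)"
proof (induction n)
  case 0 then show ?case by (simp add: orthonormal_def)
next
  case (Suc n)
  let ?r = "d n - (\<Sum>e\<in>gs d n. (d n \<bullet> e) *\<^sub>R e)"
  have "?r \<bullet> e = 0" if "e \<in> gs d n" for e
    using orthonormal_inner_sum[of "gs d n" "gs d n" e "\<lambda>e. d n \<bullet> e"] Suc that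
    by (simp add: inner_diff_left)
  then have "(?r /\<^sub>R norm ?r) \<bullet> e = 0" if "e \<in> gs d n" for e using that by simp
  then show ?case
    using Suc by (auto simp: Let_def orthonormal_def pairwise_insert orthogonal_def inner_commute)
qed

lemma gs_span: "d n \<in> span (gs d (Suc n))"
proof -
  let ?p = "\<Sum>e\<in>gs d n. (d n \<bullet> e) *\<^sub>R e"
  let ?r = "d n - ?p"
  have p: "?p \<in> span (gs d (Suc n))"
    by (intro span_sum span_scale) (auto intro!: span_base simp: Let_def)
  have r: "?r \<in> span (gs d (Suc n))"
  proof (cases "?r = 0")
    case False
    have "norm ?r *\<^sub>R (?r /\<^sub>R norm ?r) \<in> span (gs d (Suc n))"
      by (intro span_scale span_base) (use False in \<open>simp add: Let_def\<close>)
    then show ?thesis using False by simp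
  qed (simp add: span_zero)
  show ?thesis using span_add[OF p r] by simp
qed

lemma gs_mono: "m \<le> n \<Longrightarrow> gs d m \<subseteq> gs d n"
  by (rule lift_Suc_mono_le) (auto simp: Let_def)

lemma ex_countable_onb:
  "\<exists>B::'a::{real_inner,second_countable_topology} set. countable B \<and> orthonormal_basis B"
proof -
  obtain D :: "'a set" where D: "countable D" "\<And>X. open X \<Longrightarrow> X \<noteq> {} \<Longrightarrow> \<exists>d\<in>D. d \<in> X"
    by (rule countable_dense_setE) blast
  then have ne: "D \<noteq> {}" using open_UNIV by blast
  define d where "d = from_nat_into D"
  define B where "B = (\<Union>n. gs d n)"
  have rd: "range d = D" unfolding d_def using range_from_nat_into[OF ne D(1)] .
  have cB: "countable B" unfolding B_def using gs_orthonormal by (auto intro: countable_finite)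
  have "orthonormal B"
    unfolding orthonormal_def
  proof (intro conjI ballI pairwiseI)
    fix e f assume "e \<in> B" "f \<in> B" "e \<noteq> f"
    then obtain m n where "e \<in> gs d m" "f \<in> gs d n" by (auto simp: B_def)
    then have "e \<in> gs d (max m n)" "f \<in> gs d (max m n)"
      using gs_mono[of m "max m n" d] gs_mono[of n "max m n" d] by auto
    then show "orthogonal e f"
      using gs_orthonormal[of d "max m n"] \<open>e \<noteq> f\<close> by (auto simp: orthonormal_def pairwise_def)
  next
    fix e assume "e \<in> B"
    then show "norm e = 1" using gs_orthonormal[of d] by (auto simp: B_def orthonormal_def)
  qed
  moreover have "closure (span B) = UNIV"
  proof -
    have "D \<subseteq> span B"
    proof
      fix x assume "x \<in> D"
      then obtain n where "x = d n" using rd by auto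
      moreover have "span (gs d (Suc n)) \<subseteq> span B" by (rule span_mono) (use B_def in blast)
      ultimately show "x \<in> span B" using gs_span[of d n] by auto
    qed
    moreover have "closure D = UNIV"
    proof -
      have "x \<in> closure D" for x
      proof (subst closure_approachable, intro allI impI)
        fix \<epsilon> :: real assume "\<epsilon> > 0"
        then show "\<exists>y\<in>D. dist y x < \<epsilon>"
          using D(2)[of "ball x \<epsilon>"] by (force simp: dist_commute)
      qed
      then show ?thesis by auto
    qed
    ultimately show ?thesis using closure_mono by blast
  qed
  ultimately show ?thesis using cB by (auto simp: orthonormal_basis_def)
qed

lemma countable_onb: "countable (onb :: 'a::{real_inner,second_countable_topology} set)"
  and orthonormal_basis_onb: "orthonormal_basis (onb :: 'a set)"
  using someI_ex[OF ex_countable_onb[where 'a='a]] by (simp_all add: onb_def)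

lemma orthonormal_onb: "orthonormal (onb :: 'a::{real_inner,second_countable_topology} set)"
  using orthonormal_basis_onb by (auto simp: orthonormal_basis_def)


lemma Riesz_representation:
  fixes f :: "'a::{real_inner,complete_space} \<Rightarrow> real"
  assumes "bounded_linear f"
  shows "\<exists>y. \<forall>x. f x = x \<bullet> y"
proof -
  interpret f: bounded_linear f by fact
  obtain K where K: "\<And>x. \<bar>f x\<bar> \<le> norm x * K" using f.bounded by auto
  define \<psi> where "\<psi> x = (x \<bullet> x) / 2 - f x" for x
  have lb: "- (K\<^sup>2) / 2 \<le> \<psi> x" for x
  proof -
    have "f x \<le> norm x * K" using K[of x] by linarith
    moreover have "0 \<le> (norm x - K)\<^sup>2" by simp
    ultimately show ?thesis
      by (simp add: \<psi>_def power2_norm_eq_inner[symmetric] power2_eq_square algebra_simps)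
  qed
  define m where "m = (INF x. \<psi> x)"
  have bdd: "bdd_below (range \<psi>)" using lb by (auto intro!: bdd_belowI2)
  have m_le: "m \<le> \<psi> x" for x unfolding m_def using bdd by (auto intro: cINF_lower)
  have "\<exists>x. \<psi> x < m + 1 / real (Suc n)" for n
  proof -
    have "(INF x. \<psi> x) < m + 1 / real (Suc n)" by (simp add: m_def)
    then show ?thesis using bdd by (subst (asm) cINF_less_iff) auto
  qed
  then obtain u where u: "\<And>n. \<psi> (u n) < m + 1 / real (Suc n)" by metis
  have par: "(norm (x - y))\<^sup>2 / 4 = \<psi> x + \<psi> y - 2 * \<psi> ((x + y) /\<^sub>R 2)" for x y
    by (simp add: \<psi>_def power2_norm_eq_inner f.add f.scaleR inner_add_left inner_add_right
        inner_diff_left inner_diff_right inner_commute field_simps)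
  have close: "(norm (u i - u j))\<^sup>2 \<le> 4 * (1 / real (Suc i) + 1 / real (Suc j))" for i j
  proof -
    define a b where "a = 1 / real (Suc i)" and "b = 1 / real (Suc j)"
    show ?thesis
      using par[of "u i" "u j"] u[of i] u[of j] m_le[of "(u i + u j) /\<^sub>R 2"]
      unfolding a_def[symmetric] b_def[symmetric] by (simp add: field_simps)
  qed
  have "Cauchy u"
  proof (rule CauchyI)
    fix \<epsilon> :: real assume e: "\<epsilon> > 0"
    obtain N where N: "1 / real (Suc N) < \<epsilon>\<^sup>2 / 8"
      using reals_Archimedean[of "\<epsilon>\<^sup>2 / 8"] e by (auto simp: inverse_eq_divide)
    show "\<exists>M. \<forall>i\<ge>M. \<forall>j\<ge>M. norm (u i - u j) < \<epsilon>"
    proof (intro exI allI impI)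
      fix i j assume ij: "i \<ge> N" "j \<ge> N"
      have "1 / real (Suc i) \<le> 1 / real (Suc N)" "1 / real (Suc j) \<le> 1 / real (Suc N)"
        using ij by (auto simp: field_simps)
      moreover have "z < e" if "a \<le> c" "b \<le> c" "z \<le> 4 * (a + b)" "c < e / 8" for a b c z e :: real
        using that by argo
      ultimately have "(norm (u i - u j))\<^sup>2 < \<epsilon>\<^sup>2" using close[of i j] N by blast
      then show "norm (u i - u j) < \<epsilon>" using e by (simp add: power_less_imp_less_base)
    qed
  qed
  then obtain y where y: "u \<longlonglongrightarrow> y" using Cauchy_convergent convergent_def by blast
  have "(\<lambda>n. \<psi> (u n)) \<longlonglongrightarrow> \<psi> y"
    unfolding \<psi>_def by (intro tendsto_intros y f.tendsto)  auto
  moreover have "(\<lambda>n. m + 1 / real (Suc n)) \<longlonglongrightarrow> m + 0"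
    by (intro tendsto_add tendsto_const LIMSEQ_Suc[OF lim_1_over_n])
  ultimately have "\<psi> y \<le> m + 0"
    by (rule LIMSEQ_le) (use u in \<open>auto intro!: less_imp_le\<close>)
  then have min: "\<psi> y \<le> \<psi> x" for x using m_le[of x] by linarith
  have "f h = h \<bullet> y" for h
  proof (rule ccontr)
    assume ne: "f h \<noteq> h \<bullet> y"
    define a where "a = h \<bullet> y - f h"
    have h: "h \<bullet> h > 0" using ne f.zero by (cases "h = 0") auto
    have "\<psi> (y + t *\<^sub>R h) - \<psi> y = t * a + t\<^sup>2 * (h \<bullet> h) / 2" for t
      by (simp add: \<psi>_def a_def f.add f.scaleR inner_add_left inner_add_right inner_commute
          power2_eq_square field_simps)
    then have "0 \<le> t * a + t\<^sup>2 * (h \<bullet> h) / 2" for t using min[of "y + t *\<^sub>R h"] by (smt (verit))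
    from this[of "- a / (h \<bullet> h)"] have "a\<^sup>2 \<le> 0"
      using h by (simp add: power2_eq_square field_simps)
    then show False using ne by (simp add: a_def)
  qed
  then show ?thesis by blast
qed

lemma adjoint_bounded:
  fixes T :: "'a::{real_inner,complete_space} \<Rightarrow> 'b::real_inner"
  assumes "bounded_linear T"
  shows adjoint_inner: "T x \<bullet> y = x \<bullet> adjoint T y"
    and bounded_linear_adjoint: "bounded_linear (adjoint T)"
proof -
  interpret T: bounded_linear T by fact
  have "\<forall>y. \<exists>z. \<forall>x. T x \<bullet> y = x \<bullet> z"
    by (intro allI Riesz_representation bounded_linear_compose[OF bounded_linear_inner_left assms])
  then have "\<exists>g. \<forall>x y. T x \<bullet> y = x \<bullet> g y" by metis
  then have adj: "\<forall>x y. T x \<bullet> y = x \<bullet> adjoint T y"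
    unfolding adjoint_def by (rule someI_ex)
  then show "T x \<bullet> y = x \<bullet> adjoint T y" by blast
  obtain K where K: "K \<ge> 0" "\<And>x. norm (T x) \<le> norm x * K" using T.nonneg_bounded by auto
  show "bounded_linear (adjoint T)"
  proof (rule bounded_linear_intro[where K=K])
    show "adjoint T (x + y) = adjoint T x + adjoint T y" for x y
      by (subst vector_eq_ldot[symmetric])
         (simp add: adj[rule_format, symmetric] inner_add_right)
    show "adjoint T (r *\<^sub>R x) = r *\<^sub>R adjoint T x" for r x
      by (subst vector_eq_ldot[symmetric]) (simp add: adj[rule_format, symmetric])
    show "norm (adjoint T y) \<le> norm y * K" for y
    proof (cases "adjoint T y = 0")
      case False
      have "(norm (adjoint T y))\<^sup>2 = T (adjoint T y) \<bullet> y"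
        using adj by (simp add: power2_norm_eq_inner)
      also have "\<dots> \<le> norm (T (adjoint T y)) * norm y" by (rule norm_cauchy_schwarz)
      also have "\<dots> \<le> norm (adjoint T y) * K * norm y"
        by (intro mult_right_mono K) auto
      finally show ?thesis using False by (simp add: power2_eq_square algebra_simps)
    qed (use K in simp)
  qed
qed

lift_definition adj ::
  "('a::{real_inner,complete_space} \<Rightarrow>\<^sub>L 'b::real_inner) \<Rightarrow> ('b \<Rightarrow>\<^sub>L 'a)" is adjoint
  by (rule bounded_linear_adjoint)

lemma adj_inner:
  fixes T :: "'a::{real_inner,complete_space} \<Rightarrow>\<^sub>L 'b::real_inner"
  shows "T x \<bullet> y = x \<bullet> adj T y"
  by transfer (rule adjoint_inner)


lift_definition tensor :: "'a::real_inner \<Rightarrow> 'a \<Rightarrow> ('a \<Rightarrow>\<^sub>L 'a)" is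
  "\<lambda>f g x. (f \<bullet> x) *\<^sub>R g"
  by (rule bounded_linear_compose[OF bounded_linear_scaleR_left bounded_linear_inner_right])

lemma tensor_apply [simp]: "tensor f g x = (f \<bullet> x) *\<^sub>R g"
  by transfer (rule refl)

lemma adj_tensor:
  fixes f g :: "'a::{real_inner,complete_space}"
  shows "adj (tensor f g) = tensor g f"
proof (rule blinfun_eqI)
  fix y
  have "x \<bullet> adj (tensor f g) y = x \<bullet> tensor g f y" for x
    by (subst adj_inner[symmetric]) (simp add: inner_commute)
  then show "adj (tensor f g) y = tensor g f y" by (subst vector_eq_ldot[symmetric]) blast
qed


text \<open>Neither this class nor the norm of \<open>'a hs\<close> below depends on the choice of the
  basis, see \<open>hilbert_schmidt_basis_independent\<close>.\<close>

definition hilbert_schmidt ::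
  "('a::{real_inner,second_countable_topology} \<Rightarrow>\<^sub>L 'a) \<Rightarrow> bool" where
  "hilbert_schmidt T \<longleftrightarrow> (\<lambda>e. (norm (T e))\<^sup>2) summable_on onb"

lemma hilbert_schmidtI:
  fixes T :: "'a::{real_inner,second_countable_topology} \<Rightarrow>\<^sub>L 'a"
  assumes "\<And>F. finite F \<Longrightarrow> F \<subseteq> onb \<Longrightarrow> (\<Sum>e\<in>F. (norm (T e))\<^sup>2) \<le> C"
  shows "hilbert_schmidt T"
  unfolding hilbert_schmidt_def
  by (rule nonneg_bdd_above_summable_on) (auto intro!: bdd_aboveI2[where M=C] assms)

lemma hilbert_schmidt_sum_le:
  fixes T :: "'a::{real_inner,second_countable_topology} \<Rightarrow>\<^sub>L 'a"
  assumes "hilbert_schmidt T" "finite F" "F \<subseteq> onb"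
  shows "(\<Sum>e\<in>F. (norm (T e))\<^sup>2) \<le> (\<Sum>\<^sub>\<infinity>e\<in>onb. (norm (T e))\<^sup>2)"
  using assms by (intro finite_sum_le_infsum) (auto simp: hilbert_schmidt_def)

lemma hilbert_schmidt_zero: "hilbert_schmidt 0"
  by (simp add: hilbert_schmidt_def)

lemma hilbert_schmidt_scaleR:
  assumes "hilbert_schmidt T" shows "hilbert_schmidt (r *\<^sub>R T)"
  using assms unfolding hilbert_schmidt_def
  by (simp add: scaleR_blinfun.rep_eq power_mult_distrib summable_on_cmult_right)

lemma hilbert_schmidt_add:
  fixes S T :: "'a::{real_inner,second_countable_topology} \<Rightarrow>\<^sub>L 'a"
  assumes S: "hilbert_schmidt S" and T: "hilbert_schmidt T"
  shows "hilbert_schmidt (S + T)"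
proof (rule hilbert_schmidtI)
  fix F :: "'a set" assume F: "finite F" "F \<subseteq> onb"
  have "(\<Sum>e\<in>F. (norm ((S + T) e))\<^sup>2) \<le> (\<Sum>e\<in>F. 2 * (norm (S e))\<^sup>2 + 2 * (norm (T e))\<^sup>2)"
  proof (rule sum_mono)
    fix e
    have "(norm (S e + T e))\<^sup>2 \<le> (norm (S e) + norm (T e))\<^sup>2"
      by (intro power_mono norm_triangle_ineq) simp
    also have "\<dots> \<le> 2 * (norm (S e))\<^sup>2 + 2 * (norm (T e))\<^sup>2"
      using zero_le_power2[of "norm (S e) - norm (T e)"] by (simp add: power2_eq_square algebra_simps)
    finally show "(norm ((S + T) e))\<^sup>2 \<le> 2 * (norm (S e))\<^sup>2 + 2 * (norm (T e))\<^sup>2"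
      by (simp add: plus_blinfun.rep_eq)
  qed
  also have "\<dots> = 2 * (\<Sum>e\<in>F. (norm (S e))\<^sup>2) + 2 * (\<Sum>e\<in>F. (norm (T e))\<^sup>2)"
    by (simp add: sum.distrib sum_distrib_left)
  also have "\<dots> \<le> 2 * (\<Sum>\<^sub>\<infinity>e\<in>onb. (norm (S e))\<^sup>2) + 2 * (\<Sum>\<^sub>\<infinity>e\<in>onb. (norm (T e))\<^sup>2)"
    using hilbert_schmidt_sum_le[OF S F] hilbert_schmidt_sum_le[OF T F] by linarith
  finally show "(\<Sum>e\<in>F. (norm ((S + T) e))\<^sup>2)
      \<le> 2 * (\<Sum>\<^sub>\<infinity>e\<in>onb. (norm (S e))\<^sup>2) + 2 * (\<Sum>\<^sub>\<infinity>e\<in>onb. (norm (T e))\<^sup>2)" .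
qed

lemma hilbert_schmidt_uminus: "hilbert_schmidt T \<Longrightarrow> hilbert_schmidt (- T)"
  using hilbert_schmidt_scaleR[of T "-1"] by simp

lemma hilbert_schmidt_diff:
  "hilbert_schmidt S \<Longrightarrow> hilbert_schmidt T \<Longrightarrow> hilbert_schmidt (S - T)"
  using hilbert_schmidt_add[OF _ hilbert_schmidt_uminus, of S T] by simp

lemma hilbert_schmidt_tensor: "hilbert_schmidt (tensor f g)"
  using summable_on_cmult_left[OF Bessel_summable[OF orthonormal_onb, of f], of "(norm g)\<^sup>2"]
  by (simp add: hilbert_schmidt_def power_mult_distrib)

lemma hilbert_schmidt_inner_summable:
  fixes S T :: "'a::{real_inner,second_countable_topology} \<Rightarrow>\<^sub>L 'a"
  assumes S: "hilbert_schmidt S" and T: "hilbert_schmidt T"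
  shows "(\<lambda>e. S e \<bullet> T e) summable_on onb"
proof -
  have "(\<lambda>e. (1 / 4) * (norm ((S + T) e))\<^sup>2 + (- 1 / 4) * (norm ((S - T) e))\<^sup>2) summable_on onb"
    using hilbert_schmidt_add[OF S T] hilbert_schmidt_diff[OF S T]
    by (intro summable_on_add summable_on_cmult_right) (simp_all add: hilbert_schmidt_def)
  moreover have "(1 / 4) * (norm ((S + T) e))\<^sup>2 + (- 1 / 4) * (norm ((S - T) e))\<^sup>2 = S e \<bullet> T e" for e
    by (simp add: plus_blinfun.rep_eq minus_blinfun.rep_eq power2_norm_eq_inner
        inner_add_left inner_add_right inner_diff_left inner_diff_right inner_commute field_simps)
  ultimately show ?thesis by simp
qed

lemma has_sum_finite_sum:
  fixes g :: "'i \<Rightarrow> 'b \<Rightarrow> real"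
  assumes "finite F" and "\<And>i. i \<in> F \<Longrightarrow> g i summable_on B"
  shows "((\<lambda>e. \<Sum>i\<in>F. g i e) has_sum (\<Sum>i\<in>F. \<Sum>\<^sub>\<infinity>e\<in>B. g i e)) B"
  using assms by induction (auto intro!: has_sum_add)

lemma Parseval_adj_le:
  fixes T :: "'a::{real_inner,complete_space} \<Rightarrow>\<^sub>L 'b::real_inner"
  assumes B: "orthonormal_basis B" and C: "orthonormal_basis C"
    and sm: "(\<lambda>e. (norm (T e))\<^sup>2) summable_on B" and F: "finite F" "F \<subseteq> C"
  shows "(\<Sum>f\<in>F. (norm (adj T f))\<^sup>2) \<le> (\<Sum>\<^sub>\<infinity>e\<in>B. (norm (T e))\<^sup>2)"
proof -
  have onB: "orthonormal B" and onC: "orthonormal C"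
    using B C by (simp_all add: orthonormal_basis_def)
  have "(\<Sum>f\<in>F. (norm (adj T f))\<^sup>2) = (\<Sum>f\<in>F. \<Sum>\<^sub>\<infinity>e\<in>B. (adj T f \<bullet> e)\<^sup>2)"
    by (simp add: Parseval[OF B])
  also have "\<dots> = (\<Sum>\<^sub>\<infinity>e\<in>B. \<Sum>f\<in>F. (adj T f \<bullet> e)\<^sup>2)"
    by (rule infsumI[symmetric], rule has_sum_finite_sum[OF F(1)]) (rule Bessel_summable[OF onB])
  also have "\<dots> \<le> (\<Sum>\<^sub>\<infinity>e\<in>B. (norm (T e))\<^sup>2)"
  proof (rule infsum_mono[OF _ sm])
    show "(\<lambda>e. \<Sum>f\<in>F. (adj T f \<bullet> e)\<^sup>2) summable_on B"
      by (rule has_sum_imp_summable, rule has_sum_finite_sum[OF F(1)]) (rule Bessel_summable[OF onB])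
    show "(\<Sum>f\<in>F. (adj T f \<bullet> e)\<^sup>2) \<le> (norm (T e))\<^sup>2" for e
      using Bessel_finite[OF onC F, of "T e"] by (simp add: adj_inner inner_commute[of _ e])
  qed
  finally show ?thesis .
qed

lemma adj_adj [simp]:
  fixes T :: "'a::{real_inner,complete_space} \<Rightarrow>\<^sub>L 'b::{real_inner,complete_space}"
  shows "adj (adj T) = T"
proof (rule blinfun_eqI)
  fix x
  have "y \<bullet> adj (adj T) x = y \<bullet> T x" for y
    using adj_inner[of "adj T" y x] adj_inner[of T x y] by (simp add: inner_commute)
  then show "adj (adj T) x = T x" by (subst vector_eq_ldot[symmetric]) blast
qed

lemma summable_adj:
  fixes T :: "'a::{real_inner,complete_space} \<Rightarrow>\<^sub>L 'b::{real_inner,complete_space}"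
  assumes B: "orthonormal_basis B" and C: "orthonormal_basis C"
    and sm: "(\<lambda>e. (norm (T e))\<^sup>2) summable_on B"
  shows "(\<lambda>f. (norm (adj T f))\<^sup>2) summable_on C"
    and "(\<Sum>\<^sub>\<infinity>f\<in>C. (norm (adj T f))\<^sup>2) = (\<Sum>\<^sub>\<infinity>e\<in>B. (norm (T e))\<^sup>2)"
proof -
  show sm': "(\<lambda>f. (norm (adj T f))\<^sup>2) summable_on C"
    by (rule nonneg_bdd_above_summable_on)
       (auto intro!: bdd_aboveI2 Parseval_adj_le[OF B C sm])
  show "(\<Sum>\<^sub>\<infinity>f\<in>C. (norm (adj T f))\<^sup>2) = (\<Sum>\<^sub>\<infinity>e\<in>B. (norm (T e))\<^sup>2)"
  proof (rule antisym)
    show "(\<Sum>\<^sub>\<infinity>f\<in>C. (norm (adj T f))\<^sup>2) \<le> (\<Sum>\<^sub>\<infinity>e\<in>B. (norm (T e))\<^sup>2)"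
      by (rule infsum_le_finite_sums[OF sm']) (rule Parseval_adj_le[OF B C sm])
    show "(\<Sum>\<^sub>\<infinity>e\<in>B. (norm (T e))\<^sup>2) \<le> (\<Sum>\<^sub>\<infinity>f\<in>C. (norm (adj T f))\<^sup>2)"
      by (rule infsum_le_finite_sums[OF sm])
         (rule Parseval_adj_le[OF C B sm', unfolded adj_adj])
  qed
qed

lemma hilbert_schmidt_basis_independent:
  fixes T :: "'a::{real_inner,complete_space,second_countable_topology} \<Rightarrow>\<^sub>L 'a"
  assumes B: "orthonormal_basis B"
  shows "hilbert_schmidt T \<longleftrightarrow> (\<lambda>e. (norm (T e))\<^sup>2) summable_on B"
    and "hilbert_schmidt T \<Longrightarrow>
      (\<Sum>\<^sub>\<infinity>e\<in>B. (norm (T e))\<^sup>2) = (\<Sum>\<^sub>\<infinity>e\<in>onb. (norm (T e))\<^sup>2)"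
proof -
  note onb = orthonormal_basis_onb[where 'a='a]
  show 1: "hilbert_schmidt T \<longleftrightarrow> (\<lambda>e. (norm (T e))\<^sup>2) summable_on B"
    unfolding hilbert_schmidt_def
    using summable_adj(1)[OF onb B summable_adj(1)[OF onb onb], of T]
      summable_adj(1)[OF onb onb summable_adj(1)[OF B onb], of T]
    unfolding adj_adj by blast
  show "(\<Sum>\<^sub>\<infinity>e\<in>B. (norm (T e))\<^sup>2) = (\<Sum>\<^sub>\<infinity>e\<in>onb. (norm (T e))\<^sup>2)"
    if T: "hilbert_schmidt T"
    using summable_adj(2)[OF B onb] summable_adj(2)[OF onb onb] T 1
    unfolding hilbert_schmidt_def by metis
qed

lemma hilbert_schmidt_adj:
  fixes T :: "'a::{real_inner,complete_space,second_countable_topology} \<Rightarrow>\<^sub>L 'a"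
  shows "hilbert_schmidt T \<Longrightarrow> hilbert_schmidt (adj T)"
  unfolding hilbert_schmidt_def
  by (rule summable_adj(1)[OF orthonormal_basis_onb orthonormal_basis_onb])

text \<open>\<open>hs_of T\<close> is meaningful only if \<open>hilbert_schmidt T\<close> holds, see \<open>hs_op_of\<close>.\<close>

typedef (overloaded) 'a hs =
  "{T :: 'a::{real_inner,second_countable_topology} \<Rightarrow>\<^sub>L 'a. hilbert_schmidt T}"
  morphisms hs_op hs_of
  using hilbert_schmidt_zero by blast

setup_lifting type_definition_hs

instantiation hs :: ("{real_inner,second_countable_topology}") real_inner
begin

lift_definition zero_hs :: "'a hs" is 0 by (rule hilbert_schmidt_zero)
lift_definition plus_hs :: "'a hs \<Rightarrow> 'a hs \<Rightarrow> 'a hs" is "(+)" by (rule hilbert_schmidt_add)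
lift_definition minus_hs :: "'a hs \<Rightarrow> 'a hs \<Rightarrow> 'a hs" is "(-)" by (rule hilbert_schmidt_diff)
lift_definition uminus_hs :: "'a hs \<Rightarrow> 'a hs" is uminus by (rule hilbert_schmidt_uminus)
lift_definition scaleR_hs :: "real \<Rightarrow> 'a hs \<Rightarrow> 'a hs" is scaleR by (rule hilbert_schmidt_scaleR)
lift_definition inner_hs :: "'a hs \<Rightarrow> 'a hs \<Rightarrow> real" is
  "\<lambda>S T. \<Sum>\<^sub>\<infinity>e\<in>onb. blinfun_apply S e \<bullet> blinfun_apply T e" .

definition norm_hs :: "'a hs \<Rightarrow> real" where "norm_hs T = sqrt (T \<bullet> T)"
definition sgn_hs :: "'a hs \<Rightarrow> 'a hs" where "sgn_hs T = inverse (norm T) *\<^sub>R T"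
definition dist_hs :: "'a hs \<Rightarrow> 'a hs \<Rightarrow> real" where "dist_hs S T = norm (S - T)"
definition uniformity_hs :: "('a hs \<times> 'a hs) filter" where
  "uniformity_hs = (INF \<epsilon>\<in>{0<..}. principal {(S, T). dist S T < \<epsilon>})"
definition open_hs :: "'a hs set \<Rightarrow> bool" where
  "open_hs U \<longleftrightarrow> (\<forall>S\<in>U. \<forall>\<^sub>F (S', T) in uniformity. S' = S \<longrightarrow> T \<in> U)"

instance
proof
  fix R S T :: "'a hs" and r s :: real
  show "R + S + T = R + (S + T)" by transfer (rule add.assoc)
  show "S + T = T + S" by transfer (rule add.commute)
  show "0 + T = T" by transfer simp
  show "- T + T = 0" by transfer simp
  show "S - T = S + - T" by transfer simp
  show "r *\<^sub>R (S + T) = r *\<^sub>R S + r *\<^sub>R T" by transfer (rule scaleR_add_right)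
  show "(r + s) *\<^sub>R T = r *\<^sub>R T + s *\<^sub>R T" by transfer (rule scaleR_add_left)
  show "r *\<^sub>R s *\<^sub>R T = (r * s) *\<^sub>R T" by transfer simp
  show "1 *\<^sub>R T = T" by transfer simp
  show "sgn T = inverse (norm T) *\<^sub>R T" by (rule sgn_hs_def)
  show "dist S T = norm (S - T)" by (rule dist_hs_def)
  show "(uniformity :: ('a hs \<times> 'a hs) filter) = (INF \<epsilon>\<in>{0<..}. principal {(S, T). dist S T < \<epsilon>})"
    by (rule uniformity_hs_def)
  show "open U \<longleftrightarrow> (\<forall>S\<in>U. \<forall>\<^sub>F (S', T) in uniformity. S' = S \<longrightarrow> T \<in> U)" for U :: "'a hs set"
    by (rule open_hs_def)
  show "S \<bullet> T = T \<bullet> S" by transfer (simp add: inner_commute)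
  show "(R + S) \<bullet> T = R \<bullet> T + S \<bullet> T"
    by transfer
       (simp add: plus_blinfun.rep_eq inner_add_left infsum_add hilbert_schmidt_inner_summable)
  show "r *\<^sub>R S \<bullet> T = r * (S \<bullet> T)"
    by transfer (simp add: scaleR_blinfun.rep_eq infsum_cmult_right')
  show "0 \<le> T \<bullet> T" by transfer (auto intro!: infsum_nonneg)
  show "norm T = sqrt (T \<bullet> T)" by (rule norm_hs_def)
  show "T \<bullet> T = 0 \<longleftrightarrow> T = 0"
  proof transfer
    fix T :: "'a \<Rightarrow>\<^sub>L 'a" assume T: "hilbert_schmidt T"
    show "(\<Sum>\<^sub>\<infinity>e\<in>onb. T e \<bullet> T e) = 0 \<longleftrightarrow> T = 0"
    proof
      assume 0: "(\<Sum>\<^sub>\<infinity>e\<in>onb. T e \<bullet> T e) = 0"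
      have e0: "T e = 0" if "e \<in> onb" for e
      proof -
        have "T e \<bullet> T e \<le> 0"
          using hilbert_schmidt_sum_le[OF T, of "{e}"] that 0 by (simp add: power2_norm_eq_inner)
        then have "T e \<bullet> T e = 0" by (rule antisym) simp
        then show ?thesis by simp
      qed
      have "T x = 0" for x
      proof (rule ccontr)
        assume "T x \<noteq> 0"
        then have pos: "norm (T x) > 0" "norm T > 0" by auto
        obtain F where F: "finite F" "F \<subseteq> onb"
          "norm (x - (\<Sum>f\<in>F. (x \<bullet> f) *\<^sub>R f)) < norm (T x) / norm T"
          using onb_approx[OF orthonormal_basis_onb, of "norm (T x) / norm T" x] pos by auto
        have "T (\<Sum>f\<in>F. (x \<bullet> f) *\<^sub>R f) = 0"
          using F(2) by (auto simp: blinfun.sum_right blinfun.scaleR_right e0 intro!: sum.neutral)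
        then have "norm (T x) = norm (T (x - (\<Sum>f\<in>F. (x \<bullet> f) *\<^sub>R f)))"
          by (simp add: blinfun.diff_right)
        also have "\<dots> \<le> norm T * norm (x - (\<Sum>f\<in>F. (x \<bullet> f) *\<^sub>R f))" by (rule norm_blinfun)
        also have "\<dots> < norm T * (norm (T x) / norm T)"
          using F(3) pos(2) by (rule mult_strict_left_mono)
        finally show False using pos by simp
      qed
      then show "T = 0" by (auto intro: blinfun_eqI)
    qed simp
  qed
qed

end

lemma hilbert_schmidt_hs_op [simp]: "hilbert_schmidt (hs_op T)"
  using hs_op[of T] by simp

lemma hs_op_of: "hilbert_schmidt T \<Longrightarrow> hs_op (hs_of T) = T"
  by (rule hs_of_inverse) simp

lemma norm_hs_sq: "(norm T)\<^sup>2 = (\<Sum>\<^sub>\<infinity>e\<in>onb. (norm (hs_op T e))\<^sup>2)"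
  by (simp only: power2_norm_eq_inner inner_hs.rep_eq)

lemma hs_sum_le: "finite F \<Longrightarrow> F \<subseteq> onb \<Longrightarrow> (\<Sum>e\<in>F. (norm (hs_op T e))\<^sup>2) \<le> (norm T)\<^sup>2"
  unfolding norm_hs_sq by (rule hilbert_schmidt_sum_le) simp_all

lemma norm_hs_leI:
  assumes "C \<ge> 0" and "\<And>F. finite F \<Longrightarrow> F \<subseteq> onb \<Longrightarrow> (\<Sum>e\<in>F. (norm (hs_op T e))\<^sup>2) \<le> C\<^sup>2"
  shows "norm T \<le> C"
proof -
  have "(norm T)\<^sup>2 \<le> C\<^sup>2"
    unfolding norm_hs_sq
    using hilbert_schmidt_hs_op[of T] assms(2)
    by (intro infsum_le_finite_sums) (auto simp: hilbert_schmidt_def)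
  then show ?thesis using assms(1) by (rule power2_le_imp_le)
qed

lemma norm_hs_op_le: "norm (hs_op T) \<le> norm T"
proof (rule norm_blinfun_bound)
  fix x :: 'a
  show "norm (hs_op T x) \<le> norm T * norm x"
  proof (rule field_le_epsilon)
    fix \<epsilon> :: real assume e: "\<epsilon> > 0"
    define \<delta> where "\<delta> = \<epsilon> / (norm (hs_op T) + 1)"
    have nT: "norm (hs_op T) + 1 > 0" by (simp add: add_nonneg_pos)
    have d: "\<delta> > 0" using e nT by (simp add: \<delta>_def)
    obtain F where F: "finite F" "F \<subseteq> onb" "norm (x - (\<Sum>f\<in>F. (x \<bullet> f) *\<^sub>R f)) < \<delta>"
      using onb_approx[OF orthonormal_basis_onb d, of x] by auto
    let ?p = "\<Sum>f\<in>F. (x \<bullet> f) *\<^sub>R f"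
    have "norm (hs_op T ?p) \<le> (\<Sum>f\<in>F. \<bar>x \<bullet> f\<bar> * \<bar>norm (hs_op T f)\<bar>)"
      unfolding blinfun.sum_right by (rule sum_norm_le) (simp add: blinfun.scaleR_right)
    also have "\<dots> \<le> L2_set (\<lambda>f. x \<bullet> f) F * L2_set (\<lambda>f. norm (hs_op T f)) F"
      by (rule L2_set_mult_ineq)
    also have "\<dots> \<le> norm x * norm T"
      unfolding L2_set_def
      by (intro mult_mono real_le_lsqrt hs_sum_le Bessel_finite[OF orthonormal_onb] F)
         (auto intro!: sum_nonneg)
    finally have 1: "norm (hs_op T ?p) \<le> norm T * norm x" by (simp add: mult.commute)
    have "norm (hs_op T (x - ?p)) \<le> norm (hs_op T) * norm (x - ?p)" by (rule norm_blinfun)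
    also have "\<dots> \<le> (norm (hs_op T) + 1) * \<delta>" using F(3) nT by (intro mult_mono) auto
    also have "\<dots> = \<epsilon>" using nT by (simp add: \<delta>_def)
    finally have 2: "norm (hs_op T (x - ?p)) \<le> \<epsilon>" .
    have "hs_op T x = hs_op T ?p + hs_op T (x - ?p)" by (simp add: blinfun.diff_right)
    then show "norm (hs_op T x) \<le> norm T * norm x + \<epsilon>"
      using norm_triangle_ineq[of "hs_op T ?p" "hs_op T (x - ?p)"] 1 2 by simp
  qed
qed simp

instance hs :: ("{real_inner,banach,second_countable_topology}") banach
proof
  fix X :: "nat \<Rightarrow> 'a hs" assume X: "Cauchy X"
  have op_diff: "norm (hs_op (X i) - hs_op (X j)) \<le> norm (X i - X j)" for i j
    using norm_hs_op_le[of "X i - X j"] by (simp add: minus_hs.rep_eq)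
  have "Cauchy (\<lambda>n. hs_op (X n))"
  proof (rule CauchyI)
    fix \<epsilon> :: real assume "\<epsilon> > 0"
    then obtain N where "\<forall>i\<ge>N. \<forall>j\<ge>N. norm (X i - X j) < \<epsilon>" using CauchyD[OF X] by blast
    then show "\<exists>N. \<forall>i\<ge>N. \<forall>j\<ge>N. norm (hs_op (X i) - hs_op (X j)) < \<epsilon>"
      using op_diff order_le_less_trans by blast
  qed
  then obtain T where T: "(\<lambda>n. hs_op (X n)) \<longlonglongrightarrow> T" using Cauchy_convergent convergent_def by blast
  have lim: "(\<lambda>m. hs_op (X m) e) \<longlonglongrightarrow> T e" for e
    by (intro blinfun.tendsto T tendsto_const)
  have bound: "(\<Sum>e\<in>F. (norm ((hs_op (X n) - T) e))\<^sup>2) \<le> \<epsilon>\<^sup>2"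
    if e: "\<epsilon> > 0" and N: "\<forall>i\<ge>N. \<forall>j\<ge>N. norm (X i - X j) < \<epsilon>" and n: "n \<ge> N"
      and F: "finite F" "F \<subseteq> onb" for \<epsilon> N n F
  proof (rule LIMSEQ_le_const2)
    show "(\<lambda>m. \<Sum>e\<in>F. (norm (hs_op (X n) e - hs_op (X m) e))\<^sup>2)
        \<longlonglongrightarrow> (\<Sum>e\<in>F. (norm ((hs_op (X n) - T) e))\<^sup>2)"
      unfolding minus_blinfun.rep_eq by (intro tendsto_intros lim)
    show "\<exists>N. \<forall>m\<ge>N. (\<Sum>e\<in>F. (norm (hs_op (X n) e - hs_op (X m) e))\<^sup>2) \<le> \<epsilon>\<^sup>2"
    proof (intro exI allI impI)
      fix m assume m: "m \<ge> N"
      have "(\<Sum>e\<in>F. (norm (hs_op (X n) e - hs_op (X m) e))\<^sup>2) \<le> (norm (X n - X m))\<^sup>2"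
        using hs_sum_le[OF F, of "X n - X m"] by (simp add: minus_hs.rep_eq minus_blinfun.rep_eq)
      also have "\<dots> \<le> \<epsilon>\<^sup>2" using N n m by (intro power_mono) (auto intro: less_imp_le)
      finally show "(\<Sum>e\<in>F. (norm (hs_op (X n) e - hs_op (X m) e))\<^sup>2) \<le> \<epsilon>\<^sup>2" .
    qed
  qed
  obtain N where N: "\<forall>i\<ge>N. \<forall>j\<ge>N. norm (X i - X j) < 1" using CauchyD[OF X, of 1] by auto
  have "hilbert_schmidt (hs_op (X N) - T)"
    by (rule hilbert_schmidtI[where C="1\<^sup>2"]) (rule bound[OF _ N], auto)
  from hilbert_schmidt_diff[OF hilbert_schmidt_hs_op[of "X N"] this]
  have HS: "hilbert_schmidt T" by simp
  have "X \<longlonglongrightarrow> hs_of T"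
  proof (rule LIMSEQ_I)
    fix \<epsilon> :: real assume e: "\<epsilon> > 0"
    then have e2: "\<epsilon> / 2 > 0" by simp
    obtain N where N: "\<forall>i\<ge>N. \<forall>j\<ge>N. norm (X i - X j) < \<epsilon> / 2" using CauchyD[OF X e2] by auto
    have "norm (X n - hs_of T) \<le> \<epsilon> / 2" if "n \<ge> N" for n
      by (rule norm_hs_leI)
         (use e bound[OF e2 N that] in \<open>auto simp: minus_hs.rep_eq hs_op_of[OF HS]\<close>)
    then show "\<exists>N. \<forall>n\<ge>N. norm (X n - hs_of T) < \<epsilon>" using e by (force intro!: exI[of _ N])
  qed
  then show "convergent X" by (auto simp: convergent_def)
qed

instance hs :: ("{real_inner,banach,second_countable_topology}") second_countable_topology
proof
  obtain D :: "'a set" where D: "countable D" "\<And>X. open X \<Longrightarrow> X \<noteq> {} \<Longrightarrow> \<exists>d\<in>D. d \<in> X"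
    by (rule countable_dense_setE) blast
  define R :: "('a \<times> 'a) list \<Rightarrow> 'a hs"
    where "R ps = sum_list (map (\<lambda>(e, d). hs_of (tensor e d)) ps)" for ps
  define E where "E = R ` lists (onb \<times> D)"
  have cE: "countable E"
    unfolding E_def by (intro countable_image countable_lists countable_SIGMA countable_onb D(1))
  have dense: "\<exists>S\<in>E. dist S T < \<epsilon>" if e: "\<epsilon> > 0" for T :: "'a hs" and \<epsilon>
  proof -
    define tot where "tot = (\<Sum>\<^sub>\<infinity>e\<in>onb. (norm (hs_op T e))\<^sup>2)"
    have HS: "hilbert_schmidt (hs_op T)" by simp
    have "\<exists>F. finite F \<and> F \<subseteq> onb \<and> (\<Sum>e\<in>F. (norm (hs_op T e))\<^sup>2) > tot - \<epsilon>\<^sup>2 / 8"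
    proof (rule ccontr)
      assume "\<not> ?thesis"
      then have "tot \<le> tot - \<epsilon>\<^sup>2 / 8"
        using HS unfolding tot_def hilbert_schmidt_def
        by (intro infsum_le_finite_sums) (auto simp: not_less)
      then show False using e by simp
    qed
    then obtain F where F: "finite F" "F \<subseteq> onb" "(\<Sum>e\<in>F. (norm (hs_op T e))\<^sup>2) > tot - \<epsilon>\<^sup>2 / 8"
      by blast
    define \<delta> where "\<delta> = \<epsilon>\<^sup>2 / (8 * (real (card F) + 1))"
    have d: "\<delta> > 0" using e by (simp add: \<delta>_def)
    have "\<exists>y\<in>D. (norm (z - y))\<^sup>2 \<le> \<delta>" for z
    proof -
      obtain y where "y \<in> D" "y \<in> ball z (sqrt \<delta>)" using D(2)[of "ball z (sqrt \<delta>)"] d by auto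
      moreover from this(2) have "(norm (z - y))\<^sup>2 \<le> (sqrt \<delta>)\<^sup>2"
        by (intro power_mono) (auto simp: dist_norm)
      ultimately show ?thesis using d by auto
    qed
    then obtain g where g: "\<And>z. g z \<in> D" "\<And>z. (norm (z - g z))\<^sup>2 \<le> \<delta>" by metis
    define S where "S = (\<Sum>e\<in>F. hs_of (tensor e (g (hs_op T e))))"
    obtain es where es: "set es = F" "distinct es" using finite_distinct_list[OF F(1)] by blast
    have "S = R (map (\<lambda>e. (e, g (hs_op T e))) es)"
      unfolding S_def R_def using es by (simp add: sum_list_distinct_conv_sum_set comp_def)
    then have SE: "S \<in> E"
      unfolding E_def using es F(2) g(1) by (auto intro!: imageI)
    have opsum: "hs_op (sum h F) = (\<Sum>e\<in>F. hs_op (h e))" if "finite F" for h :: "'a \<Rightarrow> 'a hs" and F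
      using that by induction (auto simp: zero_hs.rep_eq plus_hs.rep_eq)
    have Sop: "hs_op S x = (\<Sum>e\<in>F. (e \<bullet> x) *\<^sub>R g (hs_op T e))" for x
      unfolding S_def opsum[OF F(1)] by (simp add: hs_op_of hilbert_schmidt_tensor blinfun.sum_left)
    have Se: "hs_op S e = (if e \<in> F then g (hs_op T e) else 0)" if "e \<in> onb" for e
    proof -
      have "hs_op S e = (\<Sum>f\<in>F. if f = e then g (hs_op T f) else 0)"
        unfolding Sop
        by (rule sum.cong)
           (use F(2) that in \<open>auto simp: orthonormalD[OF orthonormal_onb] subset_iff\<close>)
      then show ?thesis using F(1) by simp
    qed
    have "norm (S - T) \<le> \<epsilon> / 2"
    proof (rule norm_hs_leI)
      fix G :: "'a set" assume G: "finite G" "G \<subseteq> onb"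
      let ?h = "\<lambda>e. (norm (hs_op (S - T) e))\<^sup>2"
      have "sum ?h G \<le> sum ?h (F \<union> (G - F))"
        by (rule sum_mono2) (use F G in auto)
      also have "\<dots> = sum ?h F + sum ?h (G - F)"
        by (rule sum.union_disjoint) (use F G in auto)
      also have "sum ?h F \<le> (\<Sum>e\<in>F. \<delta>)"
        by (rule sum_mono)
           (use F(2) g(2) in \<open>auto simp: minus_hs.rep_eq minus_blinfun.rep_eq Se subset_iff
              norm_minus_commute\<close>)
      also have "\<dots> \<le> \<epsilon>\<^sup>2 / 8"
      proof -
        have "real (card F) * \<delta> \<le> (real (card F) + 1) * \<delta>" using d by simp
        also have "\<dots> = \<epsilon>\<^sup>2 / 8" by (simp add: \<delta>_def field_simps)
        finally show ?thesis by simp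
      qed
      also have "sum ?h (G - F) = (\<Sum>e\<in>G - F. (norm (hs_op T e))\<^sup>2)"
        by (rule sum.cong) (use G in \<open>auto simp: minus_hs.rep_eq minus_blinfun.rep_eq Se subset_iff\<close>)
      also have "\<dots> \<le> \<epsilon>\<^sup>2 / 8"
      proof -
        have "(\<Sum>e\<in>F. (norm (hs_op T e))\<^sup>2) + (\<Sum>e\<in>G - F. (norm (hs_op T e))\<^sup>2)
            = (\<Sum>e\<in>F \<union> (G - F). (norm (hs_op T e))\<^sup>2)"
          by (rule sum.union_disjoint[symmetric]) (use F G in auto)
        also have "\<dots> \<le> tot"
          unfolding tot_def by (rule hilbert_schmidt_sum_le[OF HS]) (use F G in auto)
        finally show ?thesis using F(3) by linarith
      qed
      finally show "sum ?h G \<le> (\<epsilon> / 2)\<^sup>2" by (simp add: power_divide)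
    qed (use e in simp)
    then show ?thesis using SE e by (intro bexI[of _ S]) (auto simp: dist_norm)
  qed
  define \<B> where "\<B> = (\<lambda>(S, n). ball S (1 / real (Suc n))) ` (E \<times> UNIV)"
  have "topological_basis \<B>"
  proof (rule topological_basisI)
    show "open U" if "U \<in> \<B>" for U using that by (auto simp: \<B>_def)
    fix U and T :: "'a hs" assume U: "open U" "T \<in> U"
    then obtain \<epsilon> where e: "\<epsilon> > 0" "ball T \<epsilon> \<subseteq> U" by (auto simp: open_contains_ball)
    obtain n where n: "1 / real (Suc n) < \<epsilon> / 2"
      using reals_Archimedean[of "\<epsilon> / 2"] e by (auto simp: inverse_eq_divide)
    obtain S where S: "S \<in> E" "dist S T < 1 / real (Suc n)" using dense[of "1 / real (Suc n)" T] by auto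
    have "ball S (1 / real (Suc n)) \<subseteq> ball T \<epsilon>"
    proof
      fix R assume "R \<in> ball S (1 / real (Suc n))"
      then show "R \<in> ball T \<epsilon>" using S(2) n dist_triangle[of T R S] by (simp add: dist_commute)
    qed
    then show "\<exists>B'\<in>\<B>. T \<in> B' \<and> B' \<subseteq> U"
      using S e(2) unfolding \<B>_def by (intro bexI[of _ "ball S (1 / real (Suc n))"]) auto
  qed
  moreover have "countable \<B>" unfolding \<B>_def using cE by auto
  ultimately show "\<exists>B::'a hs set set. countable B \<and> open = generate_topology B"
    using topological_basis_imp_subbasis by blast
qed

text \<open>Trace class operators in the sense of nuclear representations
  \<open>T x = (\<Sum>k. \<langle>a k, x\<rangle> b k)\<close> with \<open>(\<Sum>k. |a k| |b k|) < \<infinity>\<close>.\<close>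

definition trace_class :: "('a::real_inner \<Rightarrow>\<^sub>L 'a) \<Rightarrow> bool" where
  "trace_class T \<longleftrightarrow> (\<exists>a b :: nat \<Rightarrow> 'a. summable (\<lambda>k. norm (a k) * norm (b k)) \<and>
     (\<forall>x. (\<lambda>k. (a k \<bullet> x) *\<^sub>R b k) sums T x))"

definition symmetric_operator :: "('a::real_inner \<Rightarrow>\<^sub>L 'a) \<Rightarrow> bool" where
  "symmetric_operator T \<longleftrightarrow> (\<forall>x y. T x \<bullet> y = x \<bullet> T y)"

definition positive_definite :: "('a::real_inner \<Rightarrow>\<^sub>L 'a) \<Rightarrow> bool" where
  "positive_definite T \<longleftrightarrow> (\<forall>x. x \<noteq> 0 \<longrightarrow> T x \<bullet> x > 0)"

text \<open>A filtration is a family \<open>F\<close> indexed by all reals of which only the times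
  \<open>t \<ge> 0\<close> matter, and only through \<open>sets (F t)\<close>. It need neither be complete nor
  right-continuous.\<close>

definition filtered_prob_space :: "'w measure \<Rightarrow> (real \<Rightarrow> 'w measure) \<Rightarrow> bool" where
  "filtered_prob_space M F \<longleftrightarrow> prob_space M \<and> (\<forall>t\<ge>0. subalgebra M (F t)) \<and>
     (\<forall>s t. 0 \<le> s \<and> s \<le> t \<longrightarrow> sets (F s) \<subseteq> sets (F t))"

definition predictable_sigma :: "'w measure \<Rightarrow> (real \<Rightarrow> 'w measure) \<Rightarrow> (real \<times> 'w) measure" where
  "predictable_sigma M F = sigma ({0..} \<times> space M)
     ({{s<..t} \<times> A | s t A. 0 \<le> s \<and> s \<le> t \<and> A \<in> sets (F s)} \<union> {{0} \<times> A | A. A \<in> sets (F 0)})"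

definition predictable ::
  "'w measure \<Rightarrow> (real \<Rightarrow> 'w measure) \<Rightarrow> (real \<Rightarrow> 'w \<Rightarrow> 'k::topological_space) \<Rightarrow> bool" where
  "predictable M F X \<longleftrightarrow> (\<lambda>(t, \<omega>). X t \<omega>) \<in> borel_measurable (predictable_sigma M F)"

definition centered_gaussian :: "'w measure \<Rightarrow> ('w \<Rightarrow> real) \<Rightarrow> real \<Rightarrow> bool" where
  "centered_gaussian M X v \<longleftrightarrow>
     (if v = 0 then X \<in> borel_measurable M \<and> (AE \<omega> in M. X \<omega> = 0)
      else v > 0 \<and> distributed M lborel X (normal_density 0 (sqrt v)))"

text \<open>Gaussianity of the \<open>'h\<close>-valued increments is that of all their one-dimensional
  projections.\<close>

definition wiener_process ::
  "'w measure \<Rightarrow> (real \<Rightarrow> 'w measure) \<Rightarrow> ('h::real_inner \<Rightarrow>\<^sub>L 'h) \<Rightarrow> (real \<Rightarrow> 'w \<Rightarrow> 'h) \<Rightarrow> bool" where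
  "wiener_process M F Q W \<longleftrightarrow>
     (\<forall>t\<ge>0. W t \<in> borel_measurable (F t)) \<and>
     (AE \<omega> in M. W 0 \<omega> = 0) \<and>
     (AE \<omega> in M. continuous_on {0..} (\<lambda>t. W t \<omega>)) \<and>
     (\<forall>s t h. 0 \<le> s \<and> s < t \<longrightarrow>
        centered_gaussian M (\<lambda>\<omega>. (W t \<omega> - W s \<omega>) \<bullet> h) ((t - s) * (Q h \<bullet> h))) \<and>
     (\<forall>s t. 0 \<le> s \<and> s < t \<longrightarrow>
        prob_space.indep_set M (sets (F s))
          {(\<lambda>\<omega>. W t \<omega> - W s \<omega>) -` A \<inter> space M | A. A \<in> sets borel})"

text \<open>Elementary integrands \<open>\<Sum>i<N. C i \<cdot> 1 {\<tau> i<..\<tau> (Suc i)}\<close>, where \<open>C i\<close> takes finitely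
  many values in the bounded operators and is measurable with respect to \<open>F (\<tau> i)\<close>.\<close>

definition elementary_integrand ::
  "'w measure \<Rightarrow> (real \<Rightarrow> 'w measure) \<Rightarrow> nat \<Rightarrow> (nat \<Rightarrow> real) \<Rightarrow>
    (nat \<Rightarrow> 'w \<Rightarrow> ('h::real_normed_vector \<Rightarrow>\<^sub>L 'k::real_normed_vector)) \<Rightarrow> bool" where
  "elementary_integrand M F N \<tau> C \<longleftrightarrow> 0 \<le> \<tau> 0 \<and>
     (\<forall>i<N. \<tau> i \<le> \<tau> (Suc i) \<and> finite (C i ` space M) \<and>
        (\<forall>B. {\<omega> \<in> space M. C i \<omega> = B} \<in> sets (F (\<tau> i))))"

definition elementary_process ::
  "nat \<Rightarrow> (nat \<Rightarrow> real) \<Rightarrow> (nat \<Rightarrow> 'w \<Rightarrow> ('h::real_normed_vector \<Rightarrow>\<^sub>L 'k::real_normed_vector)) \<Rightarrow>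
    real \<Rightarrow> 'w \<Rightarrow> ('h \<Rightarrow>\<^sub>L 'k)" where
  "elementary_process N \<tau> C t \<omega> = (\<Sum>i<N. indicator {\<tau> i<..\<tau> (Suc i)} t *\<^sub>R C i \<omega>)"

definition elementary_integral ::
  "(real \<Rightarrow> 'w \<Rightarrow> 'h) \<Rightarrow> nat \<Rightarrow> (nat \<Rightarrow> real) \<Rightarrow>
    (nat \<Rightarrow> 'w \<Rightarrow> ('h::real_normed_vector \<Rightarrow>\<^sub>L 'k::real_normed_vector)) \<Rightarrow> real \<Rightarrow> 'w \<Rightarrow> 'k" where
  "elementary_integral W N \<tau> C t \<omega> =
     (\<Sum>i<N. C i \<omega> (W (min t (\<tau> (Suc i))) \<omega> - W (min t (\<tau> i)) \<omega>))"

text \<open>The trace of \<open>\<Phi> Q \<Phi>\<^sup>*\<close>, that is the squared Hilbert--Schmidt norm of \<open>\<Phi> Q\<^sup>1\<^sup>/\<^sup>2\<close>.\<close>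

definition cov_norm_sq ::
  "('h::real_inner \<Rightarrow>\<^sub>L 'h) \<Rightarrow> ('h \<Rightarrow> 'k::{real_inner,second_countable_topology}) \<Rightarrow> ennreal" where
  "cov_norm_sq Q \<Phi> = (\<Sum>\<^sub>\<infinity>f\<in>onb. ennreal (Q (adjoint \<Phi> f) \<bullet> adjoint \<Phi> f))"

definition null_in_prob :: "'w measure \<Rightarrow> (nat \<Rightarrow> 'w \<Rightarrow> ennreal) \<Rightarrow> bool" where
  "null_in_prob M X \<longleftrightarrow> (\<forall>n. X n \<in> borel_measurable M) \<and>
     (\<forall>\<epsilon>::real. \<epsilon> > 0 \<longrightarrow> (\<lambda>n. measure M {\<omega> \<in> space M. X n \<omega> > ennreal \<epsilon>}) \<longlonglongrightarrow> 0)"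

text \<open>\<open>I\<close> is a continuous version of the stochastic integral process \<open>\<integral>\<^sub>0 \<Phi> dW\<close> of a predictable
  \<open>L('h, 'k)\<close>-valued integrand with \<open>\<integral>\<^sub>0\<^sup>T |\<Phi> Q\<^sup>1\<^sup>/\<^sup>2|\<^sup>2 ds < \<infinity>\<close> almost surely for
  all \<open>T\<close>: the limit in probability of the integrals of elementary integrands approximating
  \<open>\<Phi>\<close> (localised Ito integral). These requirements determine \<open>I\<close> up to
  indistinguishability.\<close>

definition stochastic_integral ::
  "'w measure \<Rightarrow> (real \<Rightarrow> 'w measure) \<Rightarrow> ('h::{real_inner,banach,second_countable_topology} \<Rightarrow>\<^sub>L 'h) \<Rightarrow>
    (real \<Rightarrow> 'w \<Rightarrow> 'h) \<Rightarrow> (real \<Rightarrow> 'w \<Rightarrow> 'h \<Rightarrow> 'k::{real_inner,banach,second_countable_topology}) \<Rightarrow>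
    (real \<Rightarrow> 'w \<Rightarrow> 'k) \<Rightarrow> bool" where
  "stochastic_integral M F Q W \<Phi> I \<longleftrightarrow>
     (\<forall>t\<ge>0. \<forall>\<omega>\<in>space M. bounded_linear (\<Phi> t \<omega>)) \<and>
     (\<forall>h. predictable M F (\<lambda>t \<omega>. \<Phi> t \<omega> h)) \<and>
     (\<forall>T\<ge>0. AE \<omega> in M. (\<integral>\<^sup>+s\<in>{0..T}. cov_norm_sq Q (\<Phi> s \<omega>) \<partial>lborel) < \<infinity>) \<and>
     (\<forall>t\<ge>0. I t \<in> borel_measurable (F t)) \<and>
     (AE \<omega> in M. continuous_on {0..} (\<lambda>t. I t \<omega>)) \<and>
     (\<exists>N \<tau> C. (\<forall>n. elementary_integrand M F (N n) (\<tau> n) (C n)) \<and>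
        (\<forall>T\<ge>0. null_in_prob M (\<lambda>n \<omega>. \<integral>\<^sup>+s\<in>{0..T}.
           cov_norm_sq Q (\<lambda>h. \<Phi> s \<omega> h - elementary_process (N n) (\<tau> n) (C n) s \<omega> h) \<partial>lborel)) \<and>
        (\<forall>t\<ge>0. null_in_prob M (\<lambda>n \<omega>.
           ennreal (norm (I t \<omega> - elementary_integral W (N n) (\<tau> n) (C n) t \<omega>)))))"

text \<open>The (strong) meaning of \<open>dX(t) = b(t) dt + \<Phi>(t) dW(t)\<close>; the time integral is a Bochner
  integral in \<open>'k\<close>.\<close>

definition ito_differential ::
  "'w measure \<Rightarrow> (real \<Rightarrow> 'w measure) \<Rightarrow> ('h::{real_inner,banach,second_countable_topology} \<Rightarrow>\<^sub>L 'h) \<Rightarrow>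
    (real \<Rightarrow> 'w \<Rightarrow> 'h) \<Rightarrow> (real \<Rightarrow> 'w \<Rightarrow> 'k::{real_inner,banach,second_countable_topology}) \<Rightarrow>
    (real \<Rightarrow> 'w \<Rightarrow> 'k) \<Rightarrow> (real \<Rightarrow> 'w \<Rightarrow> 'h \<Rightarrow> 'k) \<Rightarrow> bool" where
  "ito_differential M F Q W X b \<Phi> \<longleftrightarrow> predictable M F X \<and> predictable M F b \<and>
     (\<exists>I. stochastic_integral M F Q W \<Phi> I \<and>
       (AE \<omega> in M. \<forall>t\<ge>0. set_integrable lborel {0..t} (\<lambda>s. b s \<omega>) \<and>
          X t \<omega> = X 0 \<omega> + (LINT s:{0..t}|lborel. b s \<omega>) + I t \<omega>))"

definition variance_process ::
  "(real \<Rightarrow> 'w \<Rightarrow> 'h::real_inner) \<Rightarrow> real \<Rightarrow> 'w \<Rightarrow> ('h \<Rightarrow>\<^sub>L 'h)" where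
  "variance_process Y t \<omega> = tensor (Y t \<omega>) (Y t \<omega>)"

definition Gamma_process ::
  "(real \<Rightarrow> 'w \<Rightarrow> 'h::real_inner) \<Rightarrow> 'h \<Rightarrow> real \<Rightarrow> 'w \<Rightarrow> ('h \<Rightarrow>\<^sub>L 'h)" where
  "Gamma_process Y z t \<omega> = tensor z (Y t \<omega>)"

definition variance_drift ::
  "('h::{real_inner,banach} \<Rightarrow>\<^sub>L 'h) \<Rightarrow> ('h \<Rightarrow>\<^sub>L 'h) \<Rightarrow> ('h \<Rightarrow>\<^sub>L 'h) \<Rightarrow>
    (real \<Rightarrow> 'w \<Rightarrow> 'h) \<Rightarrow> real \<Rightarrow> 'w \<Rightarrow> ('h \<Rightarrow>\<^sub>L 'h)" where
  "variance_drift A \<eta> Q Y t \<omega> =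
     (A o\<^sub>L variance_process Y t \<omega> o\<^sub>L adj A) + variance_process Y t \<omega>
     - ((A - id_blinfun) o\<^sub>L variance_process Y t \<omega> o\<^sub>L (adj A - id_blinfun))
     + (\<eta> o\<^sub>L Q o\<^sub>L adj \<eta>)"

definition variance_diffusion ::
  "('h::{real_inner,banach} \<Rightarrow>\<^sub>L 'h) \<Rightarrow> (real \<Rightarrow> 'w \<Rightarrow> 'h) \<Rightarrow> real \<Rightarrow> 'w \<Rightarrow> 'h \<Rightarrow> ('h \<Rightarrow>\<^sub>L 'h)" where
  "variance_diffusion \<eta> Y t \<omega> f =
     (if \<eta> f = 0 then 0
      else norm (\<eta> f) *\<^sub>R (Gamma_process Y (\<eta> f /\<^sub>R norm (\<eta> f)) t \<omega>
                         + adj (Gamma_process Y (\<eta> f /\<^sub>R norm (\<eta> f)) t \<omega>)))"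

lemma hilbert_schmidt_variance_process: "hilbert_schmidt (variance_process Y t \<omega>)"
  by (simp add: variance_process_def hilbert_schmidt_tensor)

lemma hilbert_schmidt_variance_diffusion: "hilbert_schmidt (variance_diffusion \<eta> Y t \<omega> f)"
  by (auto simp: variance_diffusion_def Gamma_process_def adj_tensor
      intro!: hilbert_schmidt_zero hilbert_schmidt_scaleR hilbert_schmidt_add hilbert_schmidt_tensor)

end

theory Submission
  imports Defs
begin

text \<open>
  The stochastic integral of the constant \<open>\<eta>\<close> is \<open>\<eta> W\<close>, by the tail estimate
  \<open>P(|\<integral> C dW| > \<epsilon>) \<le> \<delta> / \<epsilon>\<^sup>2 + P(\<integral> |C Q\<^sup>1\<^sup>/\<^sup>2|\<^sup>2 ds > \<delta>)\<close> for elementary \<open>C\<close>, so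
  \<open>Y\<close> is pathwise \<open>\<eta> W\<close> plus a continuously differentiable part. Telescoping \<open>Y \<otimes> Y\<close> along
  dyadic times then leaves three contributions: the terms \<open>Y \<otimes> \<eta> \<Delta>W + \<eta> \<Delta>W \<otimes> Y\<close>, which after
  replacing \<open>Y\<close> by simple functions are integrals of elementary integrands; the terms in
  \<open>A Y \<Delta>t\<close>, which converge pathwise to the drift integral; and the sum of \<open>(\<eta> \<Delta>W)\<^sup>\<otimes>\<^sup>2\<close>,
  whose Hilbert--Schmidt distance to \<open>t \<eta> Q \<eta>\<^sup>*\<close> has second moment \<open>O(2\<^sup>-\<^sup>n)\<close> by independence
  and the fourth Gaussian moment. Summability in \<open>n\<close> makes this convergence almost sure.
\<close>

subsection \<open>Sums over countable sets\<close>

text \<open>\<open>stochastic_integral\<close> only says that some elementary integrands approximate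
  the integrand, so nothing is known at first about how \<open>J\<close> depends on the path of
  \<open>W\<close>. The tail estimate turns closeness of integrands into closeness of integrals and
  thereby pins \<open>J\<close> down; afterwards \<open>Y\<close> enters only through its equation
  and the continuity of its paths, without any moments. The integral in the conclusion is read off
  the equation: \<open>I\<close> is the square minus its initial value minus the drift integral.
  Adaptedness and continuity are then immediate, and the work is to exhibit elementary integrands
  whose integrals converge to \<open>I\<close>. One sequence must serve all times at once, with
  finitely many values per cell. Hence the grid \<open>i / 2 ^ n\<close> on \<open>[0, n]\<close>,
  and simple functions so close to \<open>Y\<close> that the error vanishes even when added up over
  all \<open>n * 2 ^ n\<close> cells: the noise has no finite variation that could absorb it. The
  stated drift collapses: with \<open>V\<close> the square,
  \<open>A V adj A + V - (A - 1) V (adj A - 1) = A V + V adj A\<close>, the derivative of the square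
  in direction \<open>A Y\<close>.\<close>

text \<open>Both sides are suprema of finite sums. Passing to \<open>count_space\<close> makes
  Tonelli available for sums over a basis.\<close>

lemma infsum_ennreal_eq_nn_integral:
  fixes g :: "'a \<Rightarrow> ennreal"
  assumes B: "countable B"
  shows "(\<Sum>\<^sub>\<infinity>f\<in>B. g f) = (\<integral>\<^sup>+f. g f \<partial>count_space B)"
proof -
  have S: "(\<Sum>\<^sub>\<infinity>f\<in>B. g f) = (SUP F\<in>{F. finite F \<and> F \<subseteq> B}. sum g F)"
    by (rule nonneg_infsum_complete) simp
  have fin: "sum g F = (\<integral>\<^sup>+f. g f * indicator F f \<partial>count_space B)" if "finite F" "F \<subseteq> B" for F
    using that by (subst nn_integral_count_space'[where A = F]) (auto split: split_indicator)
  show ?thesis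
  proof (rule antisym)
    show "(\<Sum>\<^sub>\<infinity>f\<in>B. g f) \<le> (\<integral>\<^sup>+f. g f \<partial>count_space B)"
      unfolding S by (rule SUP_least) (auto simp: fin split: split_indicator intro!: nn_integral_mono)
    show "(\<integral>\<^sup>+f. g f \<partial>count_space B) \<le> (\<Sum>\<^sub>\<infinity>f\<in>B. g f)"
    proof (cases "finite B")
      case True
      then show ?thesis by (simp add: nn_integral_count_space_finite)
    next
      case False
      then have bij: "bij_betw (from_nat_into B) UNIV B"
        using B by (rule bij_betw_from_nat_into[rotated])
      have "(\<integral>\<^sup>+f. g f \<partial>count_space B) = (\<Sum>i. g (from_nat_into B i))"
        by (simp add: nn_integral_bij_count_space[OF bij, symmetric] nn_integral_count_space_nat)
      also have "\<dots> = (SUP n. \<Sum>i<n. g (from_nat_into B i))"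
        by (rule suminf_eq_SUP)
      also have "\<dots> \<le> (SUP F\<in>{F. finite F \<and> F \<subseteq> B}. sum g F)"
      proof (rule SUP_least)
        fix n
        have "(\<Sum>i<n. g (from_nat_into B i)) = sum g (from_nat_into B ` {..<n})"
          using bij by (subst sum.reindex) (auto simp: bij_betw_def intro: inj_on_subset)
        also have "\<dots> \<le> (SUP F\<in>{F. finite F \<and> F \<subseteq> B}. sum g F)"
          using bij by (intro SUP_upper) (auto simp: bij_betw_def)
        finally show "(\<Sum>i<n. g (from_nat_into B i)) \<le> (SUP F\<in>{F. finite F \<and> F \<subseteq> B}. sum g F)" .
      qed
      finally show ?thesis unfolding S .
    qed
  qed
qed

lemma ennreal_infsum:
  assumes "f summable_on A" and "\<And>x. x \<in> A \<Longrightarrow> f x \<ge> 0"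
  shows "ennreal (infsum f A) = (\<Sum>\<^sub>\<infinity>x\<in>A. ennreal (f x))"
proof -
  have "(\<Sum>\<^sub>\<infinity>x\<in>A. ennreal (f x)) = (SUP F\<in>{F. finite F \<and> F \<subseteq> A}. \<Sum>x\<in>F. ennreal (f x))"
    by (rule nonneg_infsum_complete) simp
  also have "\<dots> = (SUP F\<in>{F. finite F \<and> F \<subseteq> A}. ennreal (sum f F))"
    using assms(2) by (intro SUP_cong refl sum_ennreal) auto
  finally show ?thesis using infsum_nonneg_is_SUPREMUM_ennreal[OF assms] by simp
qed

text \<open>The sum is a supremum over finite subsets, and a countable \<open>B\<close> has only
  countably many of them.\<close>

lemma borel_measurable_infsum_ennreal:
  fixes g :: "'b \<Rightarrow> 'a \<Rightarrow> ennreal"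
  assumes "countable B" and "\<And>f. f \<in> B \<Longrightarrow> g f \<in> borel_measurable N"
  shows "(\<lambda>x. \<Sum>\<^sub>\<infinity>f\<in>B. g f x) \<in> borel_measurable N"
proof -
  have "(\<lambda>x. \<Sum>\<^sub>\<infinity>f\<in>B. g f x) = (\<lambda>x. SUP F\<in>{F. finite F \<and> F \<subseteq> B}. \<Sum>f\<in>F. g f x)"
    by (intro ext nonneg_infsum_complete) simp
  also have "\<dots> \<in> borel_measurable N"
    using assms by (intro borel_measurable_SUP countable_Collect_finite_subset borel_measurable_sum) auto
  finally show ?thesis .
qed

lemma Parseval_ennreal:
  fixes x :: "'a::{real_inner,second_countable_topology}"
  shows "(\<Sum>\<^sub>\<infinity>f\<in>onb. ennreal ((x \<bullet> f)\<^sup>2)) = ennreal ((norm x)\<^sup>2)"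
  by (simp add: ennreal_infsum[symmetric] Bessel_summable orthonormal_onb Parseval orthonormal_basis_onb)

subsection \<open>Rank one operators in the Hilbert--Schmidt space\<close>

text \<open>Living in \<open>'a hs\<close> makes limits and norms of squares Hilbert-Schmidt ones
  and gives access to the rules for bounded bilinear maps.\<close>

definition htensor :: "'a::{real_inner,second_countable_topology} \<Rightarrow> 'a \<Rightarrow> 'a hs" where
  "htensor f g = hs_of (tensor f g)"

lemma hs_op_htensor [simp]: "hs_op (htensor f g) = tensor f g"
  by (simp add: htensor_def hs_op_of hilbert_schmidt_tensor)

lemma hs_eqI: "(\<And>x. hs_op S x = hs_op T x) \<Longrightarrow> S = T"
  by (metis blinfun_eqI hs_op_inject)

lemma norm_htensor: "norm (htensor f g) = norm f * norm g"
proof -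
  have "(norm (htensor f g))\<^sup>2 = (\<Sum>\<^sub>\<infinity>e\<in>onb. (f \<bullet> e)\<^sup>2 * (norm g)\<^sup>2)"
    by (simp add: norm_hs_sq power_mult_distrib)
  also have "\<dots> = (norm f * norm g)\<^sup>2"
    by (simp add: infsum_cmult_left' Parseval orthonormal_basis_onb power_mult_distrib)
  finally show ?thesis by (simp add: power2_eq_iff_nonneg)
qed

lemma bounded_bilinear_htensor: "bounded_bilinear htensor"
proof
  fix f f' g g' :: 'a and r :: real
  show "htensor (f + f') g = htensor f g + htensor f' g"
    by (rule hs_eqI) (simp add: plus_hs.rep_eq plus_blinfun.rep_eq inner_add_left scaleR_left_distrib)
  show "htensor f (g + g') = htensor f g + htensor f g'"
    by (rule hs_eqI) (simp add: plus_hs.rep_eq plus_blinfun.rep_eq scaleR_right_distrib)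
  show "htensor (r *\<^sub>R f) g = r *\<^sub>R htensor f g" "htensor f (r *\<^sub>R g) = r *\<^sub>R htensor f g"
    by (rule hs_eqI, simp add: scaleR_hs.rep_eq scaleR_blinfun.rep_eq)+
  show "\<exists>K. \<forall>f g :: 'a. norm (htensor f g) \<le> norm f * norm g * K"
    by (intro exI[of _ 1]) (simp add: norm_htensor)
qed

interpretation htensor: bounded_bilinear htensor
  by (rule bounded_bilinear_htensor)

text \<open>Parseval in both variables. It reduces second moments of operators to those of scalar
  matrix entries, where one-dimensional Gaussian moments suffice; in \<open>ennreal\<close> the sums
  may be exchanged with expectations freely.\<close>

lemma norm_hs_sq_ennreal:
  fixes S :: "'a::{real_inner,second_countable_topology} hs"
  shows "ennreal ((norm S)\<^sup>2) = (\<Sum>\<^sub>\<infinity>e\<in>onb. \<Sum>\<^sub>\<infinity>f\<in>onb. ennreal ((hs_op S e \<bullet> f)\<^sup>2))"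
  unfolding Parseval_ennreal norm_hs_sq
  using hilbert_schmidt_hs_op[of S] by (intro ennreal_infsum) (auto simp: hilbert_schmidt_def)

text \<open>The derivative of the map from \<open>g\<close> to \<open>htensor g g\<close> in
  direction \<open>f\<close>. Drift and diffusion of the square both have this form.\<close>

definition sym_tensor :: "'a::{real_inner,second_countable_topology} \<Rightarrow> 'a \<Rightarrow> 'a hs" where
  "sym_tensor f g = htensor f g + htensor g f"

lemma bounded_bilinear_sym_tensor: "bounded_bilinear sym_tensor"
proof
  fix f f' g g' :: 'a and r :: real
  show "sym_tensor (f + f') g = sym_tensor f g + sym_tensor f' g"
    "sym_tensor f (g + g') = sym_tensor f g + sym_tensor f g'"
    "sym_tensor (r *\<^sub>R f) g = r *\<^sub>R sym_tensor f g" "sym_tensor f (r *\<^sub>R g) = r *\<^sub>R sym_tensor f g"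
    by (simp_all add: sym_tensor_def htensor.add_left htensor.add_right htensor.scaleR_left
        htensor.scaleR_right scaleR_right_distrib)
  have "norm (sym_tensor f g) \<le> norm f * norm g * 2" for f g :: 'a
    using norm_triangle_ineq[of "htensor f g" "htensor g f"]
    by (simp add: sym_tensor_def norm_htensor)
  then show "\<exists>K. \<forall>f g :: 'a. norm (sym_tensor f g) \<le> norm f * norm g * K" by blast
qed

interpretation sym_tensor: bounded_bilinear sym_tensor
  by (rule bounded_bilinear_sym_tensor)

lemma norm_sym_tensor: "norm (sym_tensor f g) \<le> 2 * norm f * norm g"
  using norm_triangle_ineq[of "htensor f g" "htensor g f"]
  by (simp add: sym_tensor_def norm_htensor)

subsection \<open>Covariance norms\<close>

lemma infsum_suminf_swap_ennreal:
  fixes g :: "'b \<Rightarrow> nat \<Rightarrow> ennreal"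
  assumes "countable B"
  shows "(\<Sum>\<^sub>\<infinity>f\<in>B. \<Sum>k. g f k) = (\<Sum>k. \<Sum>\<^sub>\<infinity>f\<in>B. g f k)"
  unfolding infsum_ennreal_eq_nn_integral[OF assms] by (rule nn_integral_suminf) simp

text \<open>Cauchy-Schwarz on each finite set of basis vectors, followed by Bessel.\<close>

lemma infsum_inner_prod_le:
  fixes x y :: "'a::{real_inner,second_countable_topology}"
  shows "(\<Sum>\<^sub>\<infinity>f\<in>onb. ennreal \<bar>(x \<bullet> f) * (y \<bullet> f)\<bar>) \<le> ennreal (norm x * norm y)"
proof -
  have "(\<Sum>f\<in>F. ennreal \<bar>(x \<bullet> f) * (y \<bullet> f)\<bar>) \<le> ennreal (norm x * norm y)"
    if F: "finite F" "F \<subseteq> onb" for F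
  proof -
    have "(\<Sum>f\<in>F. \<bar>x \<bullet> f\<bar> * \<bar>y \<bullet> f\<bar>) \<le> L2_set (\<lambda>f. x \<bullet> f) F * L2_set (\<lambda>f. y \<bullet> f) F"
      by (rule L2_set_mult_ineq)
    also have "\<dots> \<le> norm x * norm y"
      unfolding L2_set_def
      by (intro mult_mono real_le_lsqrt Bessel_finite[OF orthonormal_onb] F)
         (auto intro!: sum_nonneg)
    finally show ?thesis by (simp add: sum_ennreal abs_mult ennreal_leI)
  qed
  then show ?thesis
    by (subst nonneg_infsum_complete) (auto intro!: SUP_least)
qed

text \<open>Any \<open>c\<close> coming from one nuclear representation bounds the trace norm, and
  every estimate below asks only for some finite constant of this kind.\<close>

definition nuclear_bound :: "('a::real_inner \<Rightarrow>\<^sub>L 'a) \<Rightarrow> real \<Rightarrow> bool" where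
  "nuclear_bound Q c \<longleftrightarrow> 0 \<le> c \<and> (\<exists>a b :: nat \<Rightarrow> 'a. (\<lambda>k. norm (a k) * norm (b k)) sums c \<and>
     (\<forall>x. (\<lambda>k. (a k \<bullet> x) *\<^sub>R b k) sums Q x))"

lemma trace_class_nuclear_bound:
  assumes "trace_class Q" shows "\<exists>c. nuclear_bound Q c"
proof -
  obtain a b where ab: "summable (\<lambda>k. norm (a k) * norm (b k))"
    "\<forall>x. (\<lambda>k. (a k \<bullet> x) *\<^sub>R b k) sums Q x"
    using assms unfolding trace_class_def by blast
  have "nuclear_bound Q (\<Sum>k. norm (a k) * norm (b k))"
    unfolding nuclear_bound_def
    by (intro conjI exI[of _ a] exI[of _ b] summable_sums suminf_nonneg ab) auto
  then show ?thesis by blast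
qed

text \<open>Inserting a nuclear representation of \<open>Q\<close> turns the diagonal entry at
  \<open>f\<close> into a series of products
  \<open>(\<Phi> (a k) \<bullet> f) * (\<Phi> (b k) \<bullet> f)\<close>. Summing absolute values
  over \<open>f\<close> first gives \<open>norm (\<Phi> (a k)) * norm (\<Phi> (b k))\<close>, and
  the sum over \<open>k\<close> is at most \<open>K\<^sup>2 * c\<close>. This works without a square
  root of \<open>Q\<close>.\<close>

lemma cov_norm_sq_le:
  fixes Q :: "'h::{real_inner,banach} \<Rightarrow>\<^sub>L 'h" and \<Phi> :: "'h \<Rightarrow> 'k::{real_inner,second_countable_topology}"
  assumes c: "nuclear_bound Q c" and \<Phi>: "bounded_linear \<Phi>"
    and K: "\<And>x. norm (\<Phi> x) \<le> K * norm x" "0 \<le> K"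
  shows "cov_norm_sq Q \<Phi> \<le> ennreal (K\<^sup>2 * c)"
proof -
  obtain a b :: "nat \<Rightarrow> 'h" where ab: "(\<lambda>k. norm (a k) * norm (b k)) sums c"
    and Q: "\<And>x. (\<lambda>k. (a k \<bullet> x) *\<^sub>R b k) sums Q x"
    using c unfolding nuclear_bound_def by blast
  have adj: "x \<bullet> adjoint \<Phi> f = \<Phi> x \<bullet> f" for x f
    using adjoint_inner[OF \<Phi>] by simp
  have 1: "ennreal (Q (adjoint \<Phi> f) \<bullet> adjoint \<Phi> f) \<le> (\<Sum>k. ennreal \<bar>(\<Phi> (a k) \<bullet> f) * (\<Phi> (b k) \<bullet> f)\<bar>)" for f
  proof -
    have "(\<lambda>k. (\<Phi> (a k) \<bullet> f) * (\<Phi> (b k) \<bullet> f)) sums (Q (adjoint \<Phi> f) \<bullet> adjoint \<Phi> f)"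
      using bounded_linear.sums[OF bounded_linear_inner_left Q[of "adjoint \<Phi> f"], of "adjoint \<Phi> f", unfolded inner_scaleR_left]
      by (simp only: adj)
    then have L: "(\<lambda>n. ennreal (\<Sum>k<n. (\<Phi> (a k) \<bullet> f) * (\<Phi> (b k) \<bullet> f)))
        \<longlonglongrightarrow> ennreal (Q (adjoint \<Phi> f) \<bullet> adjoint \<Phi> f)"
      unfolding sums_def by (rule tendsto_ennrealI)
    show ?thesis
    proof (rule LIMSEQ_le_const2[OF L], intro exI allI impI)
      fix n
      have "ennreal (\<Sum>k<n. (\<Phi> (a k) \<bullet> f) * (\<Phi> (b k) \<bullet> f))
          \<le> ennreal (\<Sum>k<n. \<bar>(\<Phi> (a k) \<bullet> f) * (\<Phi> (b k) \<bullet> f)\<bar>)"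
        by (intro ennreal_leI sum_mono) simp
      also have "\<dots> = (\<Sum>k<n. ennreal \<bar>(\<Phi> (a k) \<bullet> f) * (\<Phi> (b k) \<bullet> f)\<bar>)"
        by (simp add: sum_ennreal)
      also have "\<dots> \<le> (\<Sum>k. ennreal \<bar>(\<Phi> (a k) \<bullet> f) * (\<Phi> (b k) \<bullet> f)\<bar>)"
        by (rule sum_le_suminf) auto
      finally show "ennreal (\<Sum>k<n. (\<Phi> (a k) \<bullet> f) * (\<Phi> (b k) \<bullet> f))
          \<le> (\<Sum>k. ennreal \<bar>(\<Phi> (a k) \<bullet> f) * (\<Phi> (b k) \<bullet> f)\<bar>)" .
    qed
  qed
  have "cov_norm_sq Q \<Phi> \<le> (\<Sum>\<^sub>\<infinity>f\<in>onb. \<Sum>k. ennreal \<bar>(\<Phi> (a k) \<bullet> f) * (\<Phi> (b k) \<bullet> f)\<bar>)"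
    unfolding cov_norm_sq_def by (rule infsum_mono[OF _ _ 1]) (rule nonneg_summable_on_complete, simp)+
  also have "\<dots> = (\<Sum>k. \<Sum>\<^sub>\<infinity>f\<in>onb. ennreal \<bar>(\<Phi> (a k) \<bullet> f) * (\<Phi> (b k) \<bullet> f)\<bar>)"
    by (rule infsum_suminf_swap_ennreal[OF countable_onb])
  also have "\<dots> \<le> (\<Sum>k. ennreal (K\<^sup>2 * (norm (a k) * norm (b k))))"
  proof (intro suminf_le)
    fix k
    have "norm (\<Phi> (a k)) * norm (\<Phi> (b k)) \<le> (K * norm (a k)) * (K * norm (b k))"
      using K by (intro mult_mono) auto
    then have "ennreal (norm (\<Phi> (a k)) * norm (\<Phi> (b k))) \<le> ennreal (K\<^sup>2 * (norm (a k) * norm (b k)))"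
      by (intro ennreal_leI) (simp add: power2_eq_square ac_simps)
    with infsum_inner_prod_le
    show "(\<Sum>\<^sub>\<infinity>f\<in>onb. ennreal \<bar>(\<Phi> (a k) \<bullet> f) * (\<Phi> (b k) \<bullet> f)\<bar>)
        \<le> ennreal (K\<^sup>2 * (norm (a k) * norm (b k)))" by (rule order_trans)
  qed auto
  also have "\<dots> = ennreal (K\<^sup>2 * c)"
    using sums_mult[OF ab, of "K\<^sup>2"]
    by (intro suminf_ennreal_eq) auto
  finally show ?thesis .
qed

subsection \<open>Predictable processes\<close>

lemma predictable_compose:
  assumes "predictable M F X" and "g \<in> borel_measurable borel"
  shows "predictable M F (\<lambda>t \<omega>. g (X t \<omega>))"
  using measurable_compose[OF assms[unfolded predictable_def]]
  by (simp add: predictable_def case_prod_unfold)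

text \<open>Predictable processes are progressively measurable. It suffices to look at generating
  rectangles: \<open>{s<..r} \<times> A\<close> misses \<open>[0, t]\<close> if
  \<open>t < s\<close>, and otherwise \<open>A \<in> sets (F s)\<close> lies in
  \<open>sets (F t)\<close>.\<close>

lemma predictable_restrict_measurable:
  assumes F: "filtered_prob_space M F" and X: "predictable M F X" and t: "0 \<le> t"
  shows "(\<lambda>(s, \<omega>). X s \<omega>) \<in> borel_measurable (restrict_space (borel \<Otimes>\<^sub>M F t) ({0..t} \<times> space M))"
proof -
  let ?R = "restrict_space (borel \<Otimes>\<^sub>M F t) ({0..t} \<times> space M)"
  have sp: "\<And>s. 0 \<le> s \<Longrightarrow> space (F s) = space M"
    and mono: "\<And>s t A. 0 \<le> s \<Longrightarrow> s \<le> t \<Longrightarrow> A \<in> sets (F s) \<Longrightarrow> A \<in> sets (F t)"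
    using F by (simp add: filtered_prob_space_def subalgebra_def, force simp: filtered_prob_space_def)
  have sub: "A \<subseteq> space M" if "0 \<le> s" "A \<in> sets (F s)" for s A
    using sets.sets_into_space[OF that(2)] sp[OF that(1)] by simp
  have spR: "space ?R = {0..t} \<times> space M"
    using sp[OF t] by (auto simp: space_restrict_space space_pair_measure)
  have rect: "(B \<inter> {0..t}) \<times> A \<in> sets ?R" if "B \<in> sets borel" "A \<in> sets (F t)" for B :: "real set" and A
  proof -
    have "A \<subseteq> space M" using sets.sets_into_space[OF that(2)] sp[OF t] by simp
    then have "(B \<inter> {0..t}) \<times> A = (B \<times> A) \<inter> ({0..t} \<times> space M)" by auto
    moreover have "B \<times> A \<in> sets (borel \<Otimes>\<^sub>M F t)" using that by auto
    ultimately show ?thesis by (auto simp: sets_restrict_space)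
  qed
  have "id \<in> measurable ?R (predictable_sigma M F)"
    unfolding predictable_sigma_def
  proof (rule measurable_measure_of)
    show "{{s<..t} \<times> A |s t A. 0 \<le> s \<and> s \<le> t \<and> A \<in> sets (F s)} \<union> {{0} \<times> A |A. A \<in> sets (F 0)}
      \<subseteq> Pow ({0..} \<times> space M)"
      by (auto dest: sub[rotated])
    show "id \<in> space ?R \<rightarrow> {0..} \<times> space M" by (auto simp: spR)
    fix P assume "P \<in> {{s<..t} \<times> A |s t A. 0 \<le> s \<and> s \<le> t \<and> A \<in> sets (F s)} \<union> {{0} \<times> A |A. A \<in> sets (F 0)}"
    then consider (1) s r A where "P = {s<..r} \<times> A" "0 \<le> s" "s \<le> r" "A \<in> sets (F s)"
      | (2) A where "P = {0} \<times> A" "A \<in> sets (F 0)" by blast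
    then show "id -` P \<inter> space ?R \<in> sets ?R"
    proof cases
      case 1
      show ?thesis
      proof (cases "s \<le> t")
        case True
        then have A: "A \<in> sets (F t)" using 1 mono by blast
        then have "A \<subseteq> space M" using sets.sets_into_space sp[OF t] by blast
        then have "id -` P \<inter> space ?R = ({s<..r} \<inter> {0..t}) \<times> A" using 1 by (auto simp: spR)
        then show ?thesis using rect[OF _ A, of "{s<..r}"] by simp
      next
        case False
        then have "id -` P \<inter> space ?R = {}" using 1 by (auto simp: spR)
        then show ?thesis by simp
      qed
    next
      case 2
      have A: "A \<in> sets (F t)" using 2 mono[OF _ t] by blast
      then have "A \<subseteq> space M" using sets.sets_into_space sp[OF t] by blast
      then have "id -` P \<inter> space ?R = ({0} \<inter> {0..t}) \<times> A" using 2 by (auto simp: spR)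
      then show ?thesis using rect[OF _ A, of "{0}"] by simp
    qed
  qed
  from measurable_compose[OF this X[unfolded predictable_def]] show ?thesis by simp
qed

text \<open>Cutting off at \<open>t\<close> by an indicator gives a map on the whole product space,
  ready for sections and for Fubini.\<close>

lemma predictable_measurable_pair:
  fixes X :: "real \<Rightarrow> 'w \<Rightarrow> 'k::real_normed_vector"
  assumes F: "filtered_prob_space M F" and X: "predictable M F X" and t: "0 \<le> t"
  shows "(\<lambda>(s, \<omega>). indicator {0..t} s *\<^sub>R X s \<omega>) \<in> borel_measurable (borel \<Otimes>\<^sub>M F t)"
proof -
  have sp: "space (F t) = space M"
    using F t by (auto simp: filtered_prob_space_def subalgebra_def)
  have S: "{0..t} \<times> space M \<inter> space (borel \<Otimes>\<^sub>M F t) \<in> sets (borel \<Otimes>\<^sub>M F t)"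
    using sets.top[of "F t"] sp by (intro sets.Int sets.top pair_measureI) auto
  have "(\<lambda>x. indicator ({0..t} \<times> space M) x *\<^sub>R (case x of (s, \<omega>) \<Rightarrow> X s \<omega>)) \<in> borel_measurable (borel \<Otimes>\<^sub>M F t)"
    using predictable_restrict_measurable[OF assms] unfolding borel_measurable_restrict_space_iff[OF S] .
  then show ?thesis
    by (rule measurable_cong[THEN iffD1, rotated])
       (auto simp: space_pair_measure sp indicator_def)
qed

lemma predictable_measurable:
  fixes X :: "real \<Rightarrow> 'w \<Rightarrow> 'k::real_normed_vector"
  assumes F: "filtered_prob_space M F" and X: "predictable M F X" and t: "0 \<le> t"
  shows "X t \<in> borel_measurable (F t)"
  using measurable_compose[OF measurable_Pair1'[of t borel "F t"] predictable_measurable_pair[OF assms]] t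
  by simp

text \<open>The measurability part of Fubini, with \<open>F t\<close> as second factor; it makes the
  drift integral, and hence \<open>I\<close>, adapted.\<close>

lemma predictable_integral_measurable:
  fixes X :: "real \<Rightarrow> 'w \<Rightarrow> 'k::{banach,second_countable_topology}"
  assumes F: "filtered_prob_space M F" and X: "predictable M F X" and t: "0 \<le> t"
  shows "(\<lambda>\<omega>. LINT s:{0..t}|lborel. X s \<omega>) \<in> borel_measurable (F t)"
proof -
  have "(\<lambda>(\<omega>, s). indicator {0..t} s *\<^sub>R X s \<omega>) \<in> borel_measurable (F t \<Otimes>\<^sub>M lborel)"
    using measurable_compose[OF measurable_pair_swap' predictable_measurable_pair[OF assms]]
    by (subst measurable_cong_sets[where M' = "F t \<Otimes>\<^sub>M borel"]) (auto intro!: sets_pair_measure_cong simp: case_prod_unfold)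
  from lborel.borel_measurable_lebesgue_integral[OF this]
  show ?thesis by (simp add: set_lebesgue_integral_def)
qed

subsection \<open>Convergence in probability\<close>

text \<open>Dominated convergence for the indicators of the exceptional events. All approximations
  of the diffusion coefficient are shown almost surely and enter \<open>stochastic_integral\<close>
  through this lemma.\<close>

lemma (in prob_space) AE_tendsto_null_in_prob:
  assumes [measurable]: "\<And>n. X n \<in> borel_measurable M" and "AE \<omega> in M. (\<lambda>n. X n \<omega>) \<longlonglongrightarrow> 0"
  shows "null_in_prob M X"
  unfolding null_in_prob_def
proof (intro conjI allI impI)
  fix \<epsilon> :: real assume e: "\<epsilon> > 0"
  have "(\<lambda>n. LINT \<omega>|M. indicator {\<omega> \<in> space M. X n \<omega> > ennreal \<epsilon>} \<omega>) \<longlonglongrightarrow> (LINT \<omega>|M. (0::real))"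
  proof (rule integral_dominated_convergence[where w = "\<lambda>_. 1"])
    show "AE \<omega> in M. (\<lambda>n. indicator {\<omega> \<in> space M. X n \<omega> > ennreal \<epsilon>} \<omega> :: real) \<longlonglongrightarrow> 0"
      using assms(2)
    proof eventually_elim
      case (elim \<omega>)
      then have "eventually (\<lambda>n. X n \<omega> < ennreal \<epsilon>) sequentially"
        by (rule order_tendstoD) (use e in simp)
      then show ?case
        by (intro tendsto_eventually) (auto elim!: eventually_mono split: split_indicator)
    qed
  qed (auto split: split_indicator)
  then show "(\<lambda>n. measure M {\<omega> \<in> space M. X n \<omega> > ennreal \<epsilon>}) \<longlonglongrightarrow> 0" by simp
qed fact

text \<open>If the expectations have a finite sum, the series itself is finite almost surely, so its
  terms tend to zero.\<close>

lemma AE_tendsto_zero_of_suminf_nn_integral: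
  fixes X :: "nat \<Rightarrow> 'a \<Rightarrow> ennreal"
  assumes [measurable]: "\<And>n. X n \<in> borel_measurable M" and "(\<Sum>n. \<integral>\<^sup>+\<omega>. X n \<omega> \<partial>M) < \<infinity>"
  shows "AE \<omega> in M. (\<lambda>n. X n \<omega>) \<longlonglongrightarrow> 0"
proof -
  have "(\<integral>\<^sup>+\<omega>. (\<Sum>n. X n \<omega>) \<partial>M) \<noteq> \<infinity>"
    using assms(2) by (subst nn_integral_suminf) auto
  then have "AE \<omega> in M. (\<Sum>n. X n \<omega>) \<noteq> \<infinity>"
    by (intro nn_integral_PInf_AE) auto
  then show ?thesis
  proof eventually_elim
    case (elim \<omega>)
    define x where "x n = enn2real (X n \<omega>)" for n
    have fin: "X n \<omega> \<noteq> \<infinity>" for n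
      using ennreal_suminf_lessD[of "\<lambda>n. X n \<omega>" \<infinity> n] elim by (auto simp: less_top)
    have X: "X n \<omega> = ennreal (x n)" for n
      using fin[of n] by (simp add: x_def less_top)
    have "(\<Sum>n. ennreal (x n)) \<noteq> top" using elim by (simp add: X)
    then have "summable x"
      by (intro summable_suminf_not_top) (simp_all add: x_def)
    then have "x \<longlonglongrightarrow> 0" by (rule summable_LIMSEQ_zero)
    then show ?case using tendsto_ennrealI[of x 0] by (simp add: X)
  qed
qed

text \<open>Elementary integrands may take only finitely many values. Measurable maps into a
  separable metric space are pointwise limits of simple functions, and on a probability space this
  gives convergence in probability.\<close>

lemma (in prob_space) simple_function_approx:
  fixes f :: "'a \<Rightarrow> 'b::{metric_space,second_countable_topology}"
  assumes N: "subalgebra M N" and f: "f \<in> borel_measurable N" and "\<delta> > 0" "p > 0"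
  shows "\<exists>g. simple_function N g \<and> {\<omega> \<in> space M. dist (g \<omega>) (f \<omega>) > \<delta>} \<in> sets M \<and>
    measure M {\<omega> \<in> space M. dist (g \<omega>) (f \<omega>) > \<delta>} < p"
proof -
  have spN: "space N = space M" using N by (simp add: subalgebra_def)
  obtain S where S: "\<And>i. simple_function N (S i)" "\<And>\<omega>. \<omega> \<in> space N \<Longrightarrow> (\<lambda>i. S i \<omega>) \<longlonglongrightarrow> f \<omega>"
    using borel_measurable_implies_sequence_metric[OF f] by blast
  have fM [measurable]: "f \<in> borel_measurable M"
    using measurable_from_subalg[OF N f] .
  have SM [measurable]: "S i \<in> borel_measurable M" for i
    using measurable_from_subalg[OF N borel_measurable_simple_function[OF S(1)]] .
  have "null_in_prob M (\<lambda>i \<omega>. ennreal (dist (S i \<omega>) (f \<omega>)))"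
  proof (rule AE_tendsto_null_in_prob)
    show "AE \<omega> in M. (\<lambda>i. ennreal (dist (S i \<omega>) (f \<omega>))) \<longlonglongrightarrow> 0"
    proof (rule AE_I2)
      fix \<omega> assume "\<omega> \<in> space M"
      then have "(\<lambda>i. dist (S i \<omega>) (f \<omega>)) \<longlonglongrightarrow> 0"
        using S(2)[of \<omega>] spN by (simp add: tendsto_dist_iff[symmetric])
      then show "(\<lambda>i. ennreal (dist (S i \<omega>) (f \<omega>))) \<longlonglongrightarrow> 0"
        using tendsto_ennrealI[of _ 0] by simp
    qed
  qed measurable
  then have "(\<lambda>i. measure M {\<omega> \<in> space M. ennreal (dist (S i \<omega>) (f \<omega>)) > ennreal \<delta>}) \<longlonglongrightarrow> 0"
    using \<open>\<delta> > 0\<close> by (auto simp: null_in_prob_def)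
  then have "eventually (\<lambda>i. measure M {\<omega> \<in> space M. ennreal (dist (S i \<omega>) (f \<omega>)) > ennreal \<delta>} < p) sequentially"
    by (rule order_tendstoD) fact
  then obtain i where "measure M {\<omega> \<in> space M. ennreal (dist (S i \<omega>) (f \<omega>)) > ennreal \<delta>} < p"
    by (auto simp: eventually_sequentially)
  then have "measure M {\<omega> \<in> space M. dist (S i \<omega>) (f \<omega>) > \<delta>} < p"
    using \<open>\<delta> > 0\<close> by (simp add: ennreal_less_iff)
  then show ?thesis using S(1) by (intro exI[of _ "S i"]) auto
qed

subsection \<open>Wiener increments\<close>

text \<open>The degenerate law \<open>v = 0\<close> has no density and is treated apart; the moment
  formulas hold for it as well.\<close>

lemma (in prob_space) centered_gaussian_moments:
  assumes "centered_gaussian M X v"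
  shows "X \<in> borel_measurable M" and "integrable M (\<lambda>\<omega>. X \<omega> ^ k)"
    and "expectation X = 0" and "expectation (\<lambda>\<omega>. (X \<omega>)\<^sup>2) = v" and "expectation (\<lambda>\<omega>. X \<omega> ^ 4) = 3 * v\<^sup>2"
proof -
  have "X \<in> borel_measurable M \<and> integrable M (\<lambda>\<omega>. X \<omega> ^ k) \<and> expectation X = 0 \<and>
    expectation (\<lambda>\<omega>. (X \<omega>)\<^sup>2) = v \<and> expectation (\<lambda>\<omega>. X \<omega> ^ 4) = 3 * v\<^sup>2"
  proof (cases "v = 0")
    case True
    then have m [measurable]: "X \<in> borel_measurable M" and 0: "AE \<omega> in M. X \<omega> = 0"
      using assms by (auto simp: centered_gaussian_def)
    have e: "expectation (\<lambda>\<omega>. X \<omega> ^ j) = 0" if "j > 0" for j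
      using integral_cong_AE[of "\<lambda>\<omega>. X \<omega> ^ j" M "\<lambda>_. 0"] 0 that by (auto elim!: eventually_mono)
    have "integrable M (\<lambda>\<omega>. X \<omega> ^ k)"
      using 0 by (intro integrable_cong_AE[THEN iffD2, OF _ _ _ integrable_const[of "0 ^ k"]])
        (auto elim!: eventually_mono)
    then show ?thesis using e[of 1] e[of 2] e[of 4] True m by simp
  next
    case False
    then have v: "v > 0" and D: "distributed M lborel X (normal_density 0 (sqrt v))"
      using assms by (auto simp: centered_gaussian_def split: if_splits)
    have s: "sqrt v > 0" using v by simp
    note nn = normal_density_nonneg
    have m: "X \<in> borel_measurable M" using distributed_measurable[OF D] by simp
    have i: "integrable M (\<lambda>\<omega>. X \<omega> ^ k)"
      using distributed_integrable[OF D, of "\<lambda>x. x ^ k"] integrable_normal_moment[OF s, of 0 k] by simp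
    have e: "expectation (\<lambda>\<omega>. X \<omega> ^ j) = (LINT x|lborel. normal_density 0 (sqrt v) x * x ^ j)" for j
      using distributed_integral[OF D, of "\<lambda>x. x ^ j"] by simp
    have "expectation (\<lambda>\<omega>. X \<omega> ^ 1) = 0"
      unfolding e using integral_normal_moment_odd[OF s, of 0 0] by simp
    moreover have "expectation (\<lambda>\<omega>. X \<omega> ^ 2) = v"
      unfolding e using integral_normal_moment_even[OF s, of 0 1] v by (simp add: fact_numeral)
    moreover have "expectation (\<lambda>\<omega>. X \<omega> ^ 4) = 3 * v\<^sup>2"
      unfolding e using integral_normal_moment_even[OF s, of 0 2] v
      by (simp add: fact_numeral power2_eq_square power_divide field_simps)
    ultimately show ?thesis using m i by simp
  qed
  then show "X \<in> borel_measurable M" and "integrable M (\<lambda>\<omega>. X \<omega> ^ k)"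
    and "expectation X = 0" and "expectation (\<lambda>\<omega>. (X \<omega>)\<^sup>2) = v" and "expectation (\<lambda>\<omega>. X \<omega> ^ 4) = 3 * v\<^sup>2"
    by blast+
qed

locale wiener = prob_space M
  for M :: "'w measure" +
  fixes F :: "real \<Rightarrow> 'w measure"
    and Q :: "'h::{real_inner,banach,second_countable_topology} \<Rightarrow>\<^sub>L 'h"
    and W :: "real \<Rightarrow> 'w \<Rightarrow> 'h"
  assumes filtered: "filtered_prob_space M F"
    and symmetric: "symmetric_operator Q" and pos_def: "positive_definite Q" and tr_class: "trace_class Q"
    and wiener: "wiener_process M F Q W"
begin

lemma subalg: "0 \<le> t \<Longrightarrow> subalgebra M (F t)"
  and space_F: "0 \<le> t \<Longrightarrow> space (F t) = space M"
  using filtered by (auto simp: filtered_prob_space_def subalgebra_def)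

lemma subalg_F: "0 \<le> s \<Longrightarrow> s \<le> t \<Longrightarrow> subalgebra (F t) (F s)"
  using filtered space_F[of s] space_F[of t] by (auto simp: filtered_prob_space_def subalgebra_def)

lemma measurable_F_mono: "0 \<le> s \<Longrightarrow> s \<le> t \<Longrightarrow> f \<in> measurable (F s) N \<Longrightarrow> f \<in> measurable (F t) N"
  using measurable_from_subalg[OF subalg_F] .

lemma measurable_F_M: "0 \<le> t \<Longrightarrow> f \<in> measurable (F t) N \<Longrightarrow> f \<in> measurable M N"
  using measurable_from_subalg[OF subalg] .

lemma W_measurable_F: "0 \<le> s \<Longrightarrow> s \<le> t \<Longrightarrow> W s \<in> borel_measurable (F t)"
  using wiener by (intro measurable_F_mono[of s t]) (auto simp: wiener_process_def)

lemma W_measurable: "0 \<le> t \<Longrightarrow> W t \<in> borel_measurable M"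
  using W_measurable_F[of t t] measurable_F_M by blast

definition incr :: "real \<Rightarrow> real \<Rightarrow> 'w \<Rightarrow> 'h" where
  "incr s t \<omega> = W t \<omega> - W s \<omega>"

lemma incr_measurable_F: "0 \<le> s \<Longrightarrow> s \<le> t \<Longrightarrow> incr s t \<in> borel_measurable (F t)"
  unfolding incr_def[abs_def] by (intro borel_measurable_diff W_measurable_F) auto

lemma incr_measurable [measurable (raw)]: "0 \<le> s \<Longrightarrow> s \<le> t \<Longrightarrow> incr s t \<in> borel_measurable M"
  using incr_measurable_F[of s t] measurable_F_M[of t] by simp

lemma incr_refl [simp]: "incr s s = (\<lambda>_. 0)"
  by (simp add: incr_def fun_eq_iff)

lemma Q_sym: "Q x \<bullet> y = Q y \<bullet> x"
  using symmetric by (simp add: symmetric_operator_def inner_commute)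

lemma Q_nonneg: "0 \<le> Q x \<bullet> x"
  using pos_def by (cases "x = 0") (auto simp: positive_definite_def less_imp_le)

text \<open>The case \<open>s = t\<close> is included because grids clipped at a final time have
  repeated points.\<close>

lemma incr_gaussian:
  assumes "0 \<le> s" "s \<le> t"
  shows "centered_gaussian M (\<lambda>\<omega>. incr s t \<omega> \<bullet> h) ((t - s) * (Q h \<bullet> h))"
proof (cases "s < t")
  case True
  then show ?thesis using wiener assms by (simp add: wiener_process_def incr_def)
next
  case False
  then show ?thesis using assms by (simp add: centered_gaussian_def)
qed

context
  fixes s t :: real assumes st: "0 \<le> s" "s \<le> t"
begin

lemma incr_integrable_power: "integrable M (\<lambda>\<omega>. (incr s t \<omega> \<bullet> h) ^ k)"
  by (rule centered_gaussian_moments[OF incr_gaussian[OF st]])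

lemma incr_integrable: "integrable M (\<lambda>\<omega>. incr s t \<omega> \<bullet> h)"
  using incr_integrable_power[of h 1] by simp

lemma incr_mean: "expectation (\<lambda>\<omega>. incr s t \<omega> \<bullet> h) = 0"
  by (rule centered_gaussian_moments[OF incr_gaussian[OF st]])

lemma incr_variance: "expectation (\<lambda>\<omega>. (incr s t \<omega> \<bullet> h)\<^sup>2) = (t - s) * (Q h \<bullet> h)"
  by (rule centered_gaussian_moments[OF incr_gaussian[OF st]])

lemma incr_fourth: "expectation (\<lambda>\<omega>. (incr s t \<omega> \<bullet> h) ^ 4) = 3 * ((t - s) * (Q h \<bullet> h))\<^sup>2"
  by (rule centered_gaussian_moments[OF incr_gaussian[OF st]])

text \<open>Polarisation: \<open>wiener_process\<close> speaks only of one-dimensional projections,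
  so mixed second moments are reduced to squares.\<close>

lemma incr_prod_polar:
  "(incr s t \<omega> \<bullet> g) * (incr s t \<omega> \<bullet> h) = ((incr s t \<omega> \<bullet> (g + h))\<^sup>2 - (incr s t \<omega> \<bullet> (g - h))\<^sup>2) / 4"
  by (simp add: inner_add_right inner_diff_right power2_eq_square algebra_simps)

lemma incr_prod_integrable: "integrable M (\<lambda>\<omega>. (incr s t \<omega> \<bullet> g) * (incr s t \<omega> \<bullet> h))"
  unfolding incr_prod_polar by (intro integrable_divide_zero Bochner_Integration.integrable_diff incr_integrable_power)

lemma incr_covariance:
  "expectation (\<lambda>\<omega>. (incr s t \<omega> \<bullet> g) * (incr s t \<omega> \<bullet> h)) = (t - s) * (Q g \<bullet> h)"
proof -
  have "expectation (\<lambda>\<omega>. (incr s t \<omega> \<bullet> g) * (incr s t \<omega> \<bullet> h))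
    = ((t - s) * (Q (g + h) \<bullet> (g + h)) - (t - s) * (Q (g - h) \<bullet> (g - h))) / 4"
    unfolding incr_prod_polar
    by (simp add: incr_integrable_power incr_variance)
  also have "\<dots> = (t - s) * (Q g \<bullet> h)"
    using Q_sym[of h g]
    by (simp add: blinfun.add_right blinfun.diff_right inner_add_left inner_add_right inner_diff_left
        inner_diff_right field_simps)
  finally show ?thesis .
qed

text \<open>The inequality between geometric and arithmetic mean replaces the formula for mixed
  fourth moments, which would need joint Gaussianity.\<close>

lemma incr_prod_square_le:
  "(incr s t \<omega> \<bullet> g)\<^sup>2 * (incr s t \<omega> \<bullet> h)\<^sup>2 \<le> ((incr s t \<omega> \<bullet> g) ^ 4 + (incr s t \<omega> \<bullet> h) ^ 4) / 2"
  using zero_le_power2[of "(incr s t \<omega> \<bullet> g)\<^sup>2 - (incr s t \<omega> \<bullet> h)\<^sup>2"]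
  by (simp add: power2_eq_square numeral_eq_Suc algebra_simps)

lemma incr_prod_square_integrable: "integrable M (\<lambda>\<omega>. ((incr s t \<omega> \<bullet> g) * (incr s t \<omega> \<bullet> h))\<^sup>2)"
proof (rule Bochner_Integration.integrable_bound)
  show "integrable M (\<lambda>\<omega>. ((incr s t \<omega> \<bullet> g) ^ 4 + (incr s t \<omega> \<bullet> h) ^ 4) / 2)"
    by (intro integrable_divide_zero Bochner_Integration.integrable_add incr_integrable_power)
  show "AE \<omega> in M. norm (((incr s t \<omega> \<bullet> g) * (incr s t \<omega> \<bullet> h))\<^sup>2)
      \<le> norm (((incr s t \<omega> \<bullet> g) ^ 4 + (incr s t \<omega> \<bullet> h) ^ 4) / 2)"
    using incr_prod_square_le[of _ g h] by (auto intro!: AE_I2 order_trans[OF _ abs_ge_self] simp: power_mult_distrib)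
qed (use st in measurable)

text \<open>Rescaling both factors to unit variance turns the estimate \<open>2 x\<^sup>2 y\<^sup>2 \<le> x\<^sup>4 + y\<^sup>4\<close> into
  the product form of the bound.\<close>

lemma incr_prod_square_mean:
  "expectation (\<lambda>\<omega>. ((incr s t \<omega> \<bullet> g) * (incr s t \<omega> \<bullet> h))\<^sup>2) \<le> 3 * (t - s)\<^sup>2 * (Q g \<bullet> g) * (Q h \<bullet> h)"
proof (cases "g = 0 \<or> h = 0")
  case False
  then have qg: "Q g \<bullet> g > 0" and qh: "Q h \<bullet> h > 0"
    using pos_def by (auto simp: positive_definite_def)
  define a b where "a = sqrt (Q g \<bullet> g)" and "b = sqrt (Q h \<bullet> h)"
  have ab: "a > 0" "b > 0" "a\<^sup>2 = Q g \<bullet> g" "b\<^sup>2 = Q h \<bullet> h" using qg qh by (simp_all add: a_def b_def)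
  let ?g = "g /\<^sub>R a" and ?h = "h /\<^sub>R b"
  have unit: "Q ?g \<bullet> ?g = 1" "Q ?h \<bullet> ?h = 1"
    using ab by (simp_all add: blinfun.scaleR_right power2_eq_square[symmetric] field_simps flip: ab(3,4))
  have "expectation (\<lambda>\<omega>. ((incr s t \<omega> \<bullet> ?g) * (incr s t \<omega> \<bullet> ?h))\<^sup>2)
      \<le> expectation (\<lambda>\<omega>. ((incr s t \<omega> \<bullet> ?g) ^ 4 + (incr s t \<omega> \<bullet> ?h) ^ 4) / 2)"
    using incr_prod_square_le[of _ ?g ?h]
    by (intro integral_mono incr_prod_square_integrable integrable_divide_zero Bochner_Integration.integrable_add incr_integrable_power)
       (auto simp: power_mult_distrib)
  also have "\<dots> = 3 * (t - s)\<^sup>2"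
    by (simp add: incr_integrable_power incr_fourth unit del: inner_scaleR_right)
  finally have *: "expectation (\<lambda>\<omega>. ((incr s t \<omega> \<bullet> ?g) * (incr s t \<omega> \<bullet> ?h))\<^sup>2) \<le> 3 * (t - s)\<^sup>2" .
  have "expectation (\<lambda>\<omega>. ((incr s t \<omega> \<bullet> g) * (incr s t \<omega> \<bullet> h))\<^sup>2)
      = expectation (\<lambda>\<omega>. (a\<^sup>2 * b\<^sup>2) * ((incr s t \<omega> \<bullet> ?g) * (incr s t \<omega> \<bullet> ?h))\<^sup>2)"
    using ab(1,2) by (intro Bochner_Integration.integral_cong) (auto simp: power2_eq_square field_simps)
  also have "\<dots> = (a\<^sup>2 * b\<^sup>2) * expectation (\<lambda>\<omega>. ((incr s t \<omega> \<bullet> ?g) * (incr s t \<omega> \<bullet> ?h))\<^sup>2)"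
    by simp
  also have "\<dots> \<le> (a\<^sup>2 * b\<^sup>2) * (3 * (t - s)\<^sup>2)"
    using * by (intro mult_left_mono) auto
  finally show ?thesis by (simp add: ab(3,4) ac_simps)
qed auto

text \<open>Independence is given for the events of \<open>F s\<close> and the preimages under the
  increment. The sigma-algebras generated by \<open>X\<close> and by \<open>\<phi>\<close> of the
  increment are contained in these two families, so expectations factor. For \<open>s = t\<close>
  the increment is zero and the second factor constant.\<close>

lemma incr_indep:
  fixes X :: "'w \<Rightarrow> real" and \<phi> :: "'h \<Rightarrow> real"
  assumes X: "X \<in> borel_measurable (F s)" and iX: "integrable M X"
    and \<phi>: "\<phi> \<in> borel_measurable borel" and i\<phi>: "integrable M (\<lambda>\<omega>. \<phi> (incr s t \<omega>))"
  shows "integrable M (\<lambda>\<omega>. X \<omega> * \<phi> (incr s t \<omega>))"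
    and "expectation (\<lambda>\<omega>. X \<omega> * \<phi> (incr s t \<omega>)) = expectation X * expectation (\<lambda>\<omega>. \<phi> (incr s t \<omega>))"
proof -
  have "integrable M (\<lambda>\<omega>. X \<omega> * \<phi> (incr s t \<omega>)) \<and>
    expectation (\<lambda>\<omega>. X \<omega> * \<phi> (incr s t \<omega>)) = expectation X * expectation (\<lambda>\<omega>. \<phi> (incr s t \<omega>))"
  proof (cases "s < t")
    case False
    then show ?thesis using st iX by (simp add: prob_space)
  next
    case True
    let ?G = "vimage_algebra (space M) (incr s t) borel"
    have ind: "indep_set (sets (F s)) {incr s t -` A \<inter> space M | A. A \<in> sets borel}"
      using wiener True st by (simp add: wiener_process_def incr_def[abs_def])
    have G: "sets ?G = {incr s t -` A \<inter> space M | A. A \<in> sets borel}"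
      by (rule sets_vimage_algebra2) simp
    have XM: "X \<in> borel_measurable M" using measurable_F_M[OF st(1) X] .
    have "indep_var borel X borel (\<lambda>\<omega>. \<phi> (incr s t \<omega>))"
      unfolding indep_var_eq
    proof (intro conjI)
      show "random_variable borel X" by fact
      show "random_variable borel (\<lambda>\<omega>. \<phi> (incr s t \<omega>))"
        using i\<phi> by (rule borel_measurable_integrable)
      have 1: "sigma_sets (space M) {X -` A \<inter> space M |A. A \<in> sets borel} \<subseteq> sets (F s)"
        using sets.sigma_sets_subset[of "{X -` A \<inter> space M |A. A \<in> sets borel}" "F s"]
          measurable_sets[OF X] by (auto simp: space_F st)
      have "\<phi> \<circ> incr s t \<in> borel_measurable ?G"
        by (rule measurable_comp[OF measurable_vimage_algebra1 \<phi>]) auto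
      then have 2: "sigma_sets (space M) {(\<lambda>\<omega>. \<phi> (incr s t \<omega>)) -` A \<inter> space M |A. A \<in> sets borel} \<subseteq> sets ?G"
        using sets.sigma_sets_subset[of "{(\<lambda>\<omega>. \<phi> (incr s t \<omega>)) -` A \<inter> space M |A. A \<in> sets borel}" ?G]
        by (auto simp: comp_def measurable_def)
      show "indep_set (sigma_sets (space M) {X -` A \<inter> space M |A. A \<in> sets borel})
         (sigma_sets (space M) {(\<lambda>\<omega>. \<phi> (incr s t \<omega>)) -` A \<inter> space M |A. A \<in> sets borel})"
        using ind 1 2 unfolding indep_set_def G
        by (elim indep_sets_mono_sets) (auto split: bool.split)
    qed
    from indep_var_integrable[OF this iX i\<phi>] indep_var_lebesgue_integral[OF this iX i\<phi>]
    show ?thesis by blast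
  qed
  then show "integrable M (\<lambda>\<omega>. X \<omega> * \<phi> (incr s t \<omega>))"
    and "expectation (\<lambda>\<omega>. X \<omega> * \<phi> (incr s t \<omega>)) = expectation X * expectation (\<lambda>\<omega>. \<phi> (incr s t \<omega>))"
    by blast+
qed

end

end

lemma simple_function_subalgebra:
  assumes "subalgebra M N" "simple_function N f" shows "simple_function M f"
  using assms by (auto simp: simple_function_def subalgebra_def)

lemma (in prob_space) square_integrable_mult:
  fixes X Y :: "'a \<Rightarrow> real"
  assumes [measurable]: "X \<in> borel_measurable M" "Y \<in> borel_measurable M"
    and X: "integrable M (\<lambda>\<omega>. (X \<omega>)\<^sup>2)" and Y: "integrable M (\<lambda>\<omega>. (Y \<omega>)\<^sup>2)"
  shows "integrable M (\<lambda>\<omega>. X \<omega> * Y \<omega>)"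
proof (rule Bochner_Integration.integrable_bound)
  show "integrable M (\<lambda>\<omega>. (X \<omega>)\<^sup>2 + (Y \<omega>)\<^sup>2)" using X Y by simp
  have "\<bar>x * y\<bar> \<le> \<bar>x\<^sup>2 + y\<^sup>2\<bar>" for x y :: real
  proof -
    have "2 * (\<bar>x\<bar> * \<bar>y\<bar>) \<le> x\<^sup>2 + y\<^sup>2" using sum_squares_bound[of "\<bar>x\<bar>" "\<bar>y\<bar>"] by simp
    moreover have "0 \<le> \<bar>x\<bar> * \<bar>y\<bar>" by simp
    ultimately show ?thesis unfolding abs_mult by linarith
  qed
  then show "AE \<omega> in M. norm (X \<omega> * Y \<omega>) \<le> norm ((X \<omega>)\<^sup>2 + (Y \<omega>)\<^sup>2)" by simp
qed measurable

context wiener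
begin

subsection \<open>Orthogonal increments\<close>

text \<open>Pythagoras for martingale differences. The partial sum is known at time
  \<open>\<sigma> N\<close>, so its product with the next term has mean zero. Measurability and
  integrability are carried along because \<open>orth\<close> demands them of the partial sum in the
  induction step.\<close>

lemma orthogonal_sum_square:
  fixes X :: "nat \<Rightarrow> 'w \<Rightarrow> real"
  assumes \<sigma>: "0 \<le> \<sigma> 0" "\<And>i. \<sigma> i \<le> \<sigma> (Suc i)"
    and X: "\<And>i. X i \<in> borel_measurable (F (\<sigma> (Suc i)))"
    and sq: "\<And>i. integrable M (\<lambda>\<omega>. (X i \<omega>)\<^sup>2)"
    and orth: "\<And>i S. S \<in> borel_measurable (F (\<sigma> i)) \<Longrightarrow> integrable M (\<lambda>\<omega>. (S \<omega>)\<^sup>2) \<Longrightarrow>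
      expectation (\<lambda>\<omega>. S \<omega> * X i \<omega>) = 0"
  shows "(\<lambda>\<omega>. \<Sum>i<N. X i \<omega>) \<in> borel_measurable (F (\<sigma> N)) \<and> integrable M (\<lambda>\<omega>. (\<Sum>i<N. X i \<omega>)\<^sup>2) \<and>
    expectation (\<lambda>\<omega>. (\<Sum>i<N. X i \<omega>)\<^sup>2) = (\<Sum>i<N. expectation (\<lambda>\<omega>. (X i \<omega>)\<^sup>2))"
proof (induction N)
  case 0
  then show ?case by simp
next
  case (Suc N)
  have pos: "0 \<le> \<sigma> i" for i by (induction i) (use \<sigma> order_trans in blast)+
  let ?S = "\<lambda>\<omega>. \<Sum>i<N. X i \<omega>"
  from Suc have S: "?S \<in> borel_measurable (F (\<sigma> N))" "integrable M (\<lambda>\<omega>. (?S \<omega>)\<^sup>2)" by auto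
  have SX: "integrable M (\<lambda>\<omega>. ?S \<omega> * X N \<omega>)"
    by (rule square_integrable_mult[OF measurable_F_M[OF pos S(1)] measurable_F_M[OF pos X] S(2) sq])
  have "?S \<in> borel_measurable (F (\<sigma> (Suc N)))"
    using measurable_F_mono[OF pos \<sigma>(2) S(1)] .
  moreover have eq: "(\<Sum>i<Suc N. X i \<omega>)\<^sup>2 = (?S \<omega>)\<^sup>2 + 2 * (?S \<omega> * X N \<omega>) + (X N \<omega>)\<^sup>2" for \<omega>
    by (simp add: power2_eq_square algebra_simps)
  ultimately show ?case
    unfolding eq using S sq SX Suc X by (simp add: orth)
qed

text \<open>One matrix entry of the quadratic variation error. Products of increments minus their
  covariances are centred and independent of the past, so their variances add up. Centring only
  lowers second moments, which leaves the constant 3 of the fourth moment.\<close>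

lemma sum_QV_component:
  fixes g h :: 'h and N :: nat
  assumes \<sigma>: "0 \<le> \<sigma> 0" "\<And>i. \<sigma> i \<le> \<sigma> (Suc i)"
  defines "S \<equiv> \<lambda>\<omega>. \<Sum>i<N. (incr (\<sigma> i) (\<sigma> (Suc i)) \<omega> \<bullet> g) * (incr (\<sigma> i) (\<sigma> (Suc i)) \<omega> \<bullet> h)
      - (\<sigma> (Suc i) - \<sigma> i) * (Q g \<bullet> h)"
  shows "S \<in> borel_measurable M" and
    "(\<integral>\<^sup>+\<omega>. ennreal ((S \<omega>)\<^sup>2) \<partial>M) \<le> ennreal (3 * (\<Sum>i<N. (\<sigma> (Suc i) - \<sigma> i)\<^sup>2) * (Q g \<bullet> g) * (Q h \<bullet> h))"
proof -
  have pos: "0 \<le> \<sigma> i" for i by (induction i) (use \<sigma> order_trans in blast)+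
  define P where "P i \<omega> = (incr (\<sigma> i) (\<sigma> (Suc i)) \<omega> \<bullet> g) * (incr (\<sigma> i) (\<sigma> (Suc i)) \<omega> \<bullet> h)" for i \<omega>
  define c where "c i = (\<sigma> (Suc i) - \<sigma> i) * (Q g \<bullet> h)" for i
  let ?X = "\<lambda>i \<omega>. P i \<omega> - c i"
  have EP: "expectation (P i) = c i" "integrable M (P i)" "integrable M (\<lambda>\<omega>. (P i \<omega>)\<^sup>2)"
    "expectation (\<lambda>\<omega>. (P i \<omega>)\<^sup>2) \<le> 3 * (\<sigma> (Suc i) - \<sigma> i)\<^sup>2 * (Q g \<bullet> g) * (Q h \<bullet> h)" for i
    unfolding P_def c_def
    by (rule incr_covariance incr_prod_integrable incr_prod_square_integrable incr_prod_square_mean;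
        fact pos \<sigma>)+
  have Xm: "?X i \<in> borel_measurable (F (\<sigma> (Suc i)))" for i
    unfolding P_def using incr_measurable_F[OF pos \<sigma>(2), of i] by measurable
  have sqe: "(?X i \<omega>)\<^sup>2 = (P i \<omega>)\<^sup>2 - 2 * c i * P i \<omega> + (c i)\<^sup>2" for i \<omega>
    by (simp add: power2_eq_square algebra_simps)
  have sq: "integrable M (\<lambda>\<omega>. (?X i \<omega>)\<^sup>2)" for i
    unfolding sqe using EP(2,3) by simp
  have X2: "expectation (\<lambda>\<omega>. (?X i \<omega>)\<^sup>2) \<le> 3 * (\<sigma> (Suc i) - \<sigma> i)\<^sup>2 * (Q g \<bullet> g) * (Q h \<bullet> h)" for i
  proof -
    have "expectation (\<lambda>\<omega>. (?X i \<omega>)\<^sup>2) = expectation (\<lambda>\<omega>. (P i \<omega>)\<^sup>2) - (c i)\<^sup>2"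
      unfolding sqe using EP(1-3)[of i] by (simp add: prob_space power2_eq_square)
    also have "\<dots> \<le> expectation (\<lambda>\<omega>. (P i \<omega>)\<^sup>2)" by simp
    finally show ?thesis using EP(4)[of i] by linarith
  qed
  have orth: "expectation (\<lambda>\<omega>. R \<omega> * ?X i \<omega>) = 0"
    if R: "R \<in> borel_measurable (F (\<sigma> i))" "integrable M (\<lambda>\<omega>. (R \<omega>)\<^sup>2)" for i R
  proof -
    have RM: "R \<in> borel_measurable M" using measurable_F_M[OF pos R(1)] .
    have iR: "integrable M R" by (rule square_integrable_imp_integrable[OF RM R(2)])
    have iX: "integrable M (?X i)" using EP(2) by simp
    have "expectation (\<lambda>\<omega>. R \<omega> * ?X i \<omega>) = expectation R * expectation (?X i)"
      unfolding P_def
      by (rule incr_indep(2)[where \<phi> = "\<lambda>x. (x \<bullet> g) * (x \<bullet> h) - c i"])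
         (use pos \<sigma> R iR iX in \<open>auto simp: P_def\<close>)
    then show ?thesis using EP(1,2)[of i] by (simp add: prob_space)
  qed
  have S: "S = (\<lambda>\<omega>. \<Sum>i<N. ?X i \<omega>)" by (simp add: S_def P_def c_def)
  note O = orthogonal_sum_square[of \<sigma> ?X N, OF \<sigma> Xm sq orth]
  show "S \<in> borel_measurable M" unfolding S using O measurable_F_M[OF pos] by blast
  have "(\<integral>\<^sup>+\<omega>. ennreal ((S \<omega>)\<^sup>2) \<partial>M) = ennreal (expectation (\<lambda>\<omega>. (S \<omega>)\<^sup>2))"
    unfolding S using O by (intro nn_integral_eq_integral) auto
  also have "expectation (\<lambda>\<omega>. (S \<omega>)\<^sup>2) = (\<Sum>i<N. expectation (\<lambda>\<omega>. (?X i \<omega>)\<^sup>2))"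
    unfolding S using O by blast
  also have "\<dots> \<le> (\<Sum>i<N. 3 * (\<sigma> (Suc i) - \<sigma> i)\<^sup>2 * (Q g \<bullet> g) * (Q h \<bullet> h))"
    by (intro sum_mono X2)
  also have "\<dots> = 3 * (\<Sum>i<N. (\<sigma> (Suc i) - \<sigma> i)\<^sup>2) * (Q g \<bullet> g) * (Q h \<bullet> h)"
    by (simp add: sum_distrib_left sum_distrib_right)
  finally show "(\<integral>\<^sup>+\<omega>. ennreal ((S \<omega>)\<^sup>2) \<partial>M) \<le> \<dots>" by (simp add: ennreal_leI)
qed

text \<open>One step of the Ito isometry. On each event \<open>B = b\<close>, which lies in
  \<open>F s\<close>, the increment is tested against a fixed vector, and independence applies. A
  vector-valued \<open>B\<close> is enough, since the operator-valued integral is later examined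
  along one basis vector \<open>h\<close>, where \<open>B\<close> is an adjoint applied to
  \<open>h\<close>.\<close>

lemma elementary_orth:
  fixes B :: "'w \<Rightarrow> 'h"
  assumes st: "0 \<le> s" "s \<le> t" and B: "simple_function (F s) B"
  shows "(\<lambda>\<omega>. incr s t \<omega> \<bullet> B \<omega>) \<in> borel_measurable (F t)"
    and "integrable M (\<lambda>\<omega>. (incr s t \<omega> \<bullet> B \<omega>)\<^sup>2)"
    and "expectation (\<lambda>\<omega>. (incr s t \<omega> \<bullet> B \<omega>)\<^sup>2) = expectation (\<lambda>\<omega>. (t - s) * (Q (B \<omega>) \<bullet> B \<omega>))"
    and "\<And>S. S \<in> borel_measurable (F s) \<Longrightarrow> integrable M (\<lambda>\<omega>. (S \<omega>)\<^sup>2) \<Longrightarrow>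
      expectation (\<lambda>\<omega>. S \<omega> * (incr s t \<omega> \<bullet> B \<omega>)) = 0"
proof -
  let ?I = "\<lambda>b. indicator (B -` {b} \<inter> space M) :: 'w \<Rightarrow> real"
  let ?R = "B ` space M"
  have fin: "finite ?R" and set: "\<And>b. B -` {b} \<inter> space M \<in> sets (F s)"
    using B simple_functionD[OF B] by (auto simp: simple_function_def space_F st)
  have Im: "?I b \<in> borel_measurable (F s)" for b by (rule borel_measurable_indicator[OF set])
  have IM [measurable]: "?I b \<in> borel_measurable M" for b using measurable_F_M[OF st(1) Im] .
  have II: "integrable M (?I b)" for b
    by (rule integrable_const_bound[where B = 1]) (auto split: split_indicator)
  \<comment> \<open>Used for three choices of \<open>f\<close>: the squared increment, the quadratic
    form of \<open>Q\<close>, and the increment itself.\<close>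
  have dec: "f (B \<omega>) = (\<Sum>b\<in>?R. ?I b \<omega> * f b)" if "\<omega> \<in> space M" for f :: "'h \<Rightarrow> real" and \<omega>
  proof -
    have "(\<Sum>b\<in>?R. ?I b \<omega> * f b) = (\<Sum>b\<in>?R. if b = B \<omega> then f b else 0)"
      using that by (intro sum.cong) (auto split: split_indicator)
    also have "\<dots> = f (B \<omega>)" using fin that by simp
    finally show ?thesis by simp
  qed
  have Bm: "B \<in> borel_measurable (F s)" by (rule borel_measurable_simple_function[OF B])
  have "B \<in> borel_measurable (F t)" by (rule measurable_F_mono[OF st Bm])
  then show m: "(\<lambda>\<omega>. incr s t \<omega> \<bullet> B \<omega>) \<in> borel_measurable (F t)"
    by (intro borel_measurable_inner incr_measurable_F st)
  have sq: "integrable M (\<lambda>\<omega>. ?I b \<omega> * (incr s t \<omega> \<bullet> b)\<^sup>2) \<and>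
      expectation (\<lambda>\<omega>. ?I b \<omega> * (incr s t \<omega> \<bullet> b)\<^sup>2) = expectation (?I b) * ((t - s) * (Q b \<bullet> b))" for b
    using incr_indep[OF st Im[of b] II[of b], of "\<lambda>x. (x \<bullet> b)\<^sup>2"] incr_integrable_power[OF st, of b 2]
      incr_variance[OF st, of b] by simp
  have sqe: "(incr s t \<omega> \<bullet> B \<omega>)\<^sup>2 = (\<Sum>b\<in>?R. ?I b \<omega> * (incr s t \<omega> \<bullet> b)\<^sup>2)" if "\<omega> \<in> space M" for \<omega>
    using dec[OF that, of "\<lambda>b. (incr s t \<omega> \<bullet> b)\<^sup>2"] .
  show "integrable M (\<lambda>\<omega>. (incr s t \<omega> \<bullet> B \<omega>)\<^sup>2)"
    by (subst Bochner_Integration.integrable_cong[OF refl sqe]) (use sq in auto)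
  have "expectation (\<lambda>\<omega>. (incr s t \<omega> \<bullet> B \<omega>)\<^sup>2) = (\<Sum>b\<in>?R. expectation (?I b) * ((t - s) * (Q b \<bullet> b)))"
    by (subst Bochner_Integration.integral_cong[OF refl sqe]) (use sq in auto)
  also have "\<dots> = expectation (\<lambda>\<omega>. \<Sum>b\<in>?R. ?I b \<omega> * ((t - s) * (Q b \<bullet> b)))"
    using II by simp
  also have "\<dots> = expectation (\<lambda>\<omega>. (t - s) * (Q (B \<omega>) \<bullet> B \<omega>))"
    by (intro Bochner_Integration.integral_cong refl dec[symmetric])
  finally show "expectation (\<lambda>\<omega>. (incr s t \<omega> \<bullet> B \<omega>)\<^sup>2) = \<dots>" .
  fix S :: "'w \<Rightarrow> real" assume S: "S \<in> borel_measurable (F s)" "integrable M (\<lambda>\<omega>. (S \<omega>)\<^sup>2)"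
  have SM: "S \<in> borel_measurable M" using measurable_F_M[OF st(1) S(1)] .
  have iS: "integrable M S" by (rule square_integrable_imp_integrable[OF SM S(2)])
  have "integrable M (\<lambda>\<omega>. S \<omega> * ?I b \<omega>)" for b
    by (rule Bochner_Integration.integrable_bound[OF iS]) (use SM in \<open>auto split: split_indicator\<close>)
  then have or: "integrable M (\<lambda>\<omega>. S \<omega> * ?I b \<omega> * (incr s t \<omega> \<bullet> b)) \<and>
      expectation (\<lambda>\<omega>. S \<omega> * ?I b \<omega> * (incr s t \<omega> \<bullet> b)) = 0" for b
    using incr_indep[OF st borel_measurable_times[OF S(1) Im[of b]], of "\<lambda>x. x \<bullet> b"] incr_integrable[OF st, of b]
      incr_mean[OF st, of b] by simp
  have e: "S \<omega> * (incr s t \<omega> \<bullet> B \<omega>) = (\<Sum>b\<in>?R. S \<omega> * ?I b \<omega> * (incr s t \<omega> \<bullet> b))" if "\<omega> \<in> space M" for \<omega>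
    using dec[OF that, of "\<lambda>b. incr s t \<omega> \<bullet> b"] by (simp add: sum_distrib_left mult.assoc)
  show "expectation (\<lambda>\<omega>. S \<omega> * (incr s t \<omega> \<bullet> B \<omega>)) = 0"
    by (subst Bochner_Integration.integral_cong[OF refl e]) (use or in auto)
qed

text \<open>Discarding an increment as soon as the accumulated variance exceeds \<open>\<delta>\<close> keeps the integrand
  adapted and makes the second moment at most \<open>\<delta>\<close>.\<close>

lemma elementary_tail_bound:
  fixes B :: "nat \<Rightarrow> 'w \<Rightarrow> 'h" and N :: nat
  assumes \<sigma>: "0 \<le> \<sigma> 0" "\<And>i. \<sigma> i \<le> \<sigma> (Suc i)" and B: "\<And>i. simple_function (F (\<sigma> i)) (B i)"
    and \<epsilon>: "0 < \<epsilon>" and \<delta>: "0 < \<delta>"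
  defines "V \<equiv> \<lambda>n \<omega>. \<Sum>i<n. (\<sigma> (Suc i) - \<sigma> i) * (Q (B i \<omega>) \<bullet> B i \<omega>)"
    and "X \<equiv> \<lambda>\<omega>. \<Sum>i<N. incr (\<sigma> i) (\<sigma> (Suc i)) \<omega> \<bullet> B i \<omega>"
  shows "X \<in> borel_measurable M" "V N \<in> borel_measurable M"
    and "measure M {\<omega> \<in> space M. \<bar>X \<omega>\<bar> > \<epsilon>} \<le> \<delta> / \<epsilon>\<^sup>2 + measure M {\<omega> \<in> space M. V N \<omega> > \<delta>}"
proof -
  have pos: "0 \<le> \<sigma> i" for i by (induction i) (use \<sigma> order_trans in blast)+
  have mono: "\<sigma> i \<le> \<sigma> j" if "i \<le> j" for i j
    using lift_Suc_mono_le[of \<sigma>, OF \<sigma>(2) that] .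
  have sfB: "simple_function (F (\<sigma> j)) (B i)" if "i \<le> j" for i j
    using simple_function_subalgebra[OF subalg_F[OF pos mono[OF that]] B] .
  \<comment> \<open>\<open>V (Suc i)\<close> involves only \<open>B 0\<close> up to
    \<open>B i\<close> and is therefore known at time \<open>\<sigma> i\<close>: the test in
    \<open>B'\<close> may count the step that is about to be taken.\<close>
  have V: "simple_function (F (\<sigma> i)) (V (Suc i))" for i
    unfolding V_def by (intro simple_function_sum simple_function_compose1[OF sfB]) simp
  define B' where "B' i \<omega> = (if V (Suc i) \<omega> \<le> \<delta> then B i \<omega> else 0)" for i \<omega>
  have B': "simple_function (F (\<sigma> i)) (B' i)" for i
    unfolding B'_def by (rule simple_function_compose2[OF V B])
  define V' where "V' n \<omega> = (\<Sum>i<n. (\<sigma> (Suc i) - \<sigma> i) * (Q (B' i \<omega>) \<bullet> B' i \<omega>))" for n \<omega>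
  \<comment> \<open>Both bounds go through the induction together: a kept step leaves
    \<open>V'\<close> below \<open>V (Suc n)\<close>, which has just passed the test against
    \<open>\<delta>\<close>, and a discarded one leaves \<open>V'\<close> unchanged.\<close>
  have V': "V' n \<omega> \<le> V n \<omega> \<and> V' n \<omega> \<le> \<delta>" for n \<omega>
  proof (induction n)
    case 0
    show ?case using \<delta> by (simp add: V_def V'_def)
  next
    case (Suc n)
    have S: "V (Suc n) \<omega> = V n \<omega> + (\<sigma> (Suc n) - \<sigma> n) * (Q (B n \<omega>) \<bullet> B n \<omega>)"
      "V' (Suc n) \<omega> = V' n \<omega> + (\<sigma> (Suc n) - \<sigma> n) * (Q (B' n \<omega>) \<bullet> B' n \<omega>)"
      by (simp_all add: V_def V'_def)
    have "0 \<le> (\<sigma> (Suc n) - \<sigma> n) * (Q (B n \<omega>) \<bullet> B n \<omega>)" using \<sigma>(2)[of n] Q_nonneg by simp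
    then show ?case using Suc S by (cases "V (Suc n) \<omega> \<le> \<delta>") (auto simp: B'_def)
  qed
  define X' where "X' \<omega> = (\<Sum>i<N. incr (\<sigma> i) (\<sigma> (Suc i)) \<omega> \<bullet> B' i \<omega>)" for \<omega>
  \<comment> \<open>\<open>V\<close> increases with its index, so if its final value passes the test
    then no step was discarded.\<close>
  have XX: "X' \<omega> = X \<omega>" if "V N \<omega> \<le> \<delta>" for \<omega>
  proof -
    have "V (Suc i) \<omega> \<le> V N \<omega>" if "i < N" for i
      unfolding V_def by (rule sum_mono2) (use that \<sigma>(2) Q_nonneg in auto)
    then show ?thesis
      unfolding X_def X'_def B'_def using that by (intro sum.cong) (auto intro: order_trans)
  qed
  note eo = elementary_orth[OF pos \<sigma>(2)]
  note O = orthogonal_sum_square[of \<sigma> "\<lambda>i \<omega>. incr (\<sigma> i) (\<sigma> (Suc i)) \<omega> \<bullet> B' i \<omega>" N, OF \<sigma> eo(1,2,4)[OF B'],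
      folded X'_def]
  have X'M [measurable]: "X' \<in> borel_measurable M" using O measurable_F_M[OF pos] unfolding X'_def[abs_def] by blast
  have "(\<lambda>\<omega>. incr (\<sigma> i) (\<sigma> (Suc i)) \<omega> \<bullet> B i \<omega>) \<in> borel_measurable M" for i
    using measurable_F_M[OF pos eo(1)[OF B]] .
  then show XM [measurable]: "X \<in> borel_measurable M" unfolding X_def by (intro borel_measurable_sum)
  have B'M: "simple_function M (B' i)" for i by (rule simple_function_subalgebra[OF subalg[OF pos] B'])
  have BM: "simple_function M (B i)" for i by (rule simple_function_subalgebra[OF subalg[OF pos] B])
  have "simple_function M (\<lambda>\<omega>. (\<sigma> (Suc i) - \<sigma> i) * (Q (B i \<omega>) \<bullet> B i \<omega>))" for i
    by (rule simple_function_compose1[OF BM])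
  then show VM [measurable]: "V N \<in> borel_measurable M"
    unfolding V_def by (intro borel_measurable_sum borel_measurable_simple_function)
  have iV: "integrable M (\<lambda>\<omega>. (\<sigma> (Suc i) - \<sigma> i) * (Q (B' i \<omega>) \<bullet> B' i \<omega>))" for i
  proof -
    have sf: "simple_function M (\<lambda>\<omega>. (\<sigma> (Suc i) - \<sigma> i) * (Q (B' i \<omega>) \<bullet> B' i \<omega>))"
      by (rule simple_function_compose1[OF B'M])
    have "norm ((\<sigma> (Suc i) - \<sigma> i) * (Q (B' i \<omega>) \<bullet> B' i \<omega>)) \<le> \<delta>" for \<omega>
    proof -
      have nn: "0 \<le> (\<sigma> (Suc j) - \<sigma> j) * (Q (B' j \<omega>) \<bullet> B' j \<omega>)" for j using \<sigma>(2)[of j] Q_nonneg by simp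
      have "(\<sigma> (Suc i) - \<sigma> i) * (Q (B' i \<omega>) \<bullet> B' i \<omega>) \<le> V' (Suc i) \<omega>"
        unfolding V'_def by (rule member_le_sum[of i]) (use nn in auto)
      then show ?thesis using V'[of "Suc i" \<omega>] nn[of i] by simp
    qed
    then show ?thesis
      by (intro integrable_const_bound[where B = \<delta>] borel_measurable_simple_function[OF sf]) auto
  qed
  have "expectation (\<lambda>\<omega>. (X' \<omega>)\<^sup>2) = expectation (V' N)"
    using O iV unfolding V'_def[abs_def] X'_def by (simp add: eo(3)[OF B'])
  also have "\<dots> \<le> expectation (\<lambda>\<omega>. \<delta>)"
    using V' iV unfolding V'_def[abs_def] by (intro integral_mono) auto
  finally have E: "expectation (\<lambda>\<omega>. (X' \<omega>)\<^sup>2) \<le> \<delta>" by (simp add: prob_space)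
  have "measure M {\<omega> \<in> space M. \<bar>X' \<omega>\<bar> \<ge> \<epsilon>} \<le> expectation (\<lambda>\<omega>. (X' \<omega>)\<^sup>2) / \<epsilon>\<^sup>2"
    by (rule second_moment_method[OF X'M]) (use O \<epsilon> in \<open>auto simp: X'_def\<close>)
  also have "\<dots> \<le> \<delta> / \<epsilon>\<^sup>2" using E by (intro divide_right_mono) auto
  finally have 1: "measure M {\<omega> \<in> space M. \<bar>X' \<omega>\<bar> \<ge> \<epsilon>} \<le> \<delta> / \<epsilon>\<^sup>2" .
  have "measure M {\<omega> \<in> space M. \<bar>X \<omega>\<bar> > \<epsilon>}
      \<le> measure M ({\<omega> \<in> space M. \<bar>X' \<omega>\<bar> \<ge> \<epsilon>} \<union> {\<omega> \<in> space M. V N \<omega> > \<delta>})"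
    using XX by (intro finite_measure_mono) force+
  also have "\<dots> \<le> measure M {\<omega> \<in> space M. \<bar>X' \<omega>\<bar> \<ge> \<epsilon>} + measure M {\<omega> \<in> space M. V N \<omega> > \<delta>}"
    by (rule measure_Un_le) measurable
  finally show "measure M {\<omega> \<in> space M. \<bar>X \<omega>\<bar> > \<epsilon>} \<le> \<delta> / \<epsilon>\<^sup>2 + measure M {\<omega> \<in> space M. V N \<omega> > \<delta>}"
    using 1 by linarith
qed

end

subsection \<open>Step functions\<close>

text \<open>Monotonicity is assumed only below \<open>N\<close>, as in
  \<open>elementary_integrand\<close>; what the grid does later is unspecified.\<close>

lemma step_grid_mono:
  fixes \<sigma> :: "nat \<Rightarrow> real"
  assumes "\<And>i. i < N \<Longrightarrow> \<sigma> i \<le> \<sigma> (Suc i)" "i \<le> j" "j \<le> N"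
  shows "\<sigma> i \<le> \<sigma> j"
  using assms(2,3)
proof (induction j rule: dec_induct)
  case (step n)
  then show ?case using assms(1)[of n] by simp
qed simp

lemma step_sum_eq:
  fixes \<sigma> :: "nat \<Rightarrow> real" and c :: "nat \<Rightarrow> 'a::real_vector"
  assumes mono: "\<And>i. i < N \<Longrightarrow> \<sigma> i \<le> \<sigma> (Suc i)" and k: "k < N" "\<sigma> k < s" "s \<le> \<sigma> (Suc k)"
  shows "(\<Sum>i<N. indicator {\<sigma> i<..\<sigma> (Suc i)} s *\<^sub>R c i) = c k"
proof -
  have "(\<Sum>i<N. indicator {\<sigma> i<..\<sigma> (Suc i)} s *\<^sub>R c i) = (\<Sum>i<N. if i = k then c i else 0)"
  proof (intro sum.cong refl)
    fix i assume i: "i \<in> {..<N}"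
    consider "i = k" | "i < k" | "k < i" by linarith
    then show "indicator {\<sigma> i<..\<sigma> (Suc i)} s *\<^sub>R c i = (if i = k then c i else 0)"
    proof cases
      case 2
      then have "\<sigma> (Suc i) \<le> \<sigma> k" using step_grid_mono[of N \<sigma> "Suc i" k, OF mono] k by simp
      then show ?thesis using 2 k by (simp add: indicator_def)
    next
      case 3
      then have "\<sigma> (Suc k) \<le> \<sigma> i" using step_grid_mono[of N \<sigma> "Suc k" i, OF mono] i by simp
      then show ?thesis using 3 k by (simp add: indicator_def)
    qed (use k in simp)
  qed
  then show ?thesis using k by simp
qed

lemma step_sum_zero:
  fixes \<sigma> :: "nat \<Rightarrow> real" and c :: "nat \<Rightarrow> 'a::real_vector"
  assumes mono: "\<And>i. i < N \<Longrightarrow> \<sigma> i \<le> \<sigma> (Suc i)" and s: "s \<le> \<sigma> 0 \<or> \<sigma> N < s"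
  shows "(\<Sum>i<N. indicator {\<sigma> i<..\<sigma> (Suc i)} s *\<^sub>R c i) = 0"
proof (intro sum.neutral ballI)
  fix i assume i: "i \<in> {..<N}"
  then have "\<sigma> 0 \<le> \<sigma> i" "\<sigma> (Suc i) \<le> \<sigma> N"
    using step_grid_mono[of N \<sigma> 0 i, OF mono] step_grid_mono[of N \<sigma> "Suc i" N, OF mono] by simp_all
  then show "indicator {\<sigma> i<..\<sigma> (Suc i)} s *\<^sub>R c i = 0" using s by (auto simp: indicator_def)
qed

lemma step_find:
  fixes \<sigma> :: "nat \<Rightarrow> real"
  assumes "\<sigma> 0 < s" "s \<le> \<sigma> N"
  obtains k where "k < N" "\<sigma> k < s" "s \<le> \<sigma> (Suc k)"
proof -
  have "\<exists>k<N. \<sigma> k < s \<and> s \<le> \<sigma> (Suc k)"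
    using assms
  proof (induction N)
    case (Suc N)
    then show ?case by (cases "s \<le> \<sigma> N") (auto simp: less_Suc_eq)
  qed simp
  then show ?thesis using that by blast
qed

lemma adj_diff:
  fixes S T :: "'a::{real_inner,complete_space} \<Rightarrow>\<^sub>L 'b::real_inner"
  shows "adj (S - T) y = adj S y - adj T y"
proof -
  have "x \<bullet> adj (S - T) y = x \<bullet> (adj S y - adj T y)" for x
    by (simp add: inner_diff_right minus_blinfun.rep_eq inner_diff_left flip: adj_inner)
  then show ?thesis by (subst vector_eq_ldot[symmetric]) blast
qed

text \<open>A single term of the trace; it lets the covariance norm of an operator control the
  scalar integrand along \<open>f\<close>.\<close>

lemma cov_norm_sq_ge_component:
  fixes Q :: "'h::{real_inner,banach} \<Rightarrow>\<^sub>L 'h" and T :: "'h \<Rightarrow>\<^sub>L 'k::{real_inner,second_countable_topology}"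
  assumes "f \<in> onb"
  shows "ennreal (Q (adj T f) \<bullet> adj T f) \<le> cov_norm_sq Q T"
proof -
  have "(\<Sum>\<^sub>\<infinity>f\<in>{f}. ennreal (Q (adj T f) \<bullet> adj T f)) \<le> (\<Sum>\<^sub>\<infinity>f\<in>onb. ennreal (Q (adj T f) \<bullet> adj T f))"
    using assms by (intro infsum_mono_neutral nonneg_summable_on_complete) auto
  then show ?thesis by (simp add: cov_norm_sq_def adj.rep_eq)
qed

section \<open>The stochastic integral of a constant operator\<close>

context wiener
begin

lemma incr_telescope: "(\<Sum>i<N. incr (s i) (s (Suc i)) \<omega>) = incr (s 0) (s N) \<omega>"
  by (induction N) (simp_all add: incr_def)

text \<open>Let \<open>C n\<close> be the integrands approximating \<open>\<eta>\<close> in the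
  definition of \<open>J\<close>. On \<open>[0, t]\<close> the difference of \<open>\<eta>\<close>
  and \<open>C n\<close> is again elementary, its integral along \<open>h\<close> is a scalar sum to
  which the tail estimate applies, and its accumulated variance is at most the covariance integral,
  which tends to zero in probability. The factor 2 leaves one \<open>\<epsilon>\<close> for this sum
  and one for the distance of \<open>J t\<close> to the integral of \<open>C n\<close>.\<close>

lemma stochastic_integral_const_component:
  fixes \<eta> :: "'h \<Rightarrow>\<^sub>L 'k::{real_inner,banach,second_countable_topology}"
  assumes J: "stochastic_integral M F Q W (\<lambda>t \<omega>. blinfun_apply \<eta>) J" and t: "0 \<le> t" and h: "h \<in> onb"
    and \<epsilon>: "0 < \<epsilon>"
  shows "measure M {\<omega> \<in> space M. \<bar>(\<eta> (incr 0 t \<omega>) - J t \<omega>) \<bullet> h\<bar> > 2 * \<epsilon>} = 0"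
proof -
  obtain N \<tau> C where el: "\<And>n. elementary_integrand M F (N n) (\<tau> n) (C n)"
    and cov: "null_in_prob M (\<lambda>n \<omega>. \<integral>\<^sup>+s\<in>{0..t}.
           cov_norm_sq Q (\<lambda>h. \<eta> h - elementary_process (N n) (\<tau> n) (C n) s \<omega> h) \<partial>lborel)"
    and app: "null_in_prob M (\<lambda>n \<omega>. ennreal (norm (J t \<omega> - elementary_integral W (N n) (\<tau> n) (C n) t \<omega>)))"
    using J t unfolding stochastic_integral_def by blast
  have JM [measurable]: "J t \<in> borel_measurable M"
    using J t measurable_F_M[OF t] unfolding stochastic_integral_def by blast
  have h1: "norm h = 1" using orthonormal_onb h by (auto simp: orthonormal_def)
  let ?Cov = "\<lambda>n \<omega>. \<integral>\<^sup>+s\<in>{0..t}.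
           cov_norm_sq Q (\<lambda>h. \<eta> h - elementary_process (N n) (\<tau> n) (C n) s \<omega> h) \<partial>lborel"
  let ?E = "\<lambda>n \<omega>. elementary_integral W (N n) (\<tau> n) (C n) t \<omega>"
  have key: "\<exists>X. X \<in> borel_measurable M \<and> (\<forall>\<omega>\<in>space M. X \<omega> = (\<eta> (incr 0 t \<omega>) - ?E n \<omega>) \<bullet> h) \<and>
    measure M {\<omega> \<in> space M. \<bar>X \<omega>\<bar> > \<epsilon>} \<le> \<delta> / \<epsilon>\<^sup>2 + measure M {\<omega> \<in> space M. ?Cov n \<omega> > ennreal \<delta>}"
    if \<delta>: "0 < \<delta>" for n \<delta>
  proof -
    let ?N = "N n" let ?\<tau> = "\<tau> n" let ?C = "C n"
    have \<tau>0: "0 \<le> ?\<tau> 0" and \<tau>: "\<And>i. i < ?N \<Longrightarrow> ?\<tau> i \<le> ?\<tau> (Suc i)"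
      and Cf: "\<And>i. i < ?N \<Longrightarrow> finite (?C i ` space M)"
      and Cm: "\<And>i B. i < ?N \<Longrightarrow> {\<omega> \<in> space M. ?C i \<omega> = B} \<in> sets (F (?\<tau> i))"
      using el[of n] by (auto simp: elementary_integrand_def)
    have \<tau>pos: "0 \<le> ?\<tau> i" if "i \<le> ?N" for i
      using step_grid_mono[of ?N ?\<tau> 0 i, OF \<tau>] \<tau>0 that by simp
    have sfC: "simple_function (F (?\<tau> i)) (?C i)" if "i < ?N" for i
      using Cf[OF that] Cm[OF that] \<tau>pos[of i] that
      by (auto simp: simple_function_def space_F vimage_def Int_def conj_commute)
    \<comment> \<open>The grid of \<open>C n\<close> clipped at \<open>t\<close>, with 0 put in
      front and \<open>t\<close> behind: indices shift by one and there are \<open>N n + 2\<close>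
      cells. The constant continuation is there because the tail estimate takes an infinite
      grid.\<close>
    define \<sigma> where "\<sigma> i = (if i = 0 then 0 else if i \<le> Suc ?N then min t (?\<tau> (i - 1)) else t)" for i
    \<comment> \<open>On the two outer cells the elementary process vanishes and
      \<open>\<eta>\<close> alone remains. Where the original cell starts after \<open>t\<close> the
      clipped one is empty, and the value 0 is forced by adaptedness: \<open>C\<close> is known
      there only at a time later than \<open>t\<close>.\<close>
    define B where "B i \<omega> = (if i = 0 \<or> ?N < i then adj \<eta> h
        else if ?\<tau> (i - 1) \<le> t then adj (\<eta> - ?C (i - 1) \<omega>) h else 0)" for i \<omega>
    have \<sigma>_simps: "\<sigma> 0 = 0" "\<And>i. i \<le> ?N \<Longrightarrow> \<sigma> (Suc i) = min t (?\<tau> i)" "\<sigma> (Suc (Suc ?N)) = t"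
      by (auto simp: \<sigma>_def)
    have \<sigma>: "0 \<le> \<sigma> 0" "\<sigma> i \<le> \<sigma> (Suc i)" for i
    proof -
      show "0 \<le> \<sigma> 0" by (simp add: \<sigma>_def)
      show "\<sigma> i \<le> \<sigma> (Suc i)"
      proof (cases i)
        case 0
        then show ?thesis using t \<tau>0 by (simp add: \<sigma>_def)
      next
        case (Suc j)
        then show ?thesis using \<tau>[of j] by (auto simp: \<sigma>_def)
      qed
    qed
    have B: "simple_function (F (\<sigma> i)) (B i)" for i
    proof (cases "i = 0 \<or> ?N < i \<or> \<not> ?\<tau> (i - 1) \<le> t")
      case True
      then have "B i = (\<lambda>_. adj \<eta> h) \<or> B i = (\<lambda>_. 0)" by (auto simp: B_def fun_eq_iff)
      then show ?thesis by auto
    next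
      case False
      then have "B i = (\<lambda>\<omega>. adj (\<eta> - ?C (i - 1) \<omega>) h)" "\<sigma> i = ?\<tau> (i - 1)" "i - 1 < ?N"
        by (auto simp: B_def \<sigma>_def fun_eq_iff min_def)
      then show ?thesis using simple_function_compose1[OF sfC, of "i - 1" "\<lambda>c. adj (\<eta> - c) h"] by simp
    qed
    let ?X = "\<lambda>\<omega>. \<Sum>i<Suc (Suc ?N). incr (\<sigma> i) (\<sigma> (Suc i)) \<omega> \<bullet> B i \<omega>"
    let ?V = "\<lambda>\<omega>. \<Sum>i<Suc (Suc ?N). (\<sigma> (Suc i) - \<sigma> i) * (Q (B i \<omega>) \<bullet> B i \<omega>)"
    note tail = elementary_tail_bound[OF \<sigma> B \<epsilon> \<delta>, of "Suc (Suc ?N)"]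
    have X: "?X \<omega> = (\<eta> (incr 0 t \<omega>) - ?E n \<omega>) \<bullet> h" for \<omega>
    proof -
      let ?s = "\<lambda>i. min t (?\<tau> i)"
      have mid: "incr (\<sigma> (Suc j)) (\<sigma> (Suc (Suc j))) \<omega> \<bullet> B (Suc j) \<omega>
          = incr (?s j) (?s (Suc j)) \<omega> \<bullet> adj \<eta> h - ?C j \<omega> (incr (?s j) (?s (Suc j)) \<omega>) \<bullet> h" if j: "j < ?N" for j
      proof (cases "?\<tau> j \<le> t")
        case True
        then show ?thesis using j by (simp add: \<sigma>_simps B_def adj_diff inner_diff_right adj_inner)
      next
        case False
        then have "?s j = t" "?s (Suc j) = t" using \<tau>[OF j] by auto
        then show ?thesis using j by (simp add: \<sigma>_simps)
      qed
      have "?X \<omega> = incr 0 (?s 0) \<omega> \<bullet> adj \<eta> h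
          + (\<Sum>j<?N. incr (\<sigma> (Suc j)) (\<sigma> (Suc (Suc j))) \<omega> \<bullet> B (Suc j) \<omega>) + incr (?s ?N) t \<omega> \<bullet> adj \<eta> h"
        unfolding sum.lessThan_Suc_shift[of _ "Suc ?N"] sum.lessThan_Suc[of _ ?N]
        by (simp add: \<sigma>_simps B_def)
      also have "(\<Sum>j<?N. incr (\<sigma> (Suc j)) (\<sigma> (Suc (Suc j))) \<omega> \<bullet> B (Suc j) \<omega>)
          = (\<Sum>j<?N. incr (?s j) (?s (Suc j)) \<omega>) \<bullet> adj \<eta> h - ?E n \<omega> \<bullet> h"
      proof -
        have "?E n \<omega> \<bullet> h = (\<Sum>j<?N. ?C j \<omega> (incr (?s j) (?s (Suc j)) \<omega>) \<bullet> h)"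
          by (simp add: elementary_integral_def incr_def inner_sum_left)
        then show ?thesis by (simp add: mid sum_subtractf inner_sum_left)
      qed
      also have "(\<Sum>j<?N. incr (?s j) (?s (Suc j)) \<omega>) = incr (?s 0) (?s ?N) \<omega>"
        by (rule incr_telescope[of ?s])
      finally show ?thesis
        by (simp add: inner_diff_left adj_inner flip: inner_add_left) (simp add: incr_def inner_diff_left)
    qed
    \<comment> \<open>Every \<open>s\<close> in \<open>(0, t]\<close> lies in exactly one cell, and
      there \<open>B\<close> is the adjoint of the integrand error at time \<open>s\<close> applied
      to \<open>h\<close>. So the left side integrates one term of the trace that is integrated on
      the right.\<close>
    have VC: "ennreal (?V \<omega>) \<le> ?Cov n \<omega>" if "\<omega> \<in> space M" for \<omega>
    proof -
      let ?q = "\<lambda>i. Q (B i \<omega>) \<bullet> B i \<omega>"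
      have "ennreal (?V \<omega>) = (\<Sum>i<Suc (Suc ?N). ennreal ((\<sigma> (Suc i) - \<sigma> i) * ?q i))"
        using \<sigma>(2) Q_nonneg by (intro sum_ennreal[symmetric]) (auto intro!: mult_nonneg_nonneg)
      also have "\<dots> = (\<Sum>i<Suc (Suc ?N). \<integral>\<^sup>+s. ennreal (?q i) * indicator {\<sigma> i<..\<sigma> (Suc i)} s \<partial>lborel)"
        using \<sigma>(2) Q_nonneg by (intro sum.cong refl) (subst nn_integral_cmult_indicator; simp add: ennreal_mult mult.commute)
      also have "\<dots> = (\<integral>\<^sup>+s. (\<Sum>i<Suc (Suc ?N). ennreal (?q i) * indicator {\<sigma> i<..\<sigma> (Suc i)} s) \<partial>lborel)"
        by (rule nn_integral_sum[symmetric]) measurable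
      also have "\<dots> \<le> ?Cov n \<omega>"
      proof (rule nn_integral_mono)
        fix s :: real
        let ?\<Psi> = "elementary_process ?N ?\<tau> ?C s \<omega>"
        have "(\<Sum>i<Suc (Suc ?N). ennreal (?q i) * indicator {\<sigma> i<..\<sigma> (Suc i)} s)
            = (\<Sum>i<Suc (Suc ?N). ennreal (indicator {\<sigma> i<..\<sigma> (Suc i)} s *\<^sub>R ?q i))"
          by (intro sum.cong) (auto split: split_indicator)
        also have "\<dots> = ennreal (\<Sum>i<Suc (Suc ?N). indicator {\<sigma> i<..\<sigma> (Suc i)} s *\<^sub>R ?q i)"
          using Q_nonneg by (intro sum_ennreal) auto
        finally have eq: "(\<Sum>i<Suc (Suc ?N). ennreal (?q i) * indicator {\<sigma> i<..\<sigma> (Suc i)} s)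
          = ennreal (\<Sum>i<Suc (Suc ?N). indicator {\<sigma> i<..\<sigma> (Suc i)} s *\<^sub>R ?q i)" .
        show "(\<Sum>i<Suc (Suc ?N). ennreal (?q i) * indicator {\<sigma> i<..\<sigma> (Suc i)} s)
          \<le> cov_norm_sq Q (\<lambda>h. \<eta> h - ?\<Psi> h) * indicator {0..t} s"
        proof (cases "0 < s \<and> s \<le> t")
          case False
          then have "(\<Sum>i<Suc (Suc ?N). indicator {\<sigma> i<..\<sigma> (Suc i)} s *\<^sub>R ?q i) = 0"
            by (intro step_sum_zero \<sigma>(2)) (auto simp: \<sigma>_simps)
          then show ?thesis unfolding eq by simp
        next
          case True
          then obtain k where k: "k < Suc (Suc ?N)" "\<sigma> k < s" "s \<le> \<sigma> (Suc k)"
            using step_find[of \<sigma> s "Suc (Suc ?N)"] by (auto simp: \<sigma>_simps)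
          have "B k \<omega> = adj (\<eta> - ?\<Psi>) h"
          proof -
            consider "k = 0" | j where "k = Suc j" "j < ?N" | "k = Suc ?N"
              using k(1) by (cases k) (auto simp: less_Suc_eq)
            then show ?thesis
            proof cases
              case 1
              then have "?\<Psi> = 0" unfolding elementary_process_def
                using k by (intro step_sum_zero \<tau>) (auto simp: \<sigma>_simps)
              then show ?thesis using 1 by (simp add: B_def)
            next
              case 2
              then have j: "?\<tau> j < s" "s \<le> ?\<tau> (Suc j)" using k True by (auto simp: \<sigma>_simps)
              then have "?\<Psi> = ?C j \<omega>" unfolding elementary_process_def
                using 2 by (intro step_sum_eq \<tau>) auto
              then show ?thesis using 2 j True by (simp add: B_def)
            next
              case 3
              then have "?\<Psi> = 0" unfolding elementary_process_def
                using k True by (intro step_sum_zero \<tau>) (auto simp: \<sigma>_simps)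
              then show ?thesis using 3 by (simp add: B_def)
            qed
          qed
          moreover have "(\<Sum>i<Suc (Suc ?N). indicator {\<sigma> i<..\<sigma> (Suc i)} s *\<^sub>R ?q i) = ?q k"
            by (rule step_sum_eq) (use \<sigma> k in auto)
          moreover have "cov_norm_sq Q (\<lambda>h. \<eta> h - ?\<Psi> h) = cov_norm_sq Q (\<eta> - ?\<Psi>)"
            by (simp add: minus_blinfun.rep_eq)
          ultimately show ?thesis
            unfolding eq using cov_norm_sq_ge_component[OF h, of Q "\<eta> - ?\<Psi>"] True by simp
        qed
      qed
      finally show ?thesis .
    qed
    have "measure M {\<omega> \<in> space M. ?V \<omega> > \<delta>} \<le> measure M {\<omega> \<in> space M. ?Cov n \<omega> > ennreal \<delta>}"
    proof (rule finite_measure_mono)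
      show "{\<omega> \<in> space M. ?V \<omega> > \<delta>} \<subseteq> {\<omega> \<in> space M. ?Cov n \<omega> > ennreal \<delta>}"
      proof safe
        fix \<omega> assume w: "\<omega> \<in> space M" and V: "\<delta> < ?V \<omega>"
        have "ennreal \<delta> < ennreal (?V \<omega>)" using V \<delta> by (intro ennreal_lessI) linarith+
        then show "ennreal \<delta> < ?Cov n \<omega>" using VC[OF w] by (rule less_le_trans)
      qed
      have "?Cov n \<in> borel_measurable M" using cov by (simp add: null_in_prob_def)
      then show "{\<omega> \<in> space M. ?Cov n \<omega> > ennreal \<delta>} \<in> sets M" by measurable
    qed
    then show ?thesis using tail X by (intro exI[of _ ?X]) auto
  qed
  define m where "m = measure M {\<omega> \<in> space M. \<bar>(\<eta> (incr 0 t \<omega>) - J t \<omega>) \<bullet> h\<bar> > 2 * \<epsilon>}"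
  \<comment> \<open>Letting \<open>n\<close> grow removes the two probabilities; since
    \<open>m\<close> does not depend on \<open>\<delta>\<close>, the remaining quotient can then be
    made arbitrarily small.\<close>
  have bound: "m \<le> \<delta> / \<epsilon>\<^sup>2" if \<delta>: "0 < \<delta>" for \<delta>
  proof -
    define a where "a n = measure M {\<omega> \<in> space M. ?Cov n \<omega> > ennreal \<delta>}" for n
    define b where "b n = measure M {\<omega> \<in> space M. ennreal (norm (J t \<omega> - ?E n \<omega>)) > ennreal \<epsilon>}" for n
    have "a \<longlonglongrightarrow> 0" "b \<longlonglongrightarrow> 0"
      using cov app \<delta> \<epsilon> unfolding null_in_prob_def a_def b_def by blast+
    then have L: "(\<lambda>n. \<delta> / \<epsilon>\<^sup>2 + a n + b n) \<longlonglongrightarrow> \<delta> / \<epsilon>\<^sup>2 + 0 + 0" by (intro tendsto_intros)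
    have "m \<le> \<delta> / \<epsilon>\<^sup>2 + a n + b n" for n
    proof -
      obtain X where X [measurable]: "X \<in> borel_measurable M" and
        XE: "\<And>\<omega>. \<omega> \<in> space M \<Longrightarrow> X \<omega> = (\<eta> (incr 0 t \<omega>) - ?E n \<omega>) \<bullet> h"
        and Xm: "measure M {\<omega> \<in> space M. \<bar>X \<omega>\<bar> > \<epsilon>} \<le> \<delta> / \<epsilon>\<^sup>2 + a n"
        using key[OF \<delta>, of n] unfolding a_def by blast
      have [measurable]: "(\<lambda>\<omega>. ennreal (norm (J t \<omega> - ?E n \<omega>))) \<in> borel_measurable M"
        using app by (simp add: null_in_prob_def)
      have "m \<le> measure M ({\<omega> \<in> space M. \<bar>X \<omega>\<bar> > \<epsilon>} \<union> {\<omega> \<in> space M. ennreal (norm (J t \<omega> - ?E n \<omega>)) > ennreal \<epsilon>})"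
        unfolding m_def
      proof (rule finite_measure_mono)
        show "{\<omega> \<in> space M. 2 * \<epsilon> < \<bar>(\<eta> (incr 0 t \<omega>) - J t \<omega>) \<bullet> h\<bar>}
          \<subseteq> {\<omega> \<in> space M. \<epsilon> < \<bar>X \<omega>\<bar>} \<union> {\<omega> \<in> space M. ennreal \<epsilon> < ennreal (norm (J t \<omega> - ?E n \<omega>))}"
        proof safe
          fix \<omega> assume w: "\<omega> \<in> space M" "2 * \<epsilon> < \<bar>(\<eta> (incr 0 t \<omega>) - J t \<omega>) \<bullet> h\<bar>"
            "\<not> ennreal \<epsilon> < ennreal (norm (J t \<omega> - ?E n \<omega>))"
          have "\<bar>(J t \<omega> - ?E n \<omega>) \<bullet> h\<bar> \<le> norm (J t \<omega> - ?E n \<omega>)"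
            using Cauchy_Schwarz_ineq2[of "J t \<omega> - ?E n \<omega>" h] h1 by simp
          also have "\<dots> \<le> \<epsilon>" using w(3) \<epsilon> by (simp add: not_less)
          finally show "\<epsilon> < \<bar>X \<omega>\<bar>" using w(2) XE[OF w(1)] by (simp add: inner_diff_left)
        qed
      qed measurable
      also have "\<dots> \<le> measure M {\<omega> \<in> space M. \<bar>X \<omega>\<bar> > \<epsilon>} + b n"
        unfolding b_def by (rule measure_Un_le) measurable
      finally show ?thesis using Xm by linarith
    qed
    then have "m \<le> \<delta> / \<epsilon>\<^sup>2 + 0 + 0" by (intro LIMSEQ_le_const[OF L]) auto
    then show ?thesis by simp
  qed
  have "m \<le> 0"
  proof (rule field_le_epsilon)
    fix e :: real assume "e > 0"
    then show "m \<le> 0 + e" using bound[of "e * \<epsilon>\<^sup>2"] \<epsilon> by simp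
  qed
  then show ?thesis unfolding m_def by (simp add: measure_le_0_iff)
qed

text \<open>Countably many basis vectors and tolerances \<open>1 / Suc n\<close> give one common
  null set; Parseval then turns vanishing coordinates into vanishing of the vector.\<close>

lemma stochastic_integral_const:
  fixes \<eta> :: "'h \<Rightarrow>\<^sub>L 'k::{real_inner,banach,second_countable_topology}"
  assumes J: "stochastic_integral M F Q W (\<lambda>t \<omega>. blinfun_apply \<eta>) J" and t: "0 \<le> t"
  shows "AE \<omega> in M. J t \<omega> = \<eta> (incr 0 t \<omega>)"
proof -
  let ?D = "\<lambda>\<omega>. \<eta> (incr 0 t \<omega>) - J t \<omega>"
  have JM [measurable]: "J t \<in> borel_measurable M"
    using J t measurable_F_M[OF t] unfolding stochastic_integral_def by blast
  have [measurable]: "(\<lambda>\<omega>. \<eta> (incr 0 t \<omega>)) \<in> borel_measurable M"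
    by (rule measurable_compose[OF incr_measurable borel_measurable_continuous_onI])
       (use t in \<open>auto intro!: continuous_intros\<close>)
  have "AE \<omega> in M. \<forall>n. \<bar>?D \<omega> \<bullet> h\<bar> \<le> 2 * (1 / real (Suc n))" if h: "h \<in> onb" for h
    unfolding AE_all_countable
  proof
    fix n
    have "emeasure M {\<omega> \<in> space M. \<bar>?D \<omega> \<bullet> h\<bar> > 2 * (1 / real (Suc n))} = 0"
      using stochastic_integral_const_component[OF J t h, of "1 / real (Suc n)"]
      by (simp add: emeasure_eq_measure del: of_nat_Suc)
    then show "AE \<omega> in M. \<bar>?D \<omega> \<bullet> h\<bar> \<le> 2 * (1 / real (Suc n))"
      by (intro AE_I[where N = "{\<omega> \<in> space M. \<bar>?D \<omega> \<bullet> h\<bar> > 2 * (1 / real (Suc n))}"]) (auto simp: not_le)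
  qed
  then have "AE \<omega> in M. \<forall>h\<in>onb. \<forall>n. \<bar>?D \<omega> \<bullet> h\<bar> \<le> 2 * (1 / real (Suc n))"
    by (subst AE_ball_countable[OF countable_onb]) blast
  then show ?thesis
  proof eventually_elim
    case (elim \<omega>)
    have "?D \<omega> \<bullet> h = 0" if "h \<in> onb" for h
    proof -
      have "\<bar>?D \<omega> \<bullet> h\<bar> \<le> 2 * 0"
        by (rule LIMSEQ_le_const[OF tendsto_mult[OF tendsto_const LIMSEQ_Suc[OF lim_1_over_n]]])
           (use elim that in auto)
      then show ?thesis by simp
    qed
    then have "(norm (?D \<omega>))\<^sup>2 = 0"
      by (simp add: Parseval[OF orthonormal_basis_onb, symmetric] cong: infsum_cong)
    then show ?case by simp
  qed
qed

end

subsection \<open>Quadratic variation\<close>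

lemma bounded_linear_hs_apply: "bounded_linear (\<lambda>T. hs_op T x)"
proof (rule bounded_linear_intro[where K = "norm x"])
  show "norm (hs_op T x) \<le> norm T * norm x" for T
    by (rule order_trans[OF norm_blinfun]) (intro mult_right_mono norm_hs_op_le norm_ge_zero)
qed (simp_all add: plus_hs.rep_eq plus_blinfun.rep_eq scaleR_hs.rep_eq scaleR_blinfun.rep_eq)

text \<open>A nuclear representation of \<open>Q\<close> is carried by \<open>\<eta>\<close> to a
  series of rank one operators converging absolutely in the Hilbert-Schmidt norm. By completeness it
  has a sum in \<open>'h hs\<close>, and evaluation at vectors identifies that sum.\<close>

lemma hilbert_schmidt_covariance:
  fixes Q \<eta> :: "'h::{real_inner,banach,second_countable_topology} \<Rightarrow>\<^sub>L 'h"
  assumes "trace_class Q"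
  shows "hilbert_schmidt (\<eta> o\<^sub>L Q o\<^sub>L adj \<eta>)"
proof -
  obtain a b :: "nat \<Rightarrow> 'h" where ab: "summable (\<lambda>k. norm (a k) * norm (b k))"
    and Q: "\<And>x. (\<lambda>k. (a k \<bullet> x) *\<^sub>R b k) sums Q x"
    using assms unfolding trace_class_def by blast
  let ?T = "\<lambda>k. htensor (\<eta> (a k)) (\<eta> (b k))"
  have "summable (\<lambda>k. norm (?T k))"
  proof (rule summable_comparison_test')
    show "summable (\<lambda>k. (norm \<eta>)\<^sup>2 * (norm (a k) * norm (b k)))" using ab by (rule summable_mult)
    fix k :: nat
    have "norm (\<eta> (a k)) * norm (\<eta> (b k)) \<le> (norm \<eta> * norm (a k)) * (norm \<eta> * norm (b k))"
      by (intro mult_mono norm_blinfun) auto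
    then show "norm (norm (?T k)) \<le> (norm \<eta>)\<^sup>2 * (norm (a k) * norm (b k))"
      by (simp add: norm_htensor power2_eq_square ac_simps)
  qed
  then have T: "?T sums (\<Sum>k. ?T k)" by (rule summable_sums[OF summable_norm_cancel])
  have "hs_op (\<Sum>k. ?T k) x = (\<eta> o\<^sub>L Q o\<^sub>L adj \<eta>) x" for x
  proof (rule sums_unique2)
    show "(\<lambda>k. hs_op (?T k) x) sums hs_op (\<Sum>k. ?T k) x"
      by (rule bounded_linear.sums[OF bounded_linear_hs_apply T])
    show "(\<lambda>k. hs_op (?T k) x) sums (\<eta> o\<^sub>L Q o\<^sub>L adj \<eta>) x"
      using bounded_linear.sums[OF blinfun.bounded_linear_right Q[of "adj \<eta> x"], of \<eta>]
      by (simp add: blinfun.scaleR_right adj_inner)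
  qed
  then have "hs_op (\<Sum>k. ?T k) = \<eta> o\<^sub>L Q o\<^sub>L adj \<eta>" by (rule blinfun_eqI)
  then show ?thesis using hilbert_schmidt_hs_op[of "\<Sum>k. ?T k"] by (simp only:)
qed

context wiener
begin

definition cov_hs :: "('h \<Rightarrow>\<^sub>L 'h) \<Rightarrow> 'h hs" where
  "cov_hs \<eta> = hs_of (\<eta> o\<^sub>L Q o\<^sub>L adj \<eta>)"

lemma cov_hs_component: "hs_op (cov_hs \<eta>) e \<bullet> f = Q (adj \<eta> e) \<bullet> adj \<eta> f"
  by (simp add: cov_hs_def hs_op_of hilbert_schmidt_covariance tr_class adj_inner[of \<eta>])

text \<open>The norm is expanded into matrix entries and Tonelli moves the expectation inside. The
  entrywise bound is a product of a factor in \<open>e\<close> and a factor in \<open>f\<close>, so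
  the double sum factors into the square of the trace; this is why the fourth moment estimate was
  brought into product form.\<close>

lemma QV_mean_square:
  fixes \<eta> :: "'h \<Rightarrow>\<^sub>L 'h" and N :: nat
  assumes \<sigma>: "0 \<le> \<sigma> 0" "\<And>i. \<sigma> i \<le> \<sigma> (Suc i)"
  defines "S \<equiv> \<lambda>\<omega>. \<Sum>i<N. htensor (\<eta> (incr (\<sigma> i) (\<sigma> (Suc i)) \<omega>)) (\<eta> (incr (\<sigma> i) (\<sigma> (Suc i)) \<omega>))
      - (\<sigma> (Suc i) - \<sigma> i) *\<^sub>R cov_hs \<eta>"
  shows "S \<in> borel_measurable M"
    and "(\<integral>\<^sup>+\<omega>. ennreal ((norm (S \<omega>))\<^sup>2) \<partial>M)
      \<le> ennreal (3 * (\<Sum>i<N. (\<sigma> (Suc i) - \<sigma> i)\<^sup>2)) * (cov_norm_sq Q \<eta> * cov_norm_sq Q \<eta>)"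
proof -
  have pos: "0 \<le> \<sigma> i" for i by (induction i) (use \<sigma> order_trans in blast)+
  have "(\<lambda>\<omega>. htensor (\<eta> (incr (\<sigma> i) (\<sigma> (Suc i)) \<omega>)) (\<eta> (incr (\<sigma> i) (\<sigma> (Suc i)) \<omega>))) \<in> borel_measurable M" for i
    by (rule measurable_compose[OF incr_measurable[OF pos \<sigma>(2)] borel_measurable_continuous_onI])
       (rule htensor.continuous_on linear_continuous_on blinfun.bounded_linear_right)+
  then show "S \<in> borel_measurable M" unfolding S_def by (intro borel_measurable_sum borel_measurable_diff) auto
  let ?q = "\<lambda>e. ennreal (Q (adj \<eta> e) \<bullet> adj \<eta> e)"
  let ?D = "\<Sum>i<N. (\<sigma> (Suc i) - \<sigma> i)\<^sup>2"
  define c where "c e f \<omega> = ennreal ((hs_op (S \<omega>) e \<bullet> f)\<^sup>2)" for e f \<omega>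
  have comp: "hs_op (S \<omega>) e \<bullet> f = (\<Sum>i<N. (incr (\<sigma> i) (\<sigma> (Suc i)) \<omega> \<bullet> adj \<eta> e) * (incr (\<sigma> i) (\<sigma> (Suc i)) \<omega> \<bullet> adj \<eta> f)
      - (\<sigma> (Suc i) - \<sigma> i) * (Q (adj \<eta> e) \<bullet> adj \<eta> f))" for \<omega> e f
    unfolding S_def linear_sum[OF bounded_linear.linear[OF bounded_linear_hs_apply]]
    by (simp add: inner_sum_left minus_hs.rep_eq minus_blinfun.rep_eq scaleR_hs.rep_eq scaleR_blinfun.rep_eq
        inner_diff_left cov_hs_component adj_inner[of \<eta>])
  have cm [measurable]: "c e f \<in> borel_measurable M" for e f
  proof -
    have [measurable]: "(\<lambda>\<omega>. hs_op (S \<omega>) e \<bullet> f) \<in> borel_measurable M"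
      unfolding comp by (rule sum_QV_component(1)[OF \<sigma>])
    show ?thesis unfolding c_def by measurable
  qed
  have ci: "(\<integral>\<^sup>+\<omega>. c e f \<omega> \<partial>M) \<le> ennreal (3 * ?D) * (?q e * ?q f)" for e f
    unfolding c_def comp using sum_QV_component(2)[where N = N and g = "adj \<eta> e" and h = "adj \<eta> f", OF \<sigma>]
    by (simp add: ennreal_mult[symmetric] Q_nonneg sum_nonneg mult.assoc)
  have T: "cov_norm_sq Q \<eta> = (\<integral>\<^sup>+e. ?q e \<partial>count_space onb)"
    by (simp add: cov_norm_sq_def adj.rep_eq infsum_ennreal_eq_nn_integral countable_onb)
  have "(\<integral>\<^sup>+\<omega>. ennreal ((norm (S \<omega>))\<^sup>2) \<partial>M)
      = (\<integral>\<^sup>+\<omega>. \<integral>\<^sup>+e. \<integral>\<^sup>+f. c e f \<omega> \<partial>count_space onb \<partial>count_space onb \<partial>M)"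
    by (simp add: norm_hs_sq_ennreal c_def infsum_ennreal_eq_nn_integral countable_onb)
  also have "\<dots> = (\<integral>\<^sup>+e. \<integral>\<^sup>+\<omega>. \<integral>\<^sup>+f. c e f \<omega> \<partial>count_space onb \<partial>M \<partial>count_space onb)"
    by (rule nn_integral_count_space_nn_integral[OF countable_onb])
       (simp add: infsum_ennreal_eq_nn_integral[OF countable_onb, symmetric] borel_measurable_infsum_ennreal countable_onb)
  also have "\<dots> = (\<integral>\<^sup>+e. \<integral>\<^sup>+f. \<integral>\<^sup>+\<omega>. c e f \<omega> \<partial>M \<partial>count_space onb \<partial>count_space onb)"
    by (intro nn_integral_cong nn_integral_count_space_nn_integral countable_onb cm)
  also have "\<dots> \<le> (\<integral>\<^sup>+e. \<integral>\<^sup>+f. ennreal (3 * ?D) * (?q e * ?q f) \<partial>count_space onb \<partial>count_space onb)"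
    by (intro nn_integral_mono ci)
  also have "\<dots> = ennreal (3 * ?D) * (cov_norm_sq Q \<eta> * cov_norm_sq Q \<eta>)"
    unfolding T by (simp add: nn_integral_cmult nn_integral_multc)
  finally show "(\<integral>\<^sup>+\<omega>. ennreal ((norm (S \<omega>))\<^sup>2) \<partial>M) \<le> \<dots>" .
qed

lemma QV_dyadic_AE:
  fixes \<eta> :: "'h \<Rightarrow>\<^sub>L 'h"
  assumes t: "0 \<le> t"
  defines "\<sigma> \<equiv> \<lambda>n i. min t (real i / 2 ^ n)"
  shows "AE \<omega> in M. (\<lambda>n. \<Sum>i<n * 2 ^ n.
      htensor (\<eta> (incr (\<sigma> n i) (\<sigma> n (Suc i)) \<omega>)) (\<eta> (incr (\<sigma> n i) (\<sigma> n (Suc i)) \<omega>))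
        - (\<sigma> n (Suc i) - \<sigma> n i) *\<^sub>R cov_hs \<eta>) \<longlonglongrightarrow> 0"
proof -
  obtain c where c: "nuclear_bound Q c" using trace_class_nuclear_bound[OF tr_class] by blast
  have fin: "cov_norm_sq Q \<eta> \<le> ennreal ((norm \<eta>)\<^sup>2 * c)"
    by (rule cov_norm_sq_le[OF c blinfun.bounded_linear_right]) (auto intro: norm_blinfun)
  have c0: "0 \<le> c" using c by (simp add: nuclear_bound_def)
  define C where "C = ((norm \<eta>)\<^sup>2 * c)\<^sup>2"
  have \<sigma>: "0 \<le> \<sigma> n 0" "\<sigma> n i \<le> \<sigma> n (Suc i)" "\<sigma> n (Suc i) - \<sigma> n i \<le> 1 / 2 ^ n" for n i
    using t by (auto simp: \<sigma>_def min_def field_simps)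
  define S where "S n \<omega> = (\<Sum>i<n * 2 ^ n.
      htensor (\<eta> (incr (\<sigma> n i) (\<sigma> n (Suc i)) \<omega>)) (\<eta> (incr (\<sigma> n i) (\<sigma> n (Suc i)) \<omega>))
        - (\<sigma> n (Suc i) - \<sigma> n i) *\<^sub>R cov_hs \<eta>)" for n \<omega>
  note mean = QV_mean_square[where \<sigma> = "\<sigma> n" and N = "n * 2 ^ n" and \<eta> = \<eta> for n, OF \<sigma>(1,2), folded S_def]
  have int: "(\<integral>\<^sup>+\<omega>. ennreal ((norm (S n \<omega>))\<^sup>2) \<partial>M) \<le> ennreal (3 * t * C * (1 / 2) ^ n)" for n
  proof -
    \<comment> \<open>One factor is at most the mesh, the other telescopes. The bound also holds
      while \<open>n < t\<close>, when the grid does not yet reach \<open>t\<close>.\<close>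
    have "(\<Sum>i<n * 2 ^ n. (\<sigma> n (Suc i) - \<sigma> n i)\<^sup>2) \<le> (\<Sum>i<n * 2 ^ n. (1 / 2 ^ n) * (\<sigma> n (Suc i) - \<sigma> n i))"
      unfolding power2_eq_square by (intro sum_mono mult_right_mono \<sigma>) (use \<sigma>(2) in simp)
    also have "\<dots> = (1 / 2 ^ n) * (\<sigma> n (n * 2 ^ n) - \<sigma> n 0)"
      by (simp only: sum_distrib_left[symmetric] sum_lessThan_telescope)
    also have "\<dots> \<le> (1 / 2 ^ n) * t"
      using t by (intro mult_left_mono) (auto simp: \<sigma>_def)
    finally have D: "(\<Sum>i<n * 2 ^ n. (\<sigma> n (Suc i) - \<sigma> n i)\<^sup>2) \<le> (1 / 2 ^ n) * t" .
    have "(\<integral>\<^sup>+\<omega>. ennreal ((norm (S n \<omega>))\<^sup>2) \<partial>M)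
        \<le> ennreal (3 * (\<Sum>i<n * 2 ^ n. (\<sigma> n (Suc i) - \<sigma> n i)\<^sup>2)) * (cov_norm_sq Q \<eta> * cov_norm_sq Q \<eta>)"
      by (rule mean)
    also have "\<dots> \<le> ennreal (3 * ((1 / 2 ^ n) * t)) * (ennreal ((norm \<eta>)\<^sup>2 * c) * ennreal ((norm \<eta>)\<^sup>2 * c))"
      using D fin by (intro mult_mono ennreal_leI) (auto intro!: sum_nonneg)
    also have "\<dots> = ennreal (3 * t * C * (1 / 2) ^ n)"
      using t c0 by (simp add: ennreal_mult[symmetric] C_def power2_eq_square power_divide ac_simps)
    finally show ?thesis .
  qed
  have "AE \<omega> in M. (\<lambda>n. ennreal ((norm (S n \<omega>))\<^sup>2)) \<longlonglongrightarrow> 0"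
  proof (rule AE_tendsto_zero_of_suminf_nn_integral)
    show "(\<lambda>\<omega>. ennreal ((norm (S n \<omega>))\<^sup>2)) \<in> borel_measurable M" for n
      using mean(1)[of n] by measurable
    have "(\<Sum>n. \<integral>\<^sup>+\<omega>. ennreal ((norm (S n \<omega>))\<^sup>2) \<partial>M) \<le> (\<Sum>n. ennreal (3 * t * C * (1 / 2) ^ n))"
      by (intro suminf_le int) auto
    also have "\<dots> = ennreal (3 * t * C * 2)"
      using t c0 sums_mult[OF geometric_sums[of "1 / 2 :: real"], of "3 * t * C"]
      by (intro suminf_ennreal_eq) (auto simp: C_def)
    finally show "(\<Sum>n. \<integral>\<^sup>+\<omega>. ennreal ((norm (S n \<omega>))\<^sup>2) \<partial>M) < \<infinity>"
      by (rule order_le_less_trans) simp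
  qed
  then show ?thesis
  proof eventually_elim
    case (elim \<omega>)
    then have "(\<lambda>n. (norm (S n \<omega>))\<^sup>2) \<longlonglongrightarrow> 0"
      using tendsto_ennreal_iff[of "\<lambda>n. (norm (S n \<omega>))\<^sup>2" sequentially 0] by simp
    from tendsto_real_sqrt[OF this] have "(\<lambda>n. norm (S n \<omega>)) \<longlonglongrightarrow> 0" by simp
    then show ?case unfolding S_def by (rule tendsto_norm_zero_cancel)
  qed
qed

end

subsection \<open>Pathwise expansion\<close>

text \<open>Only integrability of \<open>f\<close> is assumed, since this is what makes the paths of
  \<open>Y\<close> continuous in the first place. In the dominated convergence the indicators may
  fail to converge at the single point \<open>a\<close>, a null set.\<close>

lemma set_integral_continuous:
  fixes f :: "real \<Rightarrow> 'a::{banach,second_countable_topology}"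
  assumes int: "\<And>t. 0 \<le> t \<Longrightarrow> set_integrable lborel {0..t} f"
  shows "continuous_on {0..} (\<lambda>t. LINT s:{0..t}|lborel. f s)"
proof (rule continuous_on_sequentiallyI)
  fix u :: "nat \<Rightarrow> real" and a assume u: "\<forall>n. u n \<in> {0..}" "a \<in> {0..}" "u \<longlonglongrightarrow> a"
  obtain K where K: "\<And>n. norm (u n) \<le> K"
    using convergent_imp_Bseq[of u] u(3) by (auto simp: Bseq_def convergent_def)
  have aK: "a \<le> K" using LIMSEQ_le_const2[OF u(3)] K by (auto intro: order_trans[OF abs_ge_self])
  show "(\<lambda>n. LINT s:{0..u n}|lborel. f s) \<longlonglongrightarrow> (LINT s:{0..a}|lborel. f s)"
    unfolding set_lebesgue_integral_def
  proof (rule integral_dominated_convergence[where w = "\<lambda>s. norm (indicator {0..K} s *\<^sub>R f s)"])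
    have fm: "(\<lambda>s. indicator {0..b} s *\<^sub>R f s) \<in> borel_measurable lborel" if "0 \<le> b" for b
      using int[OF that] unfolding set_integrable_def by (rule borel_measurable_integrable)
    show "(\<lambda>s. indicator {0..a} s *\<^sub>R f s) \<in> borel_measurable lborel" using fm u(2) by simp
    show "(\<lambda>s. indicator {0..u n} s *\<^sub>R f s) \<in> borel_measurable lborel" for n using fm u(1) by simp
    show "integrable lborel (\<lambda>s. norm (indicator {0..K} s *\<^sub>R f s))"
      using int[of K] aK u(2) unfolding set_integrable_def by (intro integrable_norm) auto
    show "AE s in lborel. (\<lambda>n. indicator {0..u n} s *\<^sub>R f s) \<longlonglongrightarrow> indicator {0..a} s *\<^sub>R f s"
      using AE_lborel_singleton[of a]
    proof eventually_elim
      case (elim s)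
      have "eventually (\<lambda>n. indicator {0..u n} s = (indicator {0..a} s :: real)) sequentially"
      proof (cases "s < a")
        case True
        from order_tendstoD(1)[OF u(3) True] show ?thesis
          by (rule eventually_mono) (use True in \<open>auto simp: indicator_def\<close>)
      next
        case False
        then have "a < s" using elim by simp
        from order_tendstoD(2)[OF u(3) this] show ?thesis
          by (rule eventually_mono) (use \<open>a < s\<close> in \<open>auto simp: indicator_def\<close>)
      qed
      then show ?case by (intro tendsto_eventually) (auto elim: eventually_mono)
    qed
    show "AE s in lborel. norm (indicator {0..u n} s *\<^sub>R f s) \<le> norm (indicator {0..K} s *\<^sub>R f s)" for n
      using K[of n] by (intro AE_I2) (auto split: split_indicator)
  qed
qed

lemma set_integral_increment:
  fixes f :: "real \<Rightarrow> 'a::{banach,second_countable_topology}"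
  assumes "set_integrable lborel {0..t} f" "0 \<le> s" "s \<le> t"
  shows "(LINT r:{0..t}|lborel. f r) - (LINT r:{0..s}|lborel. f r) = (LINT r:{s<..t}|lborel. f r)"
proof -
  have "{0..t} = {0..s} \<union> {s<..t}" using assms by auto
  moreover have "set_integrable lborel {0..s} f" "set_integrable lborel {s<..t} f"
    by (rule set_integrable_subset[OF assms(1)]; use assms in auto)+
  moreover have "{0..s} \<inter> {s<..t} = {}" by auto
  ultimately have "(LINT r:{0..t}|lborel. f r) = (LINT r:{0..s}|lborel. f r) + (LINT r:{s<..t}|lborel. f r)"
    by (simp add: set_integral_Un)
  then show ?thesis by simp
qed

lemma set_integral_norm_le:
  fixes f :: "real \<Rightarrow> 'a::{banach,second_countable_topology}"
  assumes f: "set_integrable lborel {s<..t} f" and st: "s \<le> t" and B: "\<And>r. s < r \<Longrightarrow> r \<le> t \<Longrightarrow> norm (f r) \<le> B"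
  shows "norm (LINT r:{s<..t}|lborel. f r) \<le> (t - s) * B"
proof -
  have c: "set_integrable lborel {s<..t} (\<lambda>_. B)"
    using borel_integrable_atLeastAtMost'[of s t "\<lambda>_. B"] by (rule set_integrable_subset) auto
  have "norm (LINT r:{s<..t}|lborel. f r) \<le> (LINT r:{s<..t}|lborel. norm (f r))"
    by (rule set_integral_norm_bound[OF f])
  also have "\<dots> \<le> (LINT r:{s<..t}|lborel. B)"
    by (rule set_integral_mono[OF set_integrable_norm[OF f] c]) (use B in auto)
  also have "\<dots> = (t - s) * B"
    using st by (subst set_integral_const) auto
  finally show ?thesis .
qed

text \<open>Here \<open>d\<close> is the drift part and \<open>w\<close> the noise part of a step.
  Once the first-order and the quadratic noise terms are removed, each remaining term contains
  \<open>d\<close>: the first is compared with the drift integral, the other two are of higher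
  order.\<close>

lemma square_increment:
  fixes u v d w :: "'a::{real_inner,second_countable_topology}"
  assumes "v = u + (d + w)"
  shows "htensor v v - htensor u u - sym_tensor w u - htensor w w
    = sym_tensor u d + htensor d (v - u) + htensor w d"
  unfolding assms sym_tensor_def
  by (simp add: htensor.add_left htensor.add_right algebra_simps)

text \<open>A single sample path: \<open>y\<close> stands for \<open>Y\<close>, \<open>z\<close> for
  its noise part, and \<open>K\<close> will be the covariance operator. What is random about the
  quadratic variation enters later as a hypothesis on \<open>z\<close>.\<close>

locale ito_path =
  fixes A :: "'h::{real_inner,banach,second_countable_topology} \<Rightarrow>\<^sub>L 'h" and K :: "'h hs"
    and y z :: "real \<Rightarrow> 'h"
  assumes y_cont: "continuous_on {0..} y" and z_cont: "continuous_on {0..} z"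
    and y_eq: "\<And>t. 0 \<le> t \<Longrightarrow> y t = y 0 + (LINT s:{0..t}|lborel. A (y s)) + z t"
begin

definition drift :: "real \<Rightarrow> 'h hs" where
  "drift s = sym_tensor (y s) (A (y s)) + K"

lemma Ay_cont: "continuous_on {0..} (\<lambda>s. A (y s))"
  by (rule bounded_linear.continuous_on[OF blinfun.bounded_linear_right y_cont])

lemma drift_cont: "continuous_on {0..} drift"
  unfolding drift_def[abs_def]
  by (rule continuous_on_add[OF sym_tensor.continuous_on[OF y_cont Ay_cont] continuous_on_const])

lemma integrable_interval:
  fixes f :: "real \<Rightarrow> 'b::{banach,second_countable_topology}"
  assumes "continuous_on {0..} f" and "0 \<le> s"
  shows "set_integrable lborel {s..t} f" and "set_integrable lborel {s<..t} f"
proof -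
  show *: "set_integrable lborel {s..t} f"
    using assms by (intro borel_integrable_atLeastAtMost' continuous_on_subset[OF assms(1)]) auto
  show "set_integrable lborel {s<..t} f"
    using * by (rule set_integrable_subset) auto
qed

text \<open>The constant 4 is 2 + 1 + 1: freezing \<open>y\<close> at \<open>s\<close> in the drift
  integral costs twice \<open>e * norm A * R\<close> per unit of time because the tensor is
  symmetrised, and each of the two products of \<open>d\<close> with a small increment costs it
  once.\<close>

lemma square_step:
  assumes st: "0 \<le> s" "s \<le> t" and e: "\<And>r. s \<le> r \<Longrightarrow> r \<le> t \<Longrightarrow> norm (y r - y s) \<le> e" "norm (z t - z s) \<le> e"
    and R: "\<And>r. s \<le> r \<Longrightarrow> r \<le> t \<Longrightarrow> norm (y r) \<le> R"
  shows "norm (htensor (y t) (y t) - htensor (y s) (y s) - (LINT r:{s<..t}|lborel. drift r)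
      - sym_tensor (z t - z s) (y s) - (htensor (z t - z s) (z t - z s) - (t - s) *\<^sub>R K))
    \<le> (t - s) * (4 * norm A * R * e)"
proof -
  have t: "0 \<le> t" using st by simp
  have R0: "0 \<le> R" using R[of s] st norm_ge_zero[of "y s"] by linarith
  have e0: "0 \<le> e" using e(2) norm_ge_zero[of "z t - z s"] by linarith
  define d where "d = (LINT r:{s<..t}|lborel. A (y r))"
  define w where "w = z t - z s"
  have yt: "y t = y s + (d + w)"
    using y_eq[OF st(1)] y_eq[OF t] set_integral_increment[OF integrable_interval(1)[OF Ay_cont order_refl] st]
    by (simp add: d_def w_def algebra_simps)
  have AR: "norm (A (y r)) \<le> norm A * R" if "s \<le> r" "r \<le> t" for r
    using norm_blinfun[of A "y r"] mult_left_mono[OF R[OF that], of "norm A"] by simp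
  have d: "norm d \<le> (t - s) * (norm A * R)"
    unfolding d_def using st AR by (intro set_integral_norm_le integrable_interval Ay_cont) auto
  have i1: "set_integrable lborel {s<..t} (\<lambda>r. sym_tensor (y r) (A (y r)))"
    by (intro integrable_interval sym_tensor.continuous_on[OF y_cont Ay_cont] st)
  have i2: "set_integrable lborel {s<..t} (\<lambda>r. sym_tensor (y s) (A (y r)))"
    by (intro integrable_interval sym_tensor.continuous_on[OF continuous_on_const Ay_cont] st)
  have drift: "(LINT r:{s<..t}|lborel. drift r)
      = (LINT r:{s<..t}|lborel. sym_tensor (y r) (A (y r))) + (t - s) *\<^sub>R K"
    unfolding drift_def using st
    by (subst set_integral_add(2)[OF i1 integrable_interval(2)[OF continuous_on_const st(1)]])
       (simp add: set_integral_const)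
  have bl: "sym_tensor (y s) d = (LINT r:{s<..t}|lborel. sym_tensor (y s) (A (y r)))"
    unfolding d_def set_lebesgue_integral_def
    using integral_bounded_linear[OF sym_tensor.bounded_linear_right[of "y s"],
        OF integrable_interval(2)[OF Ay_cont st(1), of t, unfolded set_integrable_def]]
    by (simp add: sym_tensor.scaleR_right)
  have "sym_tensor (y s) d - (LINT r:{s<..t}|lborel. sym_tensor (y r) (A (y r)))
      = (LINT r:{s<..t}|lborel. sym_tensor (y s) (A (y r)) - sym_tensor (y r) (A (y r)))"
    unfolding bl by (rule set_integral_diff(2)[OF i2 i1, symmetric])
  also have "norm \<dots> \<le> (t - s) * (2 * e * (norm A * R))"
  proof (rule set_integral_norm_le[OF set_integral_diff(1)[OF i2 i1] st(2)])
    fix r assume r: "s < r" "r \<le> t"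
    have "norm (sym_tensor (y s - y r) (A (y r))) \<le> 2 * norm (y s - y r) * norm (A (y r))"
      by (rule norm_sym_tensor)
    also have "\<dots> \<le> 2 * e * (norm A * R)"
      using e(1)[of r] AR[of r] r e0 R0 by (intro mult_mono) (auto simp: norm_minus_commute)
    finally show "norm (sym_tensor (y s) (A (y r)) - sym_tensor (y r) (A (y r))) \<le> 2 * e * (norm A * R)"
      by (simp add: sym_tensor.diff_left)
  qed
  finally have 1: "norm (sym_tensor (y s) d - (LINT r:{s<..t}|lborel. sym_tensor (y r) (A (y r))))
      \<le> (t - s) * (2 * e * (norm A * R))" .
  have 2: "norm (htensor d (y t - y s)) \<le> (t - s) * (norm A * R) * e"
    unfolding norm_htensor using d e(1)[of t] st R0 by (intro mult_mono) auto
  have 3: "norm (htensor w d) \<le> e * ((t - s) * (norm A * R))"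
    unfolding norm_htensor w_def using d e(2) e0 by (intro mult_mono) auto
  have "htensor (y t) (y t) - htensor (y s) (y s) - (LINT r:{s<..t}|lborel. drift r)
      - sym_tensor w (y s) - (htensor w w - (t - s) *\<^sub>R K)
    = (sym_tensor (y s) d - (LINT r:{s<..t}|lborel. sym_tensor (y r) (A (y r)))) + htensor d (y t - y s) + htensor w d"
    using square_increment[OF yt] unfolding drift by (simp add: algebra_simps)
  also have "norm \<dots> \<le> (t - s) * (2 * e * (norm A * R)) + (t - s) * (norm A * R) * e + e * ((t - s) * (norm A * R))"
    by (intro norm_triangle_le add_mono 1 2 3)
  also have "\<dots> = (t - s) * (4 * norm A * R * e)" by (simp add: algebra_simps)
  finally show ?thesis unfolding w_def .
qed

lemma bounded_interval:
  fixes f :: "real \<Rightarrow> 'b::real_normed_vector"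
  assumes "continuous_on {0..} f"
  obtains R where "0 < R" "\<And>r. 0 \<le> r \<Longrightarrow> r \<le> t \<Longrightarrow> norm (f r) \<le> R"
proof -
  have "bounded (f ` {0..t})"
    by (intro compact_imp_bounded compact_continuous_image continuous_on_subset[OF assms]) auto
  then show ?thesis using that unfolding bounded_pos by auto
qed

lemma uniform_interval:
  fixes f :: "real \<Rightarrow> 'b::real_normed_vector"
  assumes "continuous_on {0..} f" and "0 < e"
  obtains \<delta> where "0 < \<delta>" "\<And>r s. 0 \<le> r \<Longrightarrow> r \<le> t \<Longrightarrow> 0 \<le> s \<Longrightarrow> s \<le> t \<Longrightarrow> \<bar>r - s\<bar> < \<delta> \<Longrightarrow> norm (f r - f s) \<le> e"
proof -
  have "uniformly_continuous_on {0..t} f"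
    by (intro compact_uniformly_continuous continuous_on_subset[OF assms(1)]) auto
  then obtain \<delta> where "0 < \<delta>" "\<forall>x\<in>{0..t}. \<forall>x'\<in>{0..t}. dist x' x < \<delta> \<longrightarrow> dist (f x') (f x) < e"
    unfolding uniformly_continuous_on_def using \<open>0 < e\<close> by blast
  then show ?thesis using that[of \<delta>] by (force simp: dist_norm)
qed

text \<open>The condition \<open>t \<le> real n\<close> ensures that the grid, which ends at time
  \<open>n\<close>, has passed \<open>t\<close>.\<close>

lemma dyadic_small:
  fixes t \<delta> :: real
  assumes "0 < \<delta>"
  shows "eventually (\<lambda>n. 1 / 2 ^ n < \<delta> \<and> t \<le> real n) sequentially"
proof -
  have "(\<lambda>n. (1 / 2 :: real) ^ n) \<longlonglongrightarrow> 0" by (rule LIMSEQ_realpow_zero) auto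
  from order_tendstoD(2)[OF this assms] have "eventually (\<lambda>n. 1 / 2 ^ n < \<delta>) sequentially"
    by (simp add: power_divide)
  moreover have "eventually (\<lambda>n. t \<le> real n) sequentially"
    using eventually_ge_at_top[of "nat \<lceil>t\<rceil>"] by (rule eventually_mono) linarith
  ultimately show ?thesis by eventually_elim simp
qed

lemma square_expansion:
  assumes t: "0 \<le> t"
  defines "\<sigma> \<equiv> \<lambda>n i. min t (real i / 2 ^ n)"
  defines "d \<equiv> \<lambda>n i. z (\<sigma> n (Suc i)) - z (\<sigma> n i)"
  shows "(\<lambda>n. htensor (y t) (y t) - htensor (y 0) (y 0) - (LINT r:{0..t}|lborel. drift r)
      - (\<Sum>i<n * 2 ^ n. sym_tensor (d n i) (y (\<sigma> n i)))
      - (\<Sum>i<n * 2 ^ n. htensor (d n i) (d n i) - (\<sigma> n (Suc i) - \<sigma> n i) *\<^sub>R K)) \<longlonglongrightarrow> 0" (is "?X \<longlonglongrightarrow> 0")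
proof (rule LIMSEQ_I)
  fix \<epsilon> :: real assume \<epsilon>: "0 < \<epsilon>"
  obtain R where R: "0 < R" "\<And>r. 0 \<le> r \<Longrightarrow> r \<le> t \<Longrightarrow> norm (y r) \<le> R"
    using bounded_interval[OF y_cont] by blast
  \<comment> \<open>The step errors add up to at most \<open>t * (4 * norm A * R * e)\<close>; the
    added ones avoid zero factors, and the 8 leaves \<open>\<epsilon> / 2\<close>.\<close>
  define e where "e = \<epsilon> / (8 * (norm A + 1) * R * (t + 1))"
  have "0 < norm A + 1" by (simp add: add_nonneg_pos)
  then have D: "0 < 8 * (norm A + 1) * R * (t + 1)" using R(1) t by (intro mult_pos_pos) auto
  then have e: "0 < e" using \<epsilon> by (simp only: e_def divide_pos_pos)
  have De: "8 * (norm A + 1) * R * (t + 1) * e = \<epsilon>"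
    using D unfolding e_def by (simp only: times_divide_eq_right nonzero_mult_div_cancel_left[OF less_imp_neq[OF D, symmetric]])
  obtain \<delta>1 where \<delta>1: "0 < \<delta>1"
    "\<And>r s. 0 \<le> r \<Longrightarrow> r \<le> t \<Longrightarrow> 0 \<le> s \<Longrightarrow> s \<le> t \<Longrightarrow> \<bar>r - s\<bar> < \<delta>1 \<Longrightarrow> norm (y r - y s) \<le> e"
    using uniform_interval[OF y_cont e] by blast
  obtain \<delta>2 where \<delta>2: "0 < \<delta>2"
    "\<And>r s. 0 \<le> r \<Longrightarrow> r \<le> t \<Longrightarrow> 0 \<le> s \<Longrightarrow> s \<le> t \<Longrightarrow> \<bar>r - s\<bar> < \<delta>2 \<Longrightarrow> norm (z r - z s) \<le> e"
    using uniform_interval[OF z_cont e] by blast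
  have "eventually (\<lambda>n. 1 / 2 ^ n < min \<delta>1 \<delta>2 \<and> t \<le> real n) sequentially"
    using \<delta>1(1) \<delta>2(1) by (intro dyadic_small) auto
  then obtain n0 where n0: "\<And>n. n \<ge> n0 \<Longrightarrow> 1 / 2 ^ n < min \<delta>1 \<delta>2 \<and> t \<le> real n"
    by (auto simp: eventually_sequentially)
  have "norm (?X n) < \<epsilon>" if n: "n \<ge> n0" for n
  proof -
    have \<sigma>: "0 \<le> \<sigma> n i" "\<sigma> n i \<le> \<sigma> n (Suc i)" "\<sigma> n i \<le> t" "\<sigma> n (Suc i) - \<sigma> n i \<le> 1 / 2 ^ n" for i
      using t by (auto simp: \<sigma>_def min_def field_simps)
    have ends: "\<sigma> n 0 = 0" "\<sigma> n (n * 2 ^ n) = t" using n0[OF n] t by (auto simp: \<sigma>_def min_def)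
    let ?V = "\<lambda>i. htensor (y (\<sigma> n i)) (y (\<sigma> n i))"
    let ?I = "\<lambda>i. LINT r:{0..\<sigma> n i}|lborel. drift r"
    let ?T = "\<lambda>i. ?V (Suc i) - ?V i - (?I (Suc i) - ?I i) - sym_tensor (d n i) (y (\<sigma> n i))
      - (htensor (d n i) (d n i) - (\<sigma> n (Suc i) - \<sigma> n i) *\<^sub>R K)"
    have I: "?I (Suc i) - ?I i = (LINT r:{\<sigma> n i<..\<sigma> n (Suc i)}|lborel. drift r)" for i
      by (intro set_integral_increment integrable_interval drift_cont \<sigma>) simp
    have T: "norm (?T i) \<le> (\<sigma> n (Suc i) - \<sigma> n i) * (4 * norm A * R * e)" for i
      unfolding I d_def
    proof (rule square_step[OF \<sigma>(1,2)])
      have le: "\<sigma> n (Suc i) \<le> t" using \<sigma>(3) .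
      show "norm (y r - y (\<sigma> n i)) \<le> e" if "\<sigma> n i \<le> r" "r \<le> \<sigma> n (Suc i)" for r
        using that \<sigma>(1,3,4)[of i] le n0[OF n] by (intro \<delta>1(2)) auto
      show "norm (z (\<sigma> n (Suc i)) - z (\<sigma> n i)) \<le> e"
        using \<sigma>(1,2,3,4)[of i] \<sigma>(1)[of "Suc i"] le n0[OF n] by (intro \<delta>2(2)) auto
      show "norm (y r) \<le> R" if "\<sigma> n i \<le> r" "r \<le> \<sigma> n (Suc i)" for r
        using that \<sigma>(1)[of i] le by (intro R) auto
    qed
    have I0: "?I 0 = 0"
    proof -
      have "AE r in lborel. indicator {0..0} r *\<^sub>R drift r = 0"
        using AE_lborel_singleton[of "0::real"] by eventually_elim (simp add: indicator_def)
      then have "(LINT r:{0..0}|lborel. drift r) = 0"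
        unfolding set_lebesgue_integral_def by (rule integral_eq_zero_AE)
      then show ?thesis by (simp add: ends)
    qed
    have "(\<Sum>i<n * 2 ^ n. ?T i) = (\<Sum>i<n * 2 ^ n. ?V (Suc i) - ?V i) - (\<Sum>i<n * 2 ^ n. ?I (Suc i) - ?I i)
        - (\<Sum>i<n * 2 ^ n. sym_tensor (d n i) (y (\<sigma> n i)))
        - (\<Sum>i<n * 2 ^ n. htensor (d n i) (d n i) - (\<sigma> n (Suc i) - \<sigma> n i) *\<^sub>R K)"
      by (simp only: sum_subtractf)
    also have "\<dots> = ?X n"
      by (simp only: sum_lessThan_telescope[of ?V] sum_lessThan_telescope[of ?I] I0) (simp only: ends diff_0_right)
    finally have "?X n = (\<Sum>i<n * 2 ^ n. ?T i)" by (rule sym)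
    then have "norm (?X n) \<le> (\<Sum>i<n * 2 ^ n. (\<sigma> n (Suc i) - \<sigma> n i) * (4 * norm A * R * e))"
      using T by (auto intro!: sum_norm_le)
    also have "\<dots> = t * (4 * norm A * R * e)"
      by (simp only: sum_distrib_right[symmetric] sum_lessThan_telescope ends) simp
    also have "\<dots> \<le> (t + 1) * (4 * (norm A + 1) * R * e)"
      using t R(1) e by (intro mult_mono) auto
    also have "\<dots> = 8 * (norm A + 1) * R * (t + 1) * e / 2" by (simp add: algebra_simps)
    also have "\<dots> = \<epsilon> / 2"
      using De by simp
    also have "\<dots> < \<epsilon>" using \<epsilon> by simp
    finally show ?thesis .
  qed
  then show "\<exists>no. \<forall>n\<ge>no. norm (?X n - 0) < \<epsilon>" by auto
qed

text \<open>The increments of \<open>z\<close> are bounded only individually, by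
  \<open>2 * Z\<close>, so the tolerance has to beat the number of cells: \<open>n * 2 ^ n\<close>
  terms of size \<open>4 * Z / ((n + 1)\<^sup>2 * 2 ^ n)\<close> sum to at most
  \<open>4 * Z / (n + 1)\<close>.\<close>

lemma sum_approx_limit:
  fixes v :: "nat \<Rightarrow> nat \<Rightarrow> 'h"
  assumes t: "0 \<le> t"
    and v: "eventually (\<lambda>n. \<forall>i<n * 2 ^ n. norm (v n i - y (real i / 2 ^ n)) \<le> 1 / ((real n + 1) * 2 ^ n) / (real n + 1)) sequentially"
  defines "\<sigma> \<equiv> \<lambda>n i. min t (real i / 2 ^ n)"
  defines "d \<equiv> \<lambda>n i. z (\<sigma> n (Suc i)) - z (\<sigma> n i)"
  assumes QV: "(\<lambda>n. \<Sum>i<n * 2 ^ n. htensor (d n i) (d n i) - (\<sigma> n (Suc i) - \<sigma> n i) *\<^sub>R K) \<longlonglongrightarrow> 0"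
  shows "(\<lambda>n. \<Sum>i<n * 2 ^ n. sym_tensor (d n i) (v n i))
    \<longlonglongrightarrow> htensor (y t) (y t) - htensor (y 0) (y 0) - (LINT r:{0..t}|lborel. drift r)"
proof -
  let ?L = "htensor (y t) (y t) - htensor (y 0) (y 0) - (LINT r:{0..t}|lborel. drift r)"
  let ?Q = "\<lambda>n. \<Sum>i<n * 2 ^ n. htensor (d n i) (d n i) - (\<sigma> n (Suc i) - \<sigma> n i) *\<^sub>R K"
  let ?S = "\<lambda>n. \<Sum>i<n * 2 ^ n. sym_tensor (d n i) (y (\<sigma> n i))"
  let ?S' = "\<lambda>n. \<Sum>i<n * 2 ^ n. sym_tensor (d n i) (v n i)"
  obtain Z where Z: "0 < Z" "\<And>r. 0 \<le> r \<Longrightarrow> r \<le> t \<Longrightarrow> norm (z r) \<le> Z"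
    using bounded_interval[OF z_cont] by blast
  have D: "(\<lambda>n. ?S' n - ?S n) \<longlonglongrightarrow> 0"
  proof (rule Lim_null_comparison)
    show "(\<lambda>n. (4 * Z) * (1 / real (Suc n))) \<longlonglongrightarrow> 0"
      using tendsto_mult[OF tendsto_const LIMSEQ_Suc[OF lim_1_over_n], of "4 * Z"] by simp
    show "eventually (\<lambda>n. norm (?S' n - ?S n) \<le> (4 * Z) * (1 / real (Suc n))) sequentially"
      using v
    proof eventually_elim
      case (elim n)
      let ?\<delta> = "1 / ((real n + 1) * 2 ^ n) / (real n + 1)"
      have "norm (?S' n - ?S n) = norm (\<Sum>i<n * 2 ^ n. sym_tensor (d n i) (v n i - y (\<sigma> n i)))"
        by (simp add: sum_subtractf[symmetric] sym_tensor.diff_right)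
      also have "\<dots> \<le> (\<Sum>i<n * 2 ^ n. 4 * Z * ?\<delta>)"
      proof (rule sum_norm_le)
        fix i assume i: "i \<in> {..<n * 2 ^ n}"
        show "norm (sym_tensor (d n i) (v n i - y (\<sigma> n i))) \<le> 4 * Z * ?\<delta>"
        proof (cases "real i / 2 ^ n \<le> t")
          case True
          then have \<sigma>: "\<sigma> n i = real i / 2 ^ n" by (simp add: \<sigma>_def)
          have "norm (d n i) \<le> norm (z (\<sigma> n (Suc i))) + norm (z (\<sigma> n i))"
            unfolding d_def by (rule norm_triangle_ineq4)
          also have "\<dots> \<le> Z + Z" using t by (intro add_mono Z) (auto simp: \<sigma>_def)
          finally have "norm (d n i) \<le> 2 * Z" by simp
          have "norm (sym_tensor (d n i) (v n i - y (\<sigma> n i))) \<le> 2 * norm (d n i) * norm (v n i - y (\<sigma> n i))"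
            by (rule norm_sym_tensor)
          also have "\<dots> \<le> 2 * (2 * Z) * ?\<delta>"
            using \<open>norm (d n i) \<le> 2 * Z\<close> elim i Z(1) unfolding \<sigma> by (intro mult_mono) auto
          finally show ?thesis by simp
        next
          \<comment> \<open>Past \<open>t\<close> the vector \<open>v n i\<close> follows
            \<open>y\<close> at a later time than \<open>\<sigma> n i\<close>, but the clipped
            increment of \<open>z\<close> is zero there.\<close>
          case False
          then have "\<sigma> n i = t" "\<sigma> n (Suc i) = t"
            by (auto simp: \<sigma>_def min_def field_simps)
          then have "d n i = 0" by (simp add: d_def)
          then show ?thesis using Z(1) by (simp add: sym_tensor.zero_left)
        qed
      qed
      also have "\<dots> = 4 * Z * (real (n * 2 ^ n) * ?\<delta>)" by simp
      also have "real (n * 2 ^ n) * ?\<delta> = (real n / (real n + 1)) * (1 / (real n + 1))" by simp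
      also have "\<dots> \<le> 1 * (1 / (real n + 1))" by (intro mult_right_mono) auto
      finally show ?case using Z(1) by (simp add: mult_left_mono add.commute)
    qed
  qed
  have X: "(\<lambda>n. ?L - ?S n - ?Q n) \<longlonglongrightarrow> 0"
    unfolding d_def \<sigma>_def by (rule square_expansion[OF t])
  have "(\<lambda>n. (?S' n - ?S n) - (?L - ?S n - ?Q n) - ?Q n + ?L) \<longlonglongrightarrow> 0 - 0 - 0 + ?L"
    by (intro tendsto_add tendsto_diff D X QV tendsto_const)
  moreover have "(u - w) - (l - w - q) - q + l = u" for u w l q :: "'h hs"
    by simp
  ultimately show ?thesis by (simp only:) simp
qed

text \<open>Quadratic growth is all that is used of \<open>G\<close>, which will be the covariance
  norm of the diffusion coefficient. Mesh and tolerance each contribute an error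
  \<open>e\<close>.\<close>

lemma step_approx_integral:
  fixes v :: "nat \<Rightarrow> nat \<Rightarrow> 'h" and G :: "'h \<Rightarrow> ennreal"
  assumes t: "0 \<le> t"
    and v: "eventually (\<lambda>n. \<forall>i<n * 2 ^ n. norm (v n i - y (real i / 2 ^ n)) \<le> 1 / ((real n + 1) * 2 ^ n) / (real n + 1)) sequentially"
    and G: "\<And>x. G x \<le> ennreal (C * (norm x)\<^sup>2)" and C: "0 \<le> C"
  shows "(\<lambda>n. \<integral>\<^sup>+s\<in>{0..t}. G (y s - (\<Sum>i<n * 2 ^ n. indicator {real i / 2 ^ n<..real (Suc i) / 2 ^ n} s *\<^sub>R v n i)) \<partial>lborel)
    \<longlonglongrightarrow> 0" (is "?X \<longlonglongrightarrow> 0")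
proof (rule order_tendstoI)
  fix a :: ennreal assume "0 < a"
  then obtain b where b: "0 < b" "b < a" using dense by blast
  then obtain b' where "b = ennreal b'" "0 \<le> b'" by (cases b) auto
  then have b': "0 < b'" "ennreal b' < a" using b by auto
  \<comment> \<open>Makes \<open>4 * (t + 1) * (C + 1) * e\<^sup>2\<close> equal to
    \<open>b'\<close>; this dominates the integral over \<open>[0, t]\<close> of
    \<open>C * (2 * e)\<^sup>2\<close>.\<close>
  define e where "e = sqrt (b' / (4 * (t + 1) * (C + 1)))"
  have e: "0 < e" using b' t C by (simp add: e_def)
  have e2: "4 * (t + 1) * (C + 1) * e\<^sup>2 = b'" using b' t C by (simp add: e_def)
  obtain \<delta> where \<delta>: "0 < \<delta>"
    "\<And>r s. 0 \<le> r \<Longrightarrow> r \<le> t + 1 \<Longrightarrow> 0 \<le> s \<Longrightarrow> s \<le> t + 1 \<Longrightarrow> \<bar>r - s\<bar> < \<delta> \<Longrightarrow> norm (y r - y s) \<le> e"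
    using uniform_interval[OF y_cont e] by blast
  have "eventually (\<lambda>n. 1 / 2 ^ n < min \<delta> e \<and> t \<le> real n) sequentially"
    using \<delta>(1) e by (intro dyadic_small) auto
  then show "eventually (\<lambda>n. ?X n < a) sequentially"
    using v
  proof eventually_elim
    case (elim n)
    let ?\<tau> = "\<lambda>i. real i / 2 ^ n"
    have "1 / ((real n + 1) * 2 ^ n) / (real n + 1) = (1 / 2 ^ n) * (1 / ((real n + 1) * (real n + 1)))" by simp
    also have "\<dots> \<le> (1 / 2 ^ n) * 1" by (intro mult_left_mono) (auto intro!: mult_ge1_I simp: divide_le_eq)
    also have "\<dots> \<le> e" using elim by simp
    finally have \<delta>n: "1 / ((real n + 1) * 2 ^ n) / (real n + 1) \<le> e" .
    have pt: "G (y s - (\<Sum>i<n * 2 ^ n. indicator {?\<tau> i<..?\<tau> (Suc i)} s *\<^sub>R v n i)) \<le> ennreal (C * (2 * e)\<^sup>2)"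
      if s: "0 < s" "s \<le> t" for s
    proof -
      have "s \<le> ?\<tau> (n * 2 ^ n)" using s elim by simp
      then obtain k where k: "k < n * 2 ^ n" "?\<tau> k < s" "s \<le> ?\<tau> (Suc k)"
        using step_find[of ?\<tau> s "n * 2 ^ n"] s by auto
      have "(\<Sum>i<n * 2 ^ n. indicator {?\<tau> i<..?\<tau> (Suc i)} s *\<^sub>R v n i) = v n k"
        by (rule step_sum_eq[of "n * 2 ^ n" ?\<tau> k]) (use k in \<open>auto intro: divide_right_mono\<close>)
      moreover have "norm (y s - v n k) \<le> 2 * e"
      proof -
        have "?\<tau> (Suc k) - ?\<tau> k = 1 / 2 ^ n" by (simp add: field_simps)
        then have "\<bar>s - ?\<tau> k\<bar> < \<delta>" using k elim by linarith
        then have "norm (y s - y (?\<tau> k)) \<le> e" using k s by (intro \<delta>(2)) auto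
        moreover have "norm (y (?\<tau> k) - v n k) \<le> e"
          using elim k \<delta>n by (force simp: norm_minus_commute)
        ultimately show ?thesis using norm_triangle_ineq[of "y s - y (?\<tau> k)" "y (?\<tau> k) - v n k"] by simp
      qed
      then have "C * (norm (y s - v n k))\<^sup>2 \<le> C * (2 * e)\<^sup>2"
        using C by (intro mult_left_mono power_mono) auto
      ultimately show ?thesis using G[of "y s - v n k"] by (simp add: order_trans ennreal_leI)
    qed
    have "?X n \<le> (\<integral>\<^sup>+s. ennreal (C * (2 * e)\<^sup>2) * indicator {0..t} s \<partial>lborel)"
    \<comment> \<open>The half-open cells leave out \<open>s = 0\<close>, where the step function is
      0 instead of close to \<open>y\<close>.\<close>
    proof (rule nn_integral_mono_AE)
      show "AE s in lborel. G (y s - (\<Sum>i<n * 2 ^ n. indicator {?\<tau> i<..?\<tau> (Suc i)} s *\<^sub>R v n i)) * indicator {0..t} s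
          \<le> ennreal (C * (2 * e)\<^sup>2) * indicator {0..t} s"
        using AE_lborel_singleton[of "0::real"]
        by eventually_elim (use pt in \<open>auto split: split_indicator\<close>)
    qed
    also have "\<dots> = ennreal (C * (2 * e)\<^sup>2 * t)"
      using t C by (subst nn_integral_cmult_indicator) (auto simp: ennreal_mult)
    also have "C * (2 * e)\<^sup>2 * t \<le> 4 * (t + 1) * (C + 1) * e\<^sup>2"
    proof -
      have "C * t \<le> (C + 1) * (t + 1)" using C t by (intro mult_mono) auto
      from mult_right_mono[OF this, of "4 * e\<^sup>2"] show ?thesis by (simp add: power2_eq_square algebra_simps)
    qed
    finally have "?X n \<le> ennreal b'" unfolding e2 by (simp add: ennreal_leI)
    then show ?case using b'(2) by (rule order_le_less_trans)
  qed
qed simp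

end

subsection \<open>The variance process\<close>

lemma hs_of_variance_process: "hs_of (variance_process Y t \<omega>) = htensor (Y t \<omega>) (Y t \<omega>)"
  by (simp add: variance_process_def htensor_def)

lemma hs_op_sym_tensor: "hs_op (sym_tensor f g) = tensor f g + tensor g f"
  by (simp add: sym_tensor_def plus_hs.rep_eq)

text \<open>The normalisation of \<open>\<eta> f\<close> cancels against its norm, and taking the
  adjoint swaps the tensor factors. What remains is linear in \<open>f\<close>, and the case
  \<open>\<eta> f = 0\<close> fits in.\<close>

lemma hs_of_variance_diffusion:
  "hs_of (variance_diffusion \<eta> Y t \<omega> f) = sym_tensor (\<eta> f) (Y t \<omega>)"
proof -
  have "variance_diffusion \<eta> Y t \<omega> f = hs_op (sym_tensor (\<eta> f) (Y t \<omega>))"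
    by (rule blinfun_eqI)
       (auto simp: variance_diffusion_def Gamma_process_def adj_tensor hs_op_sym_tensor sym_tensor.zero_left
         zero_hs.rep_eq plus_blinfun.rep_eq scaleR_blinfun.rep_eq scaleR_right_distrib
         inverse_eq_divide)
  then show ?thesis by (simp add: hs_op_inverse)
qed

text \<open>Multiplying out leaves \<open>A V + V adj A\<close> for the square \<open>V\<close>.
  Composing a rank one operator with \<open>A\<close> on the left or \<open>adj A\<close> on the
  right applies \<open>A\<close> to one of its two vectors, which gives the symmetric
  tensor.\<close>

lemma variance_drift_eq:
  fixes Q \<eta> A :: "'h::{real_inner,banach,second_countable_topology} \<Rightarrow>\<^sub>L 'h"
  assumes Q: "trace_class Q"
  shows "variance_drift A \<eta> Q Y t \<omega>
    = hs_op (sym_tensor (Y t \<omega>) (A (Y t \<omega>)) + hs_of (\<eta> o\<^sub>L Q o\<^sub>L adj \<eta>))"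
proof -
  have "hs_op (sym_tensor (Y t \<omega>) (A (Y t \<omega>)) + hs_of (\<eta> o\<^sub>L Q o\<^sub>L adj \<eta>))
      = tensor (Y t \<omega>) (A (Y t \<omega>)) + tensor (A (Y t \<omega>)) (Y t \<omega>) + (\<eta> o\<^sub>L Q o\<^sub>L adj \<eta>)"
    by (simp add: plus_hs.rep_eq hs_op_sym_tensor hs_op_of hilbert_schmidt_covariance Q)
  moreover have "variance_drift A \<eta> Q Y t \<omega> x = (tensor (Y t \<omega>) (A (Y t \<omega>)) + tensor (A (Y t \<omega>)) (Y t \<omega>)
      + (\<eta> o\<^sub>L Q o\<^sub>L adj \<eta>)) x" for x
    by (simp add: variance_drift_def variance_process_def plus_blinfun.rep_eq minus_blinfun.rep_eq
        blinfun.scaleR_right blinfun.diff_right inner_diff_right adj_inner scaleR_diff_left scaleR_diff_right algebra_simps)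
  ultimately show ?thesis by (auto intro: blinfun_eqI)
qed

section \<open>The diffusion coefficient as a function of the state\<close>

context
  fixes \<eta> :: "'h::{real_inner,banach,second_countable_topology} \<Rightarrow>\<^sub>L 'h"
begin

text \<open>The state is frozen at \<open>u\<close> and the result packed as a bounded operator, the
  type of values of elementary integrands. Linearity in \<open>u\<close> carries step approximations
  of \<open>Y\<close> over to the integrand.\<close>

lift_definition diffusion :: "'h \<Rightarrow> ('h \<Rightarrow>\<^sub>L 'h hs)" is "\<lambda>u f. sym_tensor (\<eta> f) u"
  by (rule bounded_linear_compose[OF sym_tensor.bounded_linear_left blinfun.bounded_linear_right])

lemma norm_diffusion: "norm (diffusion u f) \<le> 2 * norm \<eta> * norm u * norm f"
proof -
  have "norm (diffusion u f) \<le> 2 * norm (\<eta> f) * norm u"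
    unfolding diffusion.rep_eq by (rule norm_sym_tensor)
  also have "\<dots> \<le> 2 * (norm \<eta> * norm f) * norm u"
    by (intro mult_right_mono mult_left_mono norm_blinfun) auto
  finally show ?thesis by (simp add: ac_simps)
qed

text \<open>Makes each term of the covariance norm continuous in \<open>u\<close>, hence the whole
  sum Borel.\<close>

lemma adj_diffusion_linear: "bounded_linear (\<lambda>u. adj (diffusion u) f)"
proof (rule bounded_linear_intro[where K = "2 * norm \<eta> * norm f"])
  have eqI: "a = b" if "\<And>x. x \<bullet> a = x \<bullet> b" for a b :: 'h
    using that by (subst vector_eq_ldot[symmetric]) blast
  show "adj (diffusion (u + v)) f = adj (diffusion u) f + adj (diffusion v) f" for u v
    by (rule eqI) (simp add: inner_add_right diffusion.rep_eq sym_tensor.add_right inner_add_left flip: adj_inner)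
  show "adj (diffusion (r *\<^sub>R u)) f = r *\<^sub>R adj (diffusion u) f" for r u
    by (rule eqI) (simp add: diffusion.rep_eq sym_tensor.scaleR_right flip: adj_inner)
  show "norm (adj (diffusion u) f) \<le> norm u * (2 * norm \<eta> * norm f)" for u
  proof (cases "adj (diffusion u) f = 0")
    case False
    let ?a = "adj (diffusion u) f"
    have "(norm ?a)\<^sup>2 = diffusion u ?a \<bullet> f" by (simp add: adj_inner power2_norm_eq_inner)
    also have "\<dots> \<le> norm (diffusion u ?a) * norm f" by (rule norm_cauchy_schwarz)
    also have "\<dots> \<le> (2 * norm \<eta> * norm u * norm ?a) * norm f"
      by (intro mult_right_mono norm_diffusion) auto
    finally show ?thesis using False by (simp add: power2_eq_square algebra_simps)
  qed simp
qed

lemma cov_norm_sq_diffusion_measurable: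
  "(\<lambda>u. cov_norm_sq Q (diffusion u)) \<in> borel_measurable borel"
proof -
  have m: "(\<lambda>u. Q (adj (diffusion u) f) \<bullet> adj (diffusion u) f) \<in> borel_measurable borel" for f
    by (intro borel_measurable_continuous_onI continuous_on_inner
        linear_continuous_on adj_diffusion_linear
        linear_continuous_on[OF bounded_linear_compose[OF blinfun.bounded_linear_right adj_diffusion_linear]])
  then show ?thesis
    unfolding cov_norm_sq_def adj.rep_eq[symmetric]
    by (intro borel_measurable_infsum_ennreal countable_onb measurable_compose[OF m measurable_ennreal])
qed

lemma cov_norm_sq_diffusion_le:
  assumes "nuclear_bound Q c"
  shows "cov_norm_sq Q (diffusion u) \<le> ennreal (4 * (norm \<eta>)\<^sup>2 * c * (norm u)\<^sup>2)"
  using cov_norm_sq_le[OF assms blinfun.bounded_linear_right norm_diffusion[of u]]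
  by (simp add: power2_eq_square ac_simps)

end

section \<open>Sample paths of \<open>Y\<close> and the candidate for the integral\<close>

locale ornstein_uhlenbeck = wiener M F Q W
  for M :: "'w measure" and F :: "real \<Rightarrow> 'w measure"
    and Q :: "'h::{real_inner,banach,second_countable_topology} \<Rightarrow>\<^sub>L 'h" and W :: "real \<Rightarrow> 'w \<Rightarrow> 'h" +
  fixes A \<eta> :: "'h \<Rightarrow>\<^sub>L 'h" and Y J :: "real \<Rightarrow> 'w \<Rightarrow> 'h"
  assumes Y_predictable: "predictable M F Y"
    and J: "stochastic_integral M F Q W (\<lambda>t \<omega>. blinfun_apply \<eta>) J"
    and Y_eq: "AE \<omega> in M. \<forall>t\<ge>0. set_integrable lborel {0..t} (\<lambda>s. A (Y s \<omega>)) \<and>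
      Y t \<omega> = Y 0 \<omega> + (LINT s:{0..t}|lborel. A (Y s \<omega>)) + J t \<omega>"
begin

lemma Y_measurable_F: "0 \<le> t \<Longrightarrow> Y t \<in> borel_measurable (F t)"
  by (rule predictable_measurable[OF filtered Y_predictable])

lemma Y_measurable: "0 \<le> t \<Longrightarrow> Y t \<in> borel_measurable M"
  using measurable_F_M[OF _ Y_measurable_F] .

text \<open>For each fixed time the identity holds outside a null set; the nonnegative rationals
  share one, and continuity of both sides covers the other times.\<close>

lemma J_eq_AE: "AE \<omega> in M. \<forall>t\<ge>0. J t \<omega> = \<eta> (incr 0 t \<omega>)"
proof -
  have "AE \<omega> in M. \<forall>a b. J (real a / real (Suc b)) \<omega> = \<eta> (incr 0 (real a / real (Suc b)) \<omega>)"
    unfolding AE_all_countable by (intro allI stochastic_integral_const[OF J]) simp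
  moreover have "AE \<omega> in M. continuous_on {0..} (\<lambda>t. J t \<omega>)"
    using J by (simp add: stochastic_integral_def)
  moreover have "AE \<omega> in M. continuous_on {0..} (\<lambda>t. W t \<omega>)"
    using wiener by (simp add: wiener_process_def)
  ultimately show ?thesis
  proof eventually_elim
    case (elim \<omega>)
    have c: "continuous_on {0..} (\<lambda>t. \<eta> (incr 0 t \<omega>))"
      unfolding incr_def
      by (rule bounded_linear.continuous_on[OF blinfun.bounded_linear_right])
         (rule continuous_on_diff[OF elim(3) continuous_on_const])
    show ?case
    proof (intro allI impI)
      fix t :: real assume t: "0 \<le> t"
      define q where "q n = real (nat \<lfloor>t * real (Suc n)\<rfloor>) / real (Suc n)" for n
      have q0: "q n \<in> {0..}" for n by (simp add: q_def)
      have "q \<longlonglongrightarrow> t"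
      proof (rule LIM_zero_cancel, rule Lim_null_comparison[OF _ LIMSEQ_Suc[OF lim_1_over_n]])
        have "norm (q n - t) \<le> 1 / real (Suc n)" for n
        proof -
          have "0 \<le> \<lfloor>t * real (Suc n)\<rfloor>" using t by simp
          then have "q n - t = (of_int \<lfloor>t * real (Suc n)\<rfloor> - t * real (Suc n)) / real (Suc n)"
            by (simp add: q_def field_simps del: of_nat_Suc)
          then have "norm (q n - t) = \<bar>of_int \<lfloor>t * real (Suc n)\<rfloor> - t * real (Suc n)\<bar> / real (Suc n)"
            by (simp del: of_nat_Suc)
          also have "\<dots> \<le> 1 / real (Suc n)"
            by (intro divide_right_mono) linarith+
          finally show ?thesis .
        qed
        then show "eventually (\<lambda>n. norm (q n - t) \<le> 1 / real (Suc n)) sequentially" by simp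
      qed
      note q = this
      have "(\<lambda>n. J (q n) \<omega>) \<longlonglongrightarrow> J t \<omega>"
        by (rule continuous_on_tendsto_compose[OF elim(2) q]) (use q0 t in auto)
      moreover have "(\<lambda>n. \<eta> (incr 0 (q n) \<omega>)) \<longlonglongrightarrow> \<eta> (incr 0 t \<omega>)"
        by (rule continuous_on_tendsto_compose[OF c q]) (use q0 t in auto)
      moreover have "(\<lambda>n. J (q n) \<omega>) = (\<lambda>n. \<eta> (incr 0 (q n) \<omega>))" unfolding q_def using elim(1) by blast
      ultimately show "J t \<omega> = \<eta> (incr 0 t \<omega>)" by (simp only:) (rule LIMSEQ_unique)
    qed
  qed
qed

text \<open>\<open>Y\<close> is only assumed predictable; its equation exhibits almost every path as
  a sum of continuous functions.\<close>

lemma path_AE: "AE \<omega> in M. ito_path A (\<lambda>t. Y t \<omega>) (\<lambda>t. J t \<omega>)"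
proof -
  have "AE \<omega> in M. continuous_on {0..} (\<lambda>t. J t \<omega>)"
    using J by (simp add: stochastic_integral_def)
  with Y_eq show ?thesis
  proof eventually_elim
    case (elim \<omega>)
    have si: "set_integrable lborel {0..t} (\<lambda>s. A (Y s \<omega>))"
      and eq: "Y t \<omega> = Y 0 \<omega> + (LINT s:{0..t}|lborel. A (Y s \<omega>)) + J t \<omega>" if "0 \<le> t" for t
      using elim(1) that by blast+
    have "continuous_on {0..} (\<lambda>t. Y 0 \<omega> + (LINT s:{0..t}|lborel. A (Y s \<omega>)) + J t \<omega>)"
      by (intro continuous_on_add continuous_on_const set_integral_continuous si elim(2))
    then have "continuous_on {0..} (\<lambda>t. Y t \<omega>)"
      by (rule continuous_on_eq) (rule eq[symmetric], simp)
    then show ?case by (rule ito_path.intro[OF _ elim(2) eq])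
  qed
qed

definition V_drift :: "real \<Rightarrow> 'w \<Rightarrow> 'h hs" where
  "V_drift t \<omega> = sym_tensor (Y t \<omega>) (A (Y t \<omega>)) + cov_hs \<eta>"

lemma V_drift_path: "ito_path A (\<lambda>t. Y t \<omega>) (\<lambda>t. J t \<omega>) \<Longrightarrow>
  ito_path.drift A (cov_hs \<eta>) (\<lambda>t. Y t \<omega>) = (\<lambda>t. V_drift t \<omega>)"
  by (simp add: ito_path.drift_def V_drift_def fun_eq_iff)

lemma V_predictable: "predictable M F (\<lambda>t \<omega>. htensor (Y t \<omega>) (Y t \<omega>))"
  by (rule predictable_compose[OF Y_predictable])
     (intro borel_measurable_continuous_onI htensor.continuous_on continuous_on_id)

lemma V_drift_predictable: "predictable M F V_drift"
  unfolding V_drift_def[abs_def]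
  by (rule predictable_compose[OF Y_predictable])
     (intro borel_measurable_continuous_onI continuous_on_add continuous_on_const sym_tensor.continuous_on
       continuous_on_id linear_continuous_on blinfun.bounded_linear_right)

text \<open>What the claimed equation leaves for the stochastic integral; it remains to recognise it
  as one.\<close>

definition I :: "real \<Rightarrow> 'w \<Rightarrow> 'h hs" where
  "I t \<omega> = htensor (Y t \<omega>) (Y t \<omega>) - htensor (Y 0 \<omega>) (Y 0 \<omega>) - (LINT s:{0..t}|lborel. V_drift s \<omega>)"

lemma I_measurable: "0 \<le> t \<Longrightarrow> I t \<in> borel_measurable (F t)"
  unfolding I_def[abs_def]
  using measurable_F_mono[OF order_refl _ predictable_measurable[OF filtered V_predictable order_refl], of t]
    predictable_measurable[OF filtered V_predictable, of t]
    predictable_integral_measurable[OF filtered V_drift_predictable, of t]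
  by (intro borel_measurable_diff) auto

text \<open>Chosen so that \<open>n * 2 ^ n * \<delta> n\<close> is at most
  \<open>1 / (n + 1)\<close>, as \<open>sum_approx_limit\<close> requires.\<close>

definition \<delta> :: "nat \<Rightarrow> real" where
  "\<delta> n = 1 / ((real n + 1) * 2 ^ n) / (real n + 1)"

definition good_approx :: "(nat \<Rightarrow> nat \<Rightarrow> 'w \<Rightarrow> 'h) \<Rightarrow> bool" where
  "good_approx v \<longleftrightarrow> (\<forall>n i. simple_function (F (real i / 2 ^ n)) (v n i)) \<and>
    (AE \<omega> in M. eventually (\<lambda>n. \<forall>i<n * 2 ^ n. norm (v n i \<omega> - Y (real i / 2 ^ n) \<omega>) \<le> \<delta> n) sequentially)"

text \<open>Each cell gets its own simple function with a small failure probability; Borel-Cantelli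
  then gives almost surely all cells at once from some \<open>n\<close> on.\<close>

lemma good_approx_exists: "\<exists>v. good_approx v"
proof -
  \<comment> \<open>The union over \<open>n * 2 ^ n\<close> cells has probability at most
    \<open>(1 / 2) ^ n\<close>, which is summable; the added 1 takes care of
    \<open>n = 0\<close>.\<close>
  define p where "p n = 1 / (real (n * 2 ^ n) + 1) * (1 / 2) ^ n" for n :: nat
  have p: "0 < p n" "0 < \<delta> n" for n
    by (simp_all add: p_def \<delta>_def add_nonneg_pos)
  let ?P = "\<lambda>n i g. simple_function (F (real i / 2 ^ n)) g \<and>
      {\<omega> \<in> space M. dist (g \<omega>) (Y (real i / 2 ^ n) \<omega>) > \<delta> n} \<in> sets M \<and>
      measure M {\<omega> \<in> space M. dist (g \<omega>) (Y (real i / 2 ^ n) \<omega>) > \<delta> n} < p n"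
  define v where "v n i = (SOME g. ?P n i g)" for n i
  have P: "?P n i (v n i)" for n i
  proof -
    have "\<exists>g. ?P n i g"
      by (intro simple_function_approx subalg Y_measurable_F p) auto
    then show ?thesis unfolding v_def by (rule someI_ex)
  qed
  then have v: "simple_function (F (real i / 2 ^ n)) (v n i)"
    and vm: "{\<omega> \<in> space M. dist (v n i \<omega>) (Y (real i / 2 ^ n) \<omega>) > \<delta> n} \<in> sets M"
    and vp: "measure M {\<omega> \<in> space M. dist (v n i \<omega>) (Y (real i / 2 ^ n) \<omega>) > \<delta> n} < p n" for n i
    by blast+
  define B where "B n = (\<Union>i<n * 2 ^ n. {\<omega> \<in> space M. dist (v n i \<omega>) (Y (real i / 2 ^ n) \<omega>) > \<delta> n})" for n
  have Bm: "B n \<in> sets M" for n unfolding B_def using vm by auto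
  have "measure M (B n) \<le> (1 / 2) ^ n" for n
  proof -
    have "measure M (B n) \<le> (\<Sum>i<n * 2 ^ n. measure M {\<omega> \<in> space M. dist (v n i \<omega>) (Y (real i / 2 ^ n) \<omega>) > \<delta> n})"
      unfolding B_def by (rule finite_measure_subadditive_finite) (use vm in auto)
    also have "\<dots> \<le> (\<Sum>i<n * 2 ^ n. p n)" by (intro sum_mono less_imp_le vp)
    also have "\<dots> = (real (n * 2 ^ n) / (real (n * 2 ^ n) + 1)) * (1 / 2) ^ n" by (simp add: p_def)
    also have "\<dots> \<le> 1 * (1 / 2) ^ n" by (intro mult_right_mono) (auto simp: divide_le_eq_1 add_nonneg_pos)
    finally show ?thesis by simp
  qed
  then have "summable (\<lambda>n. measure M (B n))"
    by (intro summable_comparison_test'[OF summable_geometric[of "1 / 2 :: real"]]) auto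
  from borel_cantelli_AE1[OF Bm _ this]
  have "AE \<omega> in M. eventually (\<lambda>n. \<omega> \<in> space M - B n) sequentially"
    by (simp add: emeasure_eq_measure)
  then have "AE \<omega> in M. eventually (\<lambda>n. \<forall>i<n * 2 ^ n. norm (v n i \<omega> - Y (real i / 2 ^ n) \<omega>) \<le> \<delta> n) sequentially"
    by eventually_elim (auto elim!: eventually_mono simp: B_def dist_norm not_less)
  then show ?thesis using v unfolding good_approx_def by blast
qed

section \<open>Elementary integrands approximating the diffusion coefficient\<close>

context
  fixes v :: "nat \<Rightarrow> nat \<Rightarrow> 'w \<Rightarrow> 'h"
  assumes v: "good_approx v"
begin

lemma v_simple: "simple_function (F (real i / 2 ^ n)) (v n i)"
  using v by (simp add: good_approx_def)

lemma v_measurable [measurable]: "v n i \<in> borel_measurable M"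
  by (rule measurable_F_M[OF _ borel_measurable_simple_function[OF v_simple]]) simp

lemma v_elementary:
  "elementary_integrand M F (n * 2 ^ n) (\<lambda>i. real i / 2 ^ n) (\<lambda>i \<omega>. diffusion \<eta> (v n i \<omega>))"
  unfolding elementary_integrand_def
proof (intro conjI allI impI)
  fix i
  have sf: "simple_function (F (real i / 2 ^ n)) (\<lambda>\<omega>. diffusion \<eta> (v n i \<omega>))"
    by (rule simple_function_compose1[OF v_simple])
  show "finite ((\<lambda>\<omega>. diffusion \<eta> (v n i \<omega>)) ` space M)"
    using simple_functionD(1)[OF sf] by (simp add: space_F)
  show "{\<omega> \<in> space M. diffusion \<eta> (v n i \<omega>) = B} \<in> sets (F (real i / 2 ^ n))" for B
    using simple_functionD(2)[OF sf, of "{B}"] by (simp add: space_F vimage_def Int_def conj_commute)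
qed (auto intro: divide_right_mono)

lemma v_integrand:
  "sym_tensor (\<eta> h) (Y s \<omega>) - elementary_process (n * 2 ^ n) (\<lambda>i. real i / 2 ^ n) (\<lambda>i \<omega>. diffusion \<eta> (v n i \<omega>)) s \<omega> h
    = diffusion \<eta> (Y s \<omega> - (\<Sum>i<n * 2 ^ n. indicator {real i / 2 ^ n<..real (Suc i) / 2 ^ n} s *\<^sub>R v n i \<omega>)) h"
  by (simp add: elementary_process_def blinfun.sum_left scaleR_blinfun.rep_eq diffusion.rep_eq
      sym_tensor.diff_right sym_tensor.sum_right sym_tensor.scaleR_right)

lemma v_integrand_null:
  assumes T: "0 \<le> T"
  shows "null_in_prob M (\<lambda>n \<omega>. \<integral>\<^sup>+s\<in>{0..T}. cov_norm_sq Q (\<lambda>h. sym_tensor (\<eta> h) (Y s \<omega>)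
    - elementary_process (n * 2 ^ n) (\<lambda>i. real i / 2 ^ n) (\<lambda>i \<omega>. diffusion \<eta> (v n i \<omega>)) s \<omega> h) \<partial>lborel)"
  unfolding v_integrand
proof (rule AE_tendsto_null_in_prob)
  let ?G = "\<lambda>u. cov_norm_sq Q (diffusion \<eta> u)"
  let ?S = "\<lambda>n s \<omega>. \<Sum>i<n * 2 ^ n. indicator {real i / 2 ^ n<..real (Suc i) / 2 ^ n} s *\<^sub>R v n i \<omega>"
  obtain c where c: "nuclear_bound Q c" using trace_class_nuclear_bound[OF tr_class] by blast
  then have c0: "0 \<le> c" by (simp add: nuclear_bound_def)
  show "AE \<omega> in M. (\<lambda>n. \<integral>\<^sup>+s\<in>{0..T}. ?G (Y s \<omega> - ?S n s \<omega>) \<partial>lborel) \<longlonglongrightarrow> 0"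
    using path_AE v[unfolded good_approx_def, THEN conjunct2]
  proof eventually_elim
    case (elim \<omega>)
    interpret ito_path A "cov_hs \<eta>" "\<lambda>t. Y t \<omega>" "\<lambda>t. J t \<omega>" by (rule elim)
    show ?case
      by (rule step_approx_integral[OF T _ cov_norm_sq_diffusion_le[OF c]])
         (use elim(2) c0 in \<open>auto simp: \<delta>_def\<close>)
  qed
  fix n
  have id: "(\<lambda>(\<omega>, s). (s, \<omega>)) \<in> measurable (M \<Otimes>\<^sub>M lborel) (borel \<Otimes>\<^sub>M F T)"
    using measurable_F_M[OF T measurable_ident] unfolding case_prod_unfold
    by (intro measurable_Pair) (auto intro: measurable_compose[OF measurable_fst] simp: id_def)
  have Y [measurable]: "(\<lambda>(\<omega>, s). indicator {0..T} s *\<^sub>R Y s \<omega>) \<in> borel_measurable (M \<Otimes>\<^sub>M lborel)"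
    using measurable_compose[OF id predictable_measurable_pair[OF filtered Y_predictable T]]
    by (simp add: case_prod_unfold)
  note [measurable] = cov_norm_sq_diffusion_measurable[of Q \<eta>]
  \<comment> \<open>Joint measurability is available only for \<open>Y\<close> cut off at
    \<open>T\<close>; since the integrand is multiplied by the same indicator, the cut-off does not
    change the integral.\<close>
  have "(\<lambda>(\<omega>, s). ?G (indicator {0..T} s *\<^sub>R Y s \<omega> - ?S n s \<omega>) * indicator {0..T} s) \<in> borel_measurable (M \<Otimes>\<^sub>M lborel)"
    using Y unfolding case_prod_unfold by measurable
  from lborel.borel_measurable_nn_integral[OF this]
  have "(\<lambda>\<omega>. \<integral>\<^sup>+s\<in>{0..T}. ?G (indicator {0..T} s *\<^sub>R Y s \<omega> - ?S n s \<omega>) \<partial>lborel) \<in> borel_measurable M" .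
  also have "(\<lambda>\<omega>. \<integral>\<^sup>+s\<in>{0..T}. ?G (indicator {0..T} s *\<^sub>R Y s \<omega> - ?S n s \<omega>) \<partial>lborel)
    = (\<lambda>\<omega>. \<integral>\<^sup>+s\<in>{0..T}. ?G (Y s \<omega> - ?S n s \<omega>) \<partial>lborel)"
    by (intro ext nn_integral_cong) (auto split: split_indicator)
  finally show "(\<lambda>\<omega>. \<integral>\<^sup>+s\<in>{0..T}. ?G (Y s \<omega> - ?S n s \<omega>) \<partial>lborel) \<in> borel_measurable M" .
qed

text \<open>Once \<open>J\<close> is known to be \<open>\<eta> W\<close>, the elementary integrals
  are the sums treated in \<open>sum_approx_limit\<close> along almost every path, and
  \<open>QV_dyadic_AE\<close> supplies its hypothesis on the quadratic variation.\<close>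

lemma v_integral_null:
  assumes t: "0 \<le> t"
  shows "null_in_prob M (\<lambda>n \<omega>. ennreal (norm (I t \<omega>
    - elementary_integral W (n * 2 ^ n) (\<lambda>i. real i / 2 ^ n) (\<lambda>i \<omega>. diffusion \<eta> (v n i \<omega>)) t \<omega>)))"
proof (rule AE_tendsto_null_in_prob)
  let ?\<sigma> = "\<lambda>n i. min t (real i / 2 ^ n)"
  let ?E = "\<lambda>n \<omega>. \<Sum>i<n * 2 ^ n. sym_tensor (\<eta> (incr (?\<sigma> n i) (?\<sigma> n (Suc i)) \<omega>)) (v n i \<omega>)"
  have E: "elementary_integral W (n * 2 ^ n) (\<lambda>i. real i / 2 ^ n) (\<lambda>i \<omega>. diffusion \<eta> (v n i \<omega>)) t \<omega> = ?E n \<omega>" for n \<omega>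
    by (simp add: elementary_integral_def diffusion.rep_eq incr_def)
  show "(\<lambda>\<omega>. ennreal (norm (I t \<omega>
    - elementary_integral W (n * 2 ^ n) (\<lambda>i. real i / 2 ^ n) (\<lambda>i \<omega>. diffusion \<eta> (v n i \<omega>)) t \<omega>))) \<in> borel_measurable M" for n
  proof -
    have [measurable]: "I t \<in> borel_measurable M" by (rule measurable_F_M[OF t I_measurable[OF t]])
    have "(\<lambda>\<omega>. sym_tensor (\<eta> (incr (?\<sigma> n i) (?\<sigma> n (Suc i)) \<omega>)) (v n i \<omega>)) \<in> borel_measurable M" for i
    proof (rule borel_measurable_continuous_Pair[of "incr (?\<sigma> n i) (?\<sigma> n (Suc i))" M "v n i" "\<lambda>x y. sym_tensor (\<eta> x) y"])
      show "incr (?\<sigma> n i) (?\<sigma> n (Suc i)) \<in> borel_measurable M"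
        using t by (intro incr_measurable min.mono divide_right_mono order_refl) auto
      show "continuous_on UNIV (\<lambda>x. sym_tensor (\<eta> (fst x)) (snd x))"
        by (intro sym_tensor.continuous_on continuous_on_snd continuous_on_id
            bounded_linear.continuous_on[OF blinfun.bounded_linear_right] continuous_on_fst)
    qed measurable
    then have [measurable]: "?E n \<in> borel_measurable M" by (intro borel_measurable_sum)
    show ?thesis unfolding E by measurable
  qed
  show "AE \<omega> in M. (\<lambda>n. ennreal (norm (I t \<omega>
    - elementary_integral W (n * 2 ^ n) (\<lambda>i. real i / 2 ^ n) (\<lambda>i \<omega>. diffusion \<eta> (v n i \<omega>)) t \<omega>))) \<longlonglongrightarrow> 0"
    using path_AE v[unfolded good_approx_def, THEN conjunct2] QV_dyadic_AE[OF t, of \<eta>] J_eq_AE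
  proof eventually_elim
    case (elim \<omega>)
    interpret ito_path A "cov_hs \<eta>" "\<lambda>t. Y t \<omega>" "\<lambda>t. J t \<omega>" by (rule elim)
    have d: "J (?\<sigma> n (Suc i)) \<omega> - J (?\<sigma> n i) \<omega> = \<eta> (incr (?\<sigma> n i) (?\<sigma> n (Suc i)) \<omega>)" for n i
    proof -
      have "J (?\<sigma> n j) \<omega> = \<eta> (incr 0 (?\<sigma> n j) \<omega>)" for j
        using elim(4) t by simp
      then show ?thesis by (simp only: incr_def blinfun.diff_right) simp
    qed
    have "(\<lambda>n. \<Sum>i<n * 2 ^ n. sym_tensor (J (?\<sigma> n (Suc i)) \<omega> - J (?\<sigma> n i) \<omega>) (v n i \<omega>)) \<longlonglongrightarrow> I t \<omega>"
      unfolding I_def V_drift_path[OF elim(1), symmetric, THEN fun_cong]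
      by (rule sum_approx_limit[OF t elim(2)[unfolded \<delta>_def]]) (unfold d, rule elim(3))
    then have "(\<lambda>n. ?E n \<omega>) \<longlonglongrightarrow> I t \<omega>" unfolding d .
    then have "(\<lambda>n. norm (I t \<omega> - ?E n \<omega>)) \<longlonglongrightarrow> norm (I t \<omega> - I t \<omega>)"
      by (intro tendsto_norm tendsto_diff tendsto_const)
    from tendsto_ennrealI[OF this] show ?case unfolding E by simp
  qed
qed

end

lemma I_stochastic_integral: "stochastic_integral M F Q W (\<lambda>t \<omega> f. sym_tensor (\<eta> f) (Y t \<omega>)) I"
proof -
  obtain v where v: "good_approx v" using good_approx_exists by blast
  obtain c where c: "nuclear_bound Q c" using trace_class_nuclear_bound[OF tr_class] by blast
  then have c0: "0 \<le> c" by (simp add: nuclear_bound_def)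
  have \<Phi>: "(\<lambda>f. sym_tensor (\<eta> f) u) = diffusion \<eta> u" for u by (simp add: diffusion.rep_eq)
  show ?thesis
    unfolding stochastic_integral_def
  proof (intro conjI allI ballI impI)
    show "bounded_linear (\<lambda>f. sym_tensor (\<eta> f) (Y t \<omega>))" for t \<omega>
      unfolding \<Phi> by (rule blinfun.bounded_linear_right)
    show "predictable M F (\<lambda>t \<omega>. sym_tensor (\<eta> h) (Y t \<omega>))" for h
      by (rule predictable_compose[OF Y_predictable])
         (intro borel_measurable_continuous_onI linear_continuous_on sym_tensor.bounded_linear_right)
    show "AE \<omega> in M. (\<integral>\<^sup>+s\<in>{0..T}. cov_norm_sq Q (\<lambda>f. sym_tensor (\<eta> f) (Y s \<omega>)) \<partial>lborel) < \<infinity>"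
      if T: "0 \<le> T" for T
      using path_AE
    proof eventually_elim
      case (elim \<omega>)
      interpret ito_path A "cov_hs \<eta>" "\<lambda>t. Y t \<omega>" "\<lambda>t. J t \<omega>" by (rule elim)
      obtain R where R: "0 < R" "\<And>r. 0 \<le> r \<Longrightarrow> r \<le> T \<Longrightarrow> norm (Y r \<omega>) \<le> R"
        using bounded_interval[OF y_cont] by blast
      let ?K = "4 * (norm \<eta>)\<^sup>2 * c * R\<^sup>2"
      have "cov_norm_sq Q (diffusion \<eta> (Y s \<omega>)) \<le> ennreal ?K" if "0 \<le> s" "s \<le> T" for s
        by (rule order_trans[OF cov_norm_sq_diffusion_le[OF c]])
           (use R that c0 in \<open>auto intro!: ennreal_leI mult_left_mono power_mono\<close>)
      then have "(\<integral>\<^sup>+s\<in>{0..T}. cov_norm_sq Q (diffusion \<eta> (Y s \<omega>)) \<partial>lborel)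
          \<le> (\<integral>\<^sup>+s. ennreal ?K * indicator {0..T} s \<partial>lborel)"
        by (intro nn_integral_mono) (auto split: split_indicator)
      also have "\<dots> < \<infinity>"
        using T by (subst nn_integral_cmult_indicator) (auto simp: ennreal_mult_less_top)
      finally show ?case unfolding \<Phi> .
    qed
    show "I t \<in> borel_measurable (F t)" if "0 \<le> t" for t by (rule I_measurable[OF that])
    show "AE \<omega> in M. continuous_on {0..} (\<lambda>t. I t \<omega>)"
      using path_AE
    proof eventually_elim
      case (elim \<omega>)
      interpret ito_path A "cov_hs \<eta>" "\<lambda>t. Y t \<omega>" "\<lambda>t. J t \<omega>" by (rule elim)
      show ?case
        unfolding I_def V_drift_path[OF elim, symmetric, THEN fun_cong]
        by (intro continuous_on_diff continuous_on_const htensor.continuous_on y_cont set_integral_continuous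
            integrable_interval drift_cont) auto
    qed
    show "\<exists>N \<tau> C. (\<forall>n. elementary_integrand M F (N n) (\<tau> n) (C n)) \<and>
        (\<forall>T\<ge>0. null_in_prob M (\<lambda>n \<omega>. \<integral>\<^sup>+s\<in>{0..T}.
           cov_norm_sq Q (\<lambda>h. sym_tensor (\<eta> h) (Y s \<omega>) - elementary_process (N n) (\<tau> n) (C n) s \<omega> h) \<partial>lborel)) \<and>
        (\<forall>t\<ge>0. null_in_prob M (\<lambda>n \<omega>.
           ennreal (norm (I t \<omega> - elementary_integral W (N n) (\<tau> n) (C n) t \<omega>))))"
      using v_elementary[OF v] v_integrand_null[OF v] v_integral_null[OF v]
      by (intro exI[of _ "\<lambda>n. n * 2 ^ n"] exI[of _ "\<lambda>n i. real i / 2 ^ n"]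
          exI[of _ "\<lambda>n i \<omega>. diffusion \<eta> (v n i \<omega>)"] conjI allI impI)
  qed
qed

lemma V_differential:
  "ito_differential M F Q W (\<lambda>t \<omega>. htensor (Y t \<omega>) (Y t \<omega>)) V_drift (\<lambda>t \<omega> f. sym_tensor (\<eta> f) (Y t \<omega>))"
  unfolding ito_differential_def
proof (intro conjI exI[of _ I] V_predictable V_drift_predictable I_stochastic_integral)
  show "AE \<omega> in M. \<forall>t\<ge>0. set_integrable lborel {0..t} (\<lambda>s. V_drift s \<omega>) \<and>
      htensor (Y t \<omega>) (Y t \<omega>) = htensor (Y 0 \<omega>) (Y 0 \<omega>) + (LINT s:{0..t}|lborel. V_drift s \<omega>) + I t \<omega>"
    using path_AE
  proof eventually_elim
    case (elim \<omega>)
    interpret ito_path A "cov_hs \<eta>" "\<lambda>t. Y t \<omega>" "\<lambda>t. J t \<omega>" by (rule elim)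
    show ?case
      using integrable_interval(1)[OF drift_cont order_refl] unfolding V_drift_path[OF elim] by (simp add: I_def)
  qed
qed

end

theorem proposition12:
  fixes M :: "'w measure" and F :: "real \<Rightarrow> 'w measure"
    and W Y :: "real \<Rightarrow> 'w \<Rightarrow> 'h::{real_inner,banach,second_countable_topology}"
    and Q \<eta> A :: "'h \<Rightarrow>\<^sub>L 'h" and Y0 :: 'h
  assumes "filtered_prob_space M F"
    and "symmetric_operator Q" and "positive_definite Q" and "trace_class Q"
    and "wiener_process M F Q W"
    and "AE \<omega> in M. Y 0 \<omega> = Y0"
    and "ito_differential M F Q W Y (\<lambda>t \<omega>. A (Y t \<omega>)) (\<lambda>t \<omega>. blinfun_apply \<eta>)"
  shows "(\<forall>t\<ge>0. \<forall>\<omega>\<in>space M. hilbert_schmidt (variance_drift A \<eta> Q Y t \<omega>)) \<and>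
    ito_differential M F Q W
      (\<lambda>t \<omega>. hs_of (variance_process Y t \<omega>))
      (\<lambda>t \<omega>. hs_of (variance_drift A \<eta> Q Y t \<omega>))
      (\<lambda>t \<omega> f. hs_of (variance_diffusion \<eta> Y t \<omega> f))"
proof -
  from assms(7) obtain J where J: "predictable M F Y" "stochastic_integral M F Q W (\<lambda>t \<omega>. blinfun_apply \<eta>) J"
    "AE \<omega> in M. \<forall>t\<ge>0. set_integrable lborel {0..t} (\<lambda>s. A (Y s \<omega>)) \<and>
      Y t \<omega> = Y 0 \<omega> + (LINT s:{0..t}|lborel. A (Y s \<omega>)) + J t \<omega>"
    unfolding ito_differential_def by blast
  interpret prob_space M using assms(1) by (simp add: filtered_prob_space_def)
  interpret ornstein_uhlenbeck M F Q W A \<eta> Y J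
    by unfold_locales (fact assms J)+
  \<comment> \<open>\<open>variance_drift_eq\<close> writes the drift as a value of
    \<open>hs_op\<close>: this lets \<open>hs_of\<close> cancel here and also yields the
    Hilbert-Schmidt claim below.\<close>
  have "(\<lambda>t \<omega>. hs_of (variance_drift A \<eta> Q Y t \<omega>)) = V_drift"
    by (simp add: variance_drift_eq[OF assms(4)] hs_op_inverse V_drift_def cov_hs_def fun_eq_iff)
  then show ?thesis
    using V_differential
    by (simp add: variance_drift_eq[OF assms(4)] hs_of_variance_process hs_of_variance_diffusion)
qed

end
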